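(* Let $M$ be a smooth manifold and $\mathbb E$ a finite-dimensional Banach space. If $f$ is a Lipschitz-vector-field structure on $M$ modelled by $\mathbb E$ and $N:M\times\mathbb E\to[0,+\infty)$ is a continuously varying norm, then, for every $p,q\in M$, $$d_{(f,N)}(p,q)=\inf\Big\{\int_a^b|\gamma'(t)|_{(f,N)}\,dt:\ \gamma:[a,b]\to M\text{ absolutely continuous, with }\gamma(a)=p,\ \gamma(b)=q\Big\}.$$
   Context: A Lipschitz-vector-field structure $f$ on $M$ modelled by $\mathbb E$ is a locally Lipschitz section of the bundle $\mathbb E^*\otimes TM$, i.e. a choice for each $p\in M$ of a linear map $f|_p:\mathbb E\to T_pM$ which is locally Lipschitz in $p$ (in coordinates trivializing the bundle); write $f(p,v)=f|_p[v]$. A continuously varying norm is a continuous function $N:M\times\mathbb E\to[0,+\infty)$ such that each $N(p,\cdot)$ is a norm. For $o\in M$ and $u\in L^\infty([0,1];\mathbb E)$, let $\gamma_{(o,f,u)}:[0,1]\to M$ be the absolutely continuous solution of $\gamma'(t)=f|_{\gamma(t)}[u(t)]$ for a.e. $t$, $\gamma(0)=o$, whenever it exists on $[0,1]$, and $\mathrm{End}^f_o(u):=\gamma_{(o,f,u)}(1)$. The energy is $J(o,f,u,N):=\operatorname{ess\,sup}_{t\in[0,1]}N(\gamma_{(o,f,u)}(t),u(t))$, and $$d_{(f,N)}(p,q):=\inf\{J(p,f,u,N):u\in L^\infty([0,1];\mathbb E),\ \mathrm{End}^f_p(u)=q\}\in[0,+\infty].$$ For $p\in M$, $v\in T_pM$,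 $|v|_{(f,N)}:=\inf\{N(p,u):u\in\mathbb E,\ f(p,u)=v\}$. Throughout $\inf\emptyset=+\infty$. *)

theory Defs
  imports "HOL-Analysis.Analysis" "HOL-Probability.Essential_Supremum"
begin

section \<open>Smooth manifolds\<close>

text \<open>
  The manifold is the whole type \<open>'m\<close> with its type-class topology. The model space \<open>'b\<close>
  is a finite-dimensional Banach space rather than a \<open>euclidean_space\<close>, so that
  dimension zero is not excluded. A chart is a pair of its domain and its coordinate map; the
  values of the latter outside the domain are irrelevant.
\<close>

type_synonym ('m, 'b) chart = "'m set \<times> ('m \<Rightarrow> 'b)"

abbreviation chart_dom :: "('m, 'b) chart \<Rightarrow> 'm set" where
  "chart_dom c \<equiv> fst c"

abbreviation chart_map :: "('m, 'b) chart \<Rightarrow> 'm \<Rightarrow> 'b" where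
  "chart_map c \<equiv> snd c"

abbreviation chart_inv :: "('m, 'b) chart \<Rightarrow> 'b \<Rightarrow> 'm" where
  "chart_inv c \<equiv> inv_into (chart_dom c) (chart_map c)"

definition is_chart :: "('m::topological_space, 'b::real_normed_vector) chart \<Rightarrow> bool" where
  "is_chart c \<longleftrightarrow> open (chart_dom c) \<and> open (chart_map c ` chart_dom c) \<and>
     homeomorphism (chart_dom c) (chart_map c ` chart_dom c) (chart_map c) (chart_inv c)"

definition transition :: "('m, 'b) chart \<Rightarrow> ('m, 'b) chart \<Rightarrow> 'b \<Rightarrow> 'b" where
  "transition c d = chart_map d \<circ> chart_inv c"

text \<open>
  \<open>Ck_on k S g\<close>: \<open>g\<close> is \<open>k\<close> times continuously differentiable on the open set \<open>S\<close>. Since the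
  source is finite-dimensional, it is enough to iterate directional derivatives of
  differentiable maps.
\<close>

primrec Ck_on :: "nat \<Rightarrow> 'a::real_normed_vector set \<Rightarrow> ('a \<Rightarrow> 'b::real_normed_vector) \<Rightarrow> bool" where
  "Ck_on 0 S g \<longleftrightarrow> continuous_on S g"
| "Ck_on (Suc k) S g \<longleftrightarrow> (\<forall>x\<in>S. g differentiable at x) \<and>
     (\<forall>v. Ck_on k S (\<lambda>x. frechet_derivative g (at x) v))"

definition smooth_on :: "'a::real_normed_vector set \<Rightarrow> ('a \<Rightarrow> 'b::real_normed_vector) \<Rightarrow> bool" where
  "smooth_on S g \<longleftrightarrow> (\<forall>k. Ck_on k S g)"

definition smooth_atlas :: "('m::topological_space, 'b::real_normed_vector) chart set \<Rightarrow> bool" where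
  "smooth_atlas A \<longleftrightarrow>
     (\<forall>c\<in>A. is_chart c) \<and> (\<Union>c\<in>A. chart_dom c) = UNIV \<and>
     (\<forall>c\<in>A. \<forall>d\<in>A. smooth_on (chart_map c ` (chart_dom c \<inter> chart_dom d)) (transition c d))"

text \<open>
  A tangent vector at \<open>p\<close> is the family of its coordinate expressions in the charts around \<open>p\<close>,
  which transform by the derivatives of the transition maps. The family is \<open>0\<close> at all other
  charts, so that equality of tangent vectors is equality of functions, and the vector space
  structure of the tangent space is the pointwise one.
\<close>

type_synonym ('m, 'b) tvec = "('m, 'b) chart \<Rightarrow> 'b"

definition tangent_space ::
    "('m::topological_space, 'b::real_normed_vector) chart set \<Rightarrow> 'm \<Rightarrow> ('m, 'b) tvec set" where
  "tangent_space A p = {v.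
     (\<forall>c. \<not> (c \<in> A \<and> p \<in> chart_dom c) \<longrightarrow> v c = 0) \<and>
     (\<forall>c\<in>A. \<forall>d\<in>A. p \<in> chart_dom c \<inter> chart_dom d \<longrightarrow>
        v d = frechet_derivative (transition c d) (at (chart_map c p)) (v c))}"

section \<open>Absolutely continuous curves\<close>

definition abs_cont :: "real \<Rightarrow> real \<Rightarrow> (real \<Rightarrow> 'b::metric_space) \<Rightarrow> bool" where
  "abs_cont a b g \<longleftrightarrow> (\<forall>\<epsilon>>0. \<exists>\<delta>>0. \<forall>I.
     finite I \<and> (\<forall>(s, t)\<in>I. a \<le> s \<and> s \<le> t \<and> t \<le> b) \<and>
     pairwise (\<lambda>(s, t) (s', t'). {s<..<t} \<inter> {s'<..<t'} = {}) I \<and>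
     (\<Sum>(s, t)\<in>I. t - s) < \<delta>
     \<longrightarrow> (\<Sum>(s, t)\<in>I. dist (g s) (g t)) < \<epsilon>)"

definition abs_cont_curve ::
    "('m::topological_space, 'b::real_normed_vector) chart set \<Rightarrow> real \<Rightarrow> real \<Rightarrow> (real \<Rightarrow> 'm) \<Rightarrow> bool" where
  "abs_cont_curve A a b \<gamma> \<longleftrightarrow> continuous_on {a..b} \<gamma> \<and>
     (\<forall>c\<in>A. \<forall>s t. a \<le> s \<and> s \<le> t \<and> t \<le> b \<and> \<gamma> ` {s..t} \<subseteq> chart_dom c
        \<longrightarrow> abs_cont s t (chart_map c \<circ> \<gamma>))"

definition has_velocity ::
    "('m::topological_space, 'b::real_normed_vector) chart set \<Rightarrow> (real \<Rightarrow> 'm) \<Rightarrow> ('m, 'b) tvec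
      \<Rightarrow> real \<Rightarrow> real set \<Rightarrow> bool" where
  "has_velocity A \<gamma> v t S \<longleftrightarrow> v \<in> tangent_space A (\<gamma> t) \<and>
     (\<forall>c\<in>A. \<gamma> t \<in> chart_dom c \<longrightarrow>
        ((chart_map c \<circ> \<gamma>) has_vector_derivative v c) (at t within S))"

text \<open>
  The value of \<open>velocity\<close> is only meaningful where \<open>\<gamma>\<close> is differentiable, which is almost
  everywhere if \<open>\<gamma>\<close> is absolutely continuous.
\<close>

definition velocity ::
    "('m::topological_space, 'b::real_normed_vector) chart set \<Rightarrow> (real \<Rightarrow> 'm) \<Rightarrow> real set
      \<Rightarrow> real \<Rightarrow> ('m, 'b) tvec" where
  "velocity A \<gamma> S t = (\<lambda>c. if c \<in> A \<and> \<gamma> t \<in> chart_dom c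
     then vector_derivative (chart_map c \<circ> \<gamma>) (at t within S) else 0)"

section \<open>Lipschitz-vector-field structures and continuously varying norms\<close>

text \<open>
  \<open>f p u c\<close> is the expression in the chart \<open>c\<close> of the tangent vector \<open>f(p,u)\<close>. Local Lipschitz
  continuity is that of the coordinate expression of \<open>p \<mapsto> f|\<^sub>p\<close>, with values in the space of linear
  maps with the operator norm (linear maps on the finite-dimensional space \<open>'e\<close> are
  bounded, so \<open>Blinfun\<close> is applied meaningfully).
\<close>

definition lipschitz_vf_structure ::
    "('m::topological_space, 'b::real_normed_vector) chart set
      \<Rightarrow> ('m \<Rightarrow> 'e::real_normed_vector \<Rightarrow> ('m, 'b) tvec) \<Rightarrow> bool" where
  "lipschitz_vf_structure A f \<longleftrightarrow>
     (\<forall>p u. f p u \<in> tangent_space A p) \<and>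
     (\<forall>p. \<forall>c. linear (\<lambda>u. f p u c)) \<and>
     (\<forall>c\<in>A. \<forall>x\<in>chart_map c ` chart_dom c. \<exists>r>0. \<exists>L.
        L-lipschitz_on (cball x r \<inter> chart_map c ` chart_dom c)
          (\<lambda>y. Blinfun (\<lambda>u. f (chart_inv c y) u c)))"

definition is_norm :: "('e::real_vector \<Rightarrow> real) \<Rightarrow> bool" where
  "is_norm n \<longleftrightarrow> (\<forall>u. 0 \<le> n u) \<and> (\<forall>u. n u = 0 \<longleftrightarrow> u = 0) \<and>
     (\<forall>r u. n (r *\<^sub>R u) = \<bar>r\<bar> * n u) \<and> (\<forall>u w. n (u + w) \<le> n u + n w)"

definition continuously_varying_norm ::
    "('m::topological_space \<Rightarrow> 'e::real_normed_vector \<Rightarrow> real) \<Rightarrow> bool" where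
  "continuously_varying_norm N \<longleftrightarrow>
     continuous_on UNIV (\<lambda>(p, u). N p u) \<and> (\<forall>p. is_norm (N p))"

section \<open>The distance and the infinitesimal length\<close>

definition Linf :: "(real \<Rightarrow> 'e::real_normed_vector) set" where
  "Linf = {u. u \<in> borel_measurable (lebesgue_on {0..1}) \<and>
     (\<exists>C. AE t in lebesgue_on {0..1}. norm (u t) \<le> C)}"

definition is_trajectory ::
    "('m::topological_space, 'b::real_normed_vector) chart set
      \<Rightarrow> ('m \<Rightarrow> 'e \<Rightarrow> ('m, 'b) tvec) \<Rightarrow> 'm \<Rightarrow> (real \<Rightarrow> 'e) \<Rightarrow> (real \<Rightarrow> 'm) \<Rightarrow> bool" where
  "is_trajectory A f p u \<gamma> \<longleftrightarrow> abs_cont_curve A 0 1 \<gamma> \<and> \<gamma> 0 = p \<and>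
     (AE t in lebesgue_on {0..1}. has_velocity A \<gamma> (f (\<gamma> t) (u t)) t {0..1})"

text \<open>
  Trajectories of a Lipschitz structure are unique on \<open>{0..1}\<close>; as functions on all reals they
  are not, whence \<open>SOME\<close> in place of \<open>THE\<close>.
\<close>

definition trajectory ::
    "('m::topological_space, 'b::real_normed_vector) chart set
      \<Rightarrow> ('m \<Rightarrow> 'e \<Rightarrow> ('m, 'b) tvec) \<Rightarrow> 'm \<Rightarrow> (real \<Rightarrow> 'e) \<Rightarrow> real \<Rightarrow> 'm" where
  "trajectory A f p u = (SOME \<gamma>. is_trajectory A f p u \<gamma>)"

definition End_point ::
    "('m::topological_space, 'b::real_normed_vector) chart set
      \<Rightarrow> ('m \<Rightarrow> 'e \<Rightarrow> ('m, 'b) tvec) \<Rightarrow> 'm \<Rightarrow> (real \<Rightarrow> 'e) \<Rightarrow> 'm option" where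
  "End_point A f p u =
     (if \<exists>\<gamma>. is_trajectory A f p u \<gamma> then Some (trajectory A f p u 1) else None)"

definition energy ::
    "('m::topological_space, 'b::real_normed_vector) chart set
      \<Rightarrow> ('m \<Rightarrow> 'e \<Rightarrow> ('m, 'b) tvec) \<Rightarrow> ('m \<Rightarrow> 'e \<Rightarrow> real) \<Rightarrow> 'm \<Rightarrow> (real \<Rightarrow> 'e) \<Rightarrow> ennreal" where
  "energy A f N p u =
     esssup (lebesgue_on {0..1}) (\<lambda>t. ennreal (N (trajectory A f p u t) (u t)))"

definition cc_dist ::
    "('m::topological_space, 'b::real_normed_vector) chart set
      \<Rightarrow> ('m \<Rightarrow> 'e::real_normed_vector \<Rightarrow> ('m, 'b) tvec) \<Rightarrow> ('m \<Rightarrow> 'e \<Rightarrow> real)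
      \<Rightarrow> 'm \<Rightarrow> 'm \<Rightarrow> ennreal" where
  "cc_dist A f N p q = Inf {energy A f N p u | u. u \<in> Linf \<and> End_point A f p u = Some q}"

definition speed ::
    "('m \<Rightarrow> 'e \<Rightarrow> ('m, 'b) tvec) \<Rightarrow> ('m \<Rightarrow> 'e \<Rightarrow> real) \<Rightarrow> 'm \<Rightarrow> ('m, 'b) tvec \<Rightarrow> ennreal" where
  "speed f N p v = Inf {ennreal (N p u) | u. f p u = v}"

text \<open>
  The integrand is Lebesgue measurable for an absolutely continuous curve, because \<open>speed f N\<close>
  is lower semicontinuous on the tangent bundle.
\<close>

definition curve_length ::
    "('m::topological_space, 'b::real_normed_vector) chart set
      \<Rightarrow> ('m \<Rightarrow> 'e \<Rightarrow> ('m, 'b) tvec) \<Rightarrow> ('m \<Rightarrow> 'e \<Rightarrow> real)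
      \<Rightarrow> real \<Rightarrow> real \<Rightarrow> (real \<Rightarrow> 'm) \<Rightarrow> ennreal" where
  "curve_length A f N a b \<gamma> =
     (\<integral>\<^sup>+ t. speed f N (\<gamma> t) (velocity A \<gamma> {a..b} t) \<partial>lebesgue_on {a..b})"

end

theory Submission
  imports Defs "HOL-Probability.Distribution_Functions"
begin

text \<open>
  \<^emph>\<open>Length is at most energy.\<close> Along the trajectory of a control \<open>u\<close> one has \<open>\<gamma>' = f(\<gamma>, u)\<close> almost
  everywhere, so \<open>u\<close> competes in the infimum that defines the speed of \<open>\<gamma>\<close>. Hence the speed is at
  most \<open>N(\<gamma>, u)\<close>, which is at most the energy, and \<open>\<gamma>\<close> is a curve on an interval of length \<open>1\<close>
  (\<open>curve_length_le_energy\<close>).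

  \<^emph>\<open>Energy is at most length.\<close> Let \<open>\<gamma>\<close> be an absolutely continuous curve of length less than \<open>\<Lambda>\<close>,
  and let \<open>w\<close> be a function slightly above its speed whose integral is still less than \<open>\<Lambda>\<close>. If \<open>\<gamma>\<close>
  is run through at a rate \<open>\<sigma>'\<close> with \<open>\<sigma>' w(\<sigma>) \<le> \<Lambda>\<close>, then it becomes a curve on \<open>[0,1]\<close> whose speed
  is at most \<open>\<Lambda>\<close>. A measurable choice of controls \<open>u\<close> that produce its velocity with
  \<open>N(\<gamma>, u) \<le> \<Lambda>\<close> then gives a bounded control of energy at most \<open>\<Lambda>\<close>
  (\<open>cc_dist_le_curve_length\<close>). Four ingredients make this precise.

  \<^item> Absolutely continuous functions with values in a finite-dimensional space are differentiable
    almost everywhere (\<open>abs_cont_ae_differentiable\<close>). Without this the length of a curve would not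
    be determined by the curve. The proof applies the Vitali covering theorem twice.

  \<^item> The reparametrization (\<open>speed_reparametrization\<close>) inverts the integral of a lower
    semicontinuous majorant of \<open>w\<close>. Near each point such a majorant is almost as large as at that
    point, which bounds \<open>\<sigma>'\<close> wherever it exists. Preimages of null sets under \<open>\<sigma>\<close> are null
    because \<open>\<sigma>\<close> transports Lebesgue measure to a measure with a density.

  \<^item> The controls that produce the velocity at time \<open>t\<close> with norm at most \<open>\<Lambda>\<close> are the zeros
    of a function that is measurable in \<open>t\<close> and continuous in the control; such zeros can be
    selected measurably (\<open>measurable_zero_selection\<close>). The same description shows that the
    speed of a curve is a measurable function of time (\<open>speed_measurable\<close>).

  \<^item> The end point of a control refers to some trajectory, so the constructed curve has to be
    the only one (\<open>trajectory_unique\<close>). This follows from the local Lipschitz condition and a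
    mean value inequality for absolutely continuous functions (\<open>abs_cont_mean_value\<close>).
\<close>

section \<open>Absolutely continuous functions\<close>

text \<open>
  The hypothesis on \<open>I\<close> in the definition of \<open>abs_cont\<close>, except for the bound on the total length.
\<close>

definition interval_family :: "real \<Rightarrow> real \<Rightarrow> (real \<times> real) set \<Rightarrow> bool" where
  "interval_family a b I \<longleftrightarrow> finite I \<and> (\<forall>(s, t)\<in>I. a \<le> s \<and> s \<le> t \<and> t \<le> b) \<and>
     pairwise (\<lambda>(s, t) (s', t'). {s<..<t} \<inter> {s'<..<t'} = {}) I"

lemma abs_cont_iff:
  "abs_cont a b g \<longleftrightarrow> (\<forall>\<epsilon>>0. \<exists>\<delta>>0. \<forall>I. interval_family a b I \<longrightarrow>
     (\<Sum>(s, t)\<in>I. t - s) < \<delta> \<longrightarrow> (\<Sum>(s, t)\<in>I. dist (g s) (g t)) < \<epsilon>)"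
  by (simp only: abs_cont_def interval_family_def conj_assoc imp_conjL)

lemma abs_contD:
  assumes "abs_cont a b g" "\<epsilon> > 0"
  obtains \<delta> where "\<delta> > 0" "\<And>I. interval_family a b I \<Longrightarrow> (\<Sum>(s, t)\<in>I. t - s) < \<delta>
    \<Longrightarrow> (\<Sum>(s, t)\<in>I. dist (g s) (g t)) < \<epsilon>"
  using assms unfolding abs_cont_iff by blast

text \<open>
  Absolute continuity in the language of divisions, which can be extended to divisions of a whole
  interval, and over which increments telescope.
\<close>

lemma abs_cont_intervals:
  fixes g :: "real \<Rightarrow> 'b::metric_space"
  assumes "abs_cont a b g" "\<epsilon> > 0"
  obtains \<delta> where "\<delta> > 0"
    "\<And>F. F division_of \<Union>F \<Longrightarrow> \<Union>F \<subseteq> {a..b} \<Longrightarrow> sum (measure lborel) F < \<delta>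
      \<Longrightarrow> (\<Sum>K\<in>F. dist (g (Inf K)) (g (Sup K))) < \<epsilon>"
proof -
  obtain \<delta> where \<delta>: "\<delta> > 0" and ac: "\<And>I. interval_family a b I \<Longrightarrow>
     (\<Sum>(s, t)\<in>I. t - s) < \<delta> \<Longrightarrow> (\<Sum>(s, t)\<in>I. dist (g s) (g t)) < \<epsilon>"
    using abs_contD[OF assms] by blast
  show ?thesis
  proof (rule that[OF \<delta>])
    fix F :: "real set set"
    assume F: "F division_of \<Union>F" and sub: "\<Union>F \<subseteq> {a..b}" and len: "sum (measure lborel) F < \<delta>"
    define e where "e = (\<lambda>K::real set. (Inf K, Sup K))"
    have K: "\<exists>x y. K = {x..y} \<and> x \<le> y" if "K \<in> F" for K
      using division_ofD(3,4)[OF F that] by (metis atLeastatMost_empty_iff cbox_interval)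
    have KI: "K = {Inf K..Sup K}" "Inf K \<le> Sup K" if "K \<in> F" for K
      using K[OF that] by auto
    have inj: "inj_on e F"
      by (rule inj_on_inverseI[of _ "\<lambda>(s, t). {s..t}"]) (simp add: e_def KI(1)[symmetric])
    have fin: "finite (e ` F)" using F by auto
    have 1: "\<forall>(s, t)\<in>e ` F. a \<le> s \<and> s \<le> t \<and> t \<le> b"
    proof
      fix p assume "p \<in> e ` F"
      then obtain K where K: "K \<in> F" "p = (Inf K, Sup K)" by (auto simp: e_def)
      then have "{Inf K..Sup K} \<subseteq> {a..b}" "Inf K \<le> Sup K" using sub KI[of K] by auto
      then show "case p of (s, t) \<Rightarrow> a \<le> s \<and> s \<le> t \<and> t \<le> b" using K(2) by auto
    qed
    have 2: "pairwise (\<lambda>(s, t) (s', t'). {s<..<t} \<inter> {s'<..<t'} = {}) (e ` F)"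
      unfolding pairwise_image
    proof (rule pairwiseI)
      fix K1 K2 assume *: "K1 \<in> F" "K2 \<in> F" "K1 \<noteq> K2"
      have "interior K1 = {Inf K1<..<Sup K1}" "interior K2 = {Inf K2<..<Sup K2}"
        by (metis KI(1) * interior_atLeastAtMost_real)+
      then show "e K1 \<noteq> e K2 \<longrightarrow>
          (case e K1 of (s, t) \<Rightarrow> \<lambda>(s', t'). {s<..<t} \<inter> {s'<..<t'} = {}) (e K2)"
        using division_ofD(5)[OF F *] by (simp add: e_def)
    qed
    have "measure lborel K = Sup K - Inf K" if "K \<in> F" for K
      using K[OF that] by auto
    then have 3: "(\<Sum>(s, t)\<in>e ` F. t - s) = sum (measure lborel) F"
      by (subst sum.reindex[OF inj]) (auto simp: e_def)
    have 4: "(\<Sum>(s, t)\<in>e ` F. dist (g s) (g t)) = (\<Sum>K\<in>F. dist (g (Inf K)) (g (Sup K)))"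
      by (subst sum.reindex[OF inj], rule sum.cong) (auto simp: e_def)
    show "(\<Sum>K\<in>F. dist (g (Inf K)) (g (Sup K))) < \<epsilon>"
      using ac[of "e ` F"] fin 1 2 3 4 len by (simp add: interval_family_def)
  qed
qed

lemma abs_cont_subinterval:
  assumes "abs_cont a b g" "a \<le> c" "d \<le> b"
  shows "abs_cont c d g"
proof -
  have "interval_family a b I" if "interval_family c d I" for I
    using that assms(2,3) unfolding interval_family_def
    by (auto simp: split_beta intro: order_trans)
  then show ?thesis
    using assms(1) unfolding abs_cont_iff by meson
qed

lemma abs_cont_imp_continuous:
  fixes g :: "real \<Rightarrow> 'b::metric_space"
  assumes "abs_cont a b g"
  shows "continuous_on {a..b} g"
  unfolding continuous_on_iff
proof (intro ballI allI impI)
  fix x and e::real assume x: "x \<in> {a..b}" and e: "0 < e"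
  obtain \<delta> where \<delta>: "\<delta> > 0" and ac: "\<And>I. interval_family a b I \<Longrightarrow>
     (\<Sum>(s, t)\<in>I. t - s) < \<delta> \<Longrightarrow> (\<Sum>(s, t)\<in>I. dist (g s) (g t)) < e"
    using abs_contD[OF assms e] by blast
  have *: "dist (g s) (g t) < e" if "a \<le> s" "s \<le> t" "t \<le> b" "t - s < \<delta>" for s t
    using ac[of "{(s, t)}"] that by (simp add: interval_family_def)
  have "dist (g y) (g x) < e" if "y \<in> {a..b}" "dist y x < \<delta>" for y
    using *[of x y] *[of y x] that x by (cases "x \<le> y") (auto simp: dist_real_def dist_commute)
  then show "\<exists>d>0. \<forall>x'\<in>{a..b}. dist x' x < d \<longrightarrow> dist (g x') (g x) < e"
    using \<delta> by blast
qed

lemma additive_division_1: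
  fixes g :: "real \<Rightarrow> 'b::real_normed_vector"
  assumes "a \<le> b" "F division_of {a..b}"
  shows "(\<Sum>K\<in>F. g (Sup K) - g (Inf K)) = g b - g a"
proof -
  define p where "p = (\<lambda>K::real set. (Inf K, K)) ` F"
  have K: "\<exists>x y. K = {x..y} \<and> x \<le> y" if "K \<in> F" for K
    using division_ofD(3,4)[OF assms(2) that] by (metis atLeastatMost_empty_iff cbox_interval)
  have "p tagged_division_of {a..b}"
  proof (rule tagged_division_ofI)
    show "finite p" using assms(2) by (auto simp: p_def)
    fix x K assume "(x, K) \<in> p"
    then have KF: "K \<in> F" and x: "x = Inf K" by (auto simp: p_def)
    show "x \<in> K" using K[OF KF] x by auto
    show "K \<subseteq> {a..b}" "\<exists>a b. K = cbox a b" using division_ofD(2,4)[OF assms(2) KF] by auto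
    fix x2 K2 assume "(x2, K2) \<in> p" "(x, K) \<noteq> (x2, K2)"
    then have "K2 \<in> F" "K \<noteq> K2" using x by (auto simp: p_def)
    then show "interior K \<inter> interior K2 = {}" using division_ofD(5)[OF assms(2) KF] by auto
  next
    have "{K. \<exists>x. (x, K) \<in> p} = F" by (auto simp: p_def)
    then show "\<Union> {K. \<exists>x. (x, K) \<in> p} = {a..b}"
      using division_ofD(6)[OF assms(2)] by simp
  qed
  from additive_tagged_division_1[OF assms(1) this, of g]
  show ?thesis
    unfolding p_def by (subst (asm) sum.reindex) (auto simp: inj_on_def)
qed

text \<open>
  The form of the Vitali covering theorem that suits increments: finitely many disjoint intervals,
  since absolute continuity speaks about finite families only.
\<close>

lemma vitali_finite:
  fixes E W :: "real set"
  assumes E: "E \<in> lmeasurable" and W: "open W" "E \<subseteq> W"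
    and fine: "\<And>t d. t \<in> E \<Longrightarrow> d > 0 \<Longrightarrow> \<exists>x y. P x y \<and> x < y \<and> x \<le> t \<and> t \<le> y \<and> y - x < d"
    and "\<eta> > 0"
  obtains F where "finite F" "disjoint F"
    "\<And>K. K \<in> F \<Longrightarrow> \<exists>x y. K = {x..y} \<and> x < y \<and> P x y" "\<Union>F \<subseteq> W" "measure lebesgue (E - \<Union>F) < \<eta>"
proof -
  define k where "k = {(x,y). P x y \<and> x < y \<and> {x..y} \<subseteq> W}"
  define m where "m = (\<lambda>(x::real,y). (x+y)/2)"
  define r where "r = (\<lambda>(x::real,y). (y-x)/2)"
  have cb: "cball (m i) (r i) = {fst i..snd i}" for i
    by (cases i) (simp add: m_def r_def cball_eq_atLeastAtMost field_simps)
  have 1: "\<exists>i. i \<in> k \<and> t \<in> cball (m i) (r i) \<and> r i < d" if t: "t \<in> E" "0 < d" for t d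
  proof -
    obtain e where e: "e > 0" "ball t e \<subseteq> W" using W t by (meson openE subsetD)
    obtain x y where xy: "P x y" "x < y" "x \<le> t" "t \<le> y" "y - x < min d e"
      using fine[OF t(1), of "min d e"] e t by auto
    have "{x..y} \<subseteq> ball t e" using xy by (auto simp: dist_real_def)
    then have "(x,y) \<in> k" using xy e by (auto simp: k_def)
    then show ?thesis using xy unfolding cb by (intro exI[of _ "(x,y)"]) (auto simp: r_def)
  qed
  have 2: "0 < r i" if "i \<in> k" for i using that by (auto simp: k_def r_def)
  obtain C where C: "countable C" "C \<subseteq> k"
     "pairwise (\<lambda>i j. disjnt (cball (m i) (r i)) (cball (m j) (r j))) C"
     "negligible(E - (\<Union>i \<in> C. cball (m i) (r i)))"
    by (rule Vitali_covering_theorem_cballs[OF 2 1])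
  obtain F0 where F0: "finite F0" "F0 \<subseteq> C" "measure lebesgue (E - (\<Union>i \<in> F0. {fst i..snd i})) < \<eta>"
  proof (cases "C = {}")
    case True
    then have "measure lebesgue E = 0" using C(4) by (simp add: negligible_imp_measure0)
    then show ?thesis using that[of "{}"] \<open>\<eta> > 0\<close> by simp
  next
    case False
    \<comment> \<open>the countable cover is exhausted by finite ones, and \<open>E\<close> has finite measure\<close>
    define D where "D n = E - (\<Union>i \<in> from_nat_into C ` {..<n}. {fst i..snd i})" for n :: nat
    have Dm: "D n \<in> lmeasurable" for n
      unfolding D_def by (intro fmeasurable_Diff E sets.finite_UN) auto
    have "(\<lambda>n. measure lebesgue (D n)) \<longlonglongrightarrow> measure lebesgue (\<Inter>n. D n)"
    proof (rule Lim_measure_decseq)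
      show "range D \<subseteq> sets lebesgue" using Dm by (auto dest: fmeasurableD)
      show "decseq D" by (auto simp: decseq_def D_def)
      show "emeasure lebesgue (D i) \<noteq> \<infinity>" for i using fmeasurableD2[OF Dm] by simp
    qed
    moreover have "(\<Inter>n. D n) = E - (\<Union>i\<in>range (from_nat_into C). {fst i..snd i})"
      unfolding D_def by auto
    then have "(\<Inter>n. D n) = E - (\<Union>i\<in>C. {fst i..snd i})"
      using range_from_nat_into[OF False C(1)] by simp
    then have "measure lebesgue (\<Inter>n. D n) = 0"
      using C(4) unfolding cb by (simp add: negligible_imp_measure0)
    ultimately have "\<forall>\<^sub>F n in sequentially. measure lebesgue (D n) < \<eta>"
      using \<open>\<eta> > 0\<close> by (auto dest: order_tendstoD)
    then obtain n where "measure lebesgue (D n) < \<eta>" using eventually_happens by force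
    then show ?thesis
      by (intro that[of "from_nat_into C ` {..<n}"]) (auto simp: D_def from_nat_into[OF False])
  qed
  define F where "F = (\<lambda>i. {fst i..snd i}) ` F0"
  show ?thesis
  proof (rule that[of F])
    show "finite F" using F0 by (simp add: F_def)
    have "pairwise (\<lambda>i j. disjnt {fst i..snd i} {fst j..snd j}) F0"
      using C(3) F0(2) unfolding cb by (rule pairwise_subset)
    then show "disjoint F"
      unfolding F_def pairwise_image by (rule pairwise_mono) auto
    show "\<exists>x y. K = {x..y} \<and> x < y \<and> P x y" if "K \<in> F" for K
      using that F0(2) C(2) by (fastforce simp: F_def k_def)
    show "\<Union>F \<subseteq> W" using F0(2) C(2) by (fastforce simp: F_def k_def)
    show "measure lebesgue (E - \<Union>F) < \<eta>" using F0(3) by (simp add: F_def)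
  qed
qed

lemma disjoint_intervals_division:
  fixes F :: "real set set"
  assumes "finite F" "disjoint F" "\<And>K. K \<in> F \<Longrightarrow> \<exists>x y. K = {x..y} \<and> x < y"
  shows "F division_of \<Union>F" "sum (measure lborel) F = measure lebesgue (\<Union>F)" "\<Union>F \<in> lmeasurable"
proof -
  have *: "K \<noteq> {}" "\<exists>a b. K = cbox a b" "K \<in> lmeasurable" if "K \<in> F" for K
    using assms(3)[OF that] by auto
  show "F division_of \<Union>F"
  proof (rule division_ofI)
    fix K1 K2 assume "K1 \<in> F" "K2 \<in> F" "K1 \<noteq> K2"
    then have "K1 \<inter> K2 = {}" using assms(2) by (auto simp: pairwise_def disjnt_def)
    then show "interior K1 \<inter> interior K2 = {}" using interior_subset by blast
  qed (use assms(1) * in auto)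
  have "measure lebesgue (\<Union>F) = (\<Sum>K\<in>F. measure lebesgue K)"
    using measure_UNION'[of F "\<lambda>x. x" lebesgue] assms(1,2) * by simp
  then show "sum (measure lborel) F = measure lebesgue (\<Union>F)"
    using assms(3) by (auto intro!: sum.cong dest!: assms(3))
  show "\<Union>F \<in> lmeasurable" using assms(1) * by (intro fmeasurable.finite_Union) auto
qed

lemma abs_cont_uminus:
  fixes g :: "real \<Rightarrow> 'b::real_normed_vector"
  assumes "abs_cont a b g" shows "abs_cont a b (\<lambda>x. - g x)"
  using assms unfolding abs_cont_iff by (simp add: dist_minus)

lemma abs_cont_diff:
  fixes g h :: "real \<Rightarrow> 'b::real_normed_vector"
  assumes g: "abs_cont a b g" and h: "abs_cont a b h"
  shows "abs_cont a b (\<lambda>t. g t - h t)"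
  unfolding abs_cont_iff
proof (intro allI impI)
  fix \<epsilon> :: real assume "\<epsilon> > 0"
  then have e: "\<epsilon>/2 > 0" by simp
  obtain \<delta>1 where \<delta>1: "\<delta>1 > 0" "\<And>I. interval_family a b I \<Longrightarrow> (\<Sum>(s, t)\<in>I. t - s) < \<delta>1
      \<Longrightarrow> (\<Sum>(s, t)\<in>I. dist (g s) (g t)) < \<epsilon>/2"
    using abs_contD[OF g e] by blast
  obtain \<delta>2 where \<delta>2: "\<delta>2 > 0" "\<And>I. interval_family a b I \<Longrightarrow> (\<Sum>(s, t)\<in>I. t - s) < \<delta>2
      \<Longrightarrow> (\<Sum>(s, t)\<in>I. dist (h s) (h t)) < \<epsilon>/2"
    using abs_contD[OF h e] by blast
  have "(\<Sum>(s, t)\<in>I. dist (g s - h s) (g t - h t)) < \<epsilon>"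
    if I: "interval_family a b I" "(\<Sum>(s, t)\<in>I. t - s) < min \<delta>1 \<delta>2" for I
  proof -
    have "dist (g s - h s) (g t - h t) \<le> dist (g s) (g t) + dist (h s) (h t)" for s t
      using norm_triangle_ineq4[of "g s - g t" "h s - h t"] by (simp add: dist_norm algebra_simps)
    then have "(\<Sum>(s, t)\<in>I. dist (g s - h s) (g t - h t)) \<le> (\<Sum>(s, t)\<in>I. dist (g s) (g t)) + (\<Sum>(s, t)\<in>I. dist (h s) (h t))"
      unfolding sum.distrib[symmetric] by (intro sum_mono) (auto simp: split_beta)
    then show ?thesis using \<delta>1(2)[OF I(1)] \<delta>2(2)[OF I(1)] I(2) by simp
  qed
  then show "\<exists>\<delta>>0. \<forall>I. interval_family a b I \<longrightarrow> (\<Sum>(s, t)\<in>I. t - s) < \<delta> \<longrightarrow>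
      (\<Sum>(s, t)\<in>I. dist (g s - h s) (g t - h t)) < \<epsilon>"
    using \<delta>1(1) \<delta>2(1) by (intro exI[of _ "min \<delta>1 \<delta>2"]) auto
qed

lemma abs_cont_bounded_linear:
  assumes ac: "abs_cont a b g" and h: "bounded_linear h"
  shows "abs_cont a b (\<lambda>t. h (g t))"
  unfolding abs_cont_iff
proof (intro allI impI)
  fix \<epsilon> :: real assume "\<epsilon> > 0"
  obtain k where k: "k > 0" "\<And>v. norm (h v) \<le> norm v * k"
    using bounded_linear.pos_bounded[OF h] by blast
  obtain \<delta> where \<delta>: "\<delta> > 0" "\<And>I. interval_family a b I \<Longrightarrow> (\<Sum>(s, t)\<in>I. t - s) < \<delta>
      \<Longrightarrow> (\<Sum>(s, t)\<in>I. dist (g s) (g t)) < \<epsilon> / k"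
    using abs_contD[OF ac, of "\<epsilon> / k"] \<open>\<epsilon> > 0\<close> k(1) by auto
  have "(\<Sum>(s, t)\<in>I. dist (h (g s)) (h (g t))) < \<epsilon>"
    if I: "interval_family a b I" "(\<Sum>(s, t)\<in>I. t - s) < \<delta>" for I
  proof -
    have "dist (h v) (h w) \<le> dist v w * k" for v w
      using k(2)[of "v - w"] by (simp add: dist_norm bounded_linear.linear[OF h] linear_diff)
    then have "(\<Sum>(s, t)\<in>I. dist (h (g s)) (h (g t))) \<le> (\<Sum>(s, t)\<in>I. dist (g s) (g t)) * k"
      unfolding sum_distrib_right by (intro sum_mono) (auto simp: split_beta)
    also have "\<dots> < \<epsilon>" using \<delta>(2)[OF I] k(1) by (simp add: field_simps)
    finally show ?thesis .
  qed
  then show "\<exists>\<delta>>0. \<forall>I. interval_family a b I \<longrightarrow> (\<Sum>(s, t)\<in>I. t - s) < \<delta> \<longrightarrow>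
      (\<Sum>(s, t)\<in>I. dist (h (g s)) (h (g t))) < \<epsilon>"
    using \<delta>(1) by blast
qed

text \<open>
  A Lipschitz increasing change of parameter carries a nonoverlapping family to a nonoverlapping
  family, and multiplies its total length by at most the Lipschitz constant. Strict monotonicity
  keeps different intervals different.
\<close>

lemma abs_cont_compose_mono:
  fixes \<sigma> :: "real \<Rightarrow> real"
  assumes g: "abs_cont (\<sigma> a) (\<sigma> b) g"
    and \<sigma>: "\<And>x y. a \<le> x \<Longrightarrow> x < y \<Longrightarrow> y \<le> b \<Longrightarrow> \<sigma> x < \<sigma> y \<and> \<sigma> y - \<sigma> x \<le> K * (y - x)"
  shows "abs_cont a b (g \<circ> \<sigma>)"
  unfolding abs_cont_iff
proof (intro allI impI)
  fix \<epsilon> :: real assume "\<epsilon> > 0"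
  then obtain \<delta> where \<delta>: "\<delta> > 0" "\<And>I. interval_family (\<sigma> a) (\<sigma> b) I \<Longrightarrow> (\<Sum>(s, t)\<in>I. t - s) < \<delta>
      \<Longrightarrow> (\<Sum>(s, t)\<in>I. dist (g s) (g t)) < \<epsilon>"
    using abs_contD[OF g] by blast
  have le: "\<sigma> x \<le> \<sigma> y" if "a \<le> x" "x \<le> y" "y \<le> b" for x y
    using \<sigma>[of x y] that by (cases "x = y") auto
  have "(\<Sum>(s, t)\<in>I. dist ((g \<circ> \<sigma>) s) ((g \<circ> \<sigma>) t)) < \<epsilon>"
    if I: "interval_family a b I" and len: "(\<Sum>(s, t)\<in>I. t - s) < \<delta> / (\<bar>K\<bar> + 1)" for I
  proof -
    define h where "h = (\<lambda>(s::real, t). (\<sigma> s, \<sigma> t))"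
    have fin: "finite I" and mem: "\<And>s t. (s, t) \<in> I \<Longrightarrow> a \<le> s \<and> s \<le> t \<and> t \<le> b"
      and pw: "pairwise (\<lambda>(s, t) (s', t'). {s<..<t} \<inter> {s'<..<t'} = {}) I"
      using I unfolding interval_family_def by auto
    have inj\<sigma>: "x = y" if "\<sigma> x = \<sigma> y" "a \<le> x" "x \<le> b" "a \<le> y" "y \<le> b" for x y
      using \<sigma>[of x y] \<sigma>[of y x] that by (cases x y rule: linorder_cases) auto
    have inj: "inj_on h I"
    proof (rule inj_onI)
      fix p q assume pq: "p \<in> I" "q \<in> I" "h p = h q"
      obtain s t s' t' where st: "p = (s, t)" "q = (s', t')" by (cases p, cases q) auto
      show "p = q"
        using pq mem[of s t] mem[of s' t'] inj\<sigma>[of s s'] inj\<sigma>[of t t'] unfolding st by (auto simp: h_def)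
    qed
    have "interval_family (\<sigma> a) (\<sigma> b) (h ` I)"
      unfolding interval_family_def
    proof (intro conjI)
      show "finite (h ` I)" using fin by simp
      show "\<forall>(s, t)\<in>h ` I. \<sigma> a \<le> s \<and> s \<le> t \<and> t \<le> \<sigma> b"
        using mem by (auto simp: h_def intro!: le dest!: mem)
      show "pairwise (\<lambda>(s, t) (s', t'). {s<..<t} \<inter> {s'<..<t'} = {}) (h ` I)"
        unfolding pairwise_image
      proof (rule pairwiseI, rule impI)
        fix p q assume pq: "p \<in> I" "q \<in> I" "p \<noteq> q"
        obtain s t s' t' where st: "p = (s, t)" "q = (s', t')" by (cases p, cases q) auto
        have "{s<..<t} \<inter> {s'<..<t'} = {}" using pairwiseD[OF pw pq] unfolding st by simp
        then have "min t t' \<le> max s s'" by (simp add: Int_greaterThanLessThan)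
        then have "t \<le> s' \<or> t' \<le> s \<or> t \<le> s \<or> t' \<le> s'" by linarith
        moreover have "a \<le> s" "s \<le> t" "t \<le> b" "a \<le> s'" "s' \<le> t'" "t' \<le> b"
          using pq mem[of s t] mem[of s' t'] unfolding st by auto
        ultimately have "\<sigma> t \<le> \<sigma> s' \<or> \<sigma> t' \<le> \<sigma> s \<or> \<sigma> t \<le> \<sigma> s \<or> \<sigma> t' \<le> \<sigma> s'"
          using le[of t s'] le[of t' s] le[of t s] le[of t' s'] by linarith
        then show "(case h p of (s, t) \<Rightarrow> \<lambda>(s', t'). {s<..<t} \<inter> {s'<..<t'} = {}) (h q)"
          by (auto simp: st h_def)
      qed
    qed
    moreover have "(\<Sum>(s, t)\<in>h ` I. t - s) < \<delta>"
    proof -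
      have "(\<Sum>(s, t)\<in>h ` I. t - s) = (\<Sum>(s, t)\<in>I. \<sigma> t - \<sigma> s)"
        by (subst sum.reindex[OF inj]) (auto simp: h_def split_beta)
      also have "\<dots> \<le> (\<Sum>(s, t)\<in>I. (\<bar>K\<bar> + 1) * (t - s))"
      proof (rule sum_mono, clarify)
        fix s t assume st: "(s, t) \<in> I"
        show "\<sigma> t - \<sigma> s \<le> (\<bar>K\<bar> + 1) * (t - s)"
        proof (cases "s = t")
          case False
          then have "\<sigma> t - \<sigma> s \<le> K * (t - s)" using \<sigma>[of s t] mem[OF st] by auto
          also have "\<dots> \<le> (\<bar>K\<bar> + 1) * (t - s)" using mem[OF st] by (intro mult_right_mono) auto
          finally show ?thesis .
        qed simp
      qed
      also have "\<dots> = (\<bar>K\<bar> + 1) * (\<Sum>(s, t)\<in>I. t - s)" by (simp add: sum_distrib_left split_beta)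
      also have "\<dots> < \<delta>" using len by (simp add: pos_less_divide_eq mult.commute add_nonneg_pos)
      finally show ?thesis .
    qed
    ultimately have "(\<Sum>(s, t)\<in>h ` I. dist (g s) (g t)) < \<epsilon>" by (rule \<delta>(2))
    moreover have "(\<Sum>(s, t)\<in>h ` I. dist (g s) (g t)) = (\<Sum>(s, t)\<in>I. dist ((g \<circ> \<sigma>) s) ((g \<circ> \<sigma>) t))"
      by (subst sum.reindex[OF inj]) (auto simp: h_def split_beta)
    ultimately show ?thesis by simp
  qed
  moreover have "\<delta> / (\<bar>K\<bar> + 1) > 0" using \<delta>(1) by (simp add: add_nonneg_pos)
  ultimately show "\<exists>\<delta>>0. \<forall>I. interval_family a b I \<longrightarrow> (\<Sum>(s, t)\<in>I. t - s) < \<delta> \<longrightarrow>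
      (\<Sum>(s, t)\<in>I. dist ((g \<circ> \<sigma>) s) ((g \<circ> \<sigma>) t)) < \<epsilon>" by blast
qed

lemma negligible_open_cover:
  fixes Z :: "'a::euclidean_space set"
  assumes Z: "negligible Z" and \<delta>: "\<delta> > 0"
  obtains U where "open U" "Z \<subseteq> U" "U \<in> lmeasurable" "measure lebesgue U < \<delta>"
proof -
  have "Z \<in> sets lebesgue" using Z negligible_imp_sets by blast
  then obtain U where U: "open U" "Z \<subseteq> U" "U - Z \<in> lmeasurable" "emeasure lebesgue (U - Z) < ennreal \<delta>"
    using sets_lebesgue_outer_open[OF _ \<delta>] by metis
  have eq: "U = (U - Z) \<union> Z" using U by auto
  have "(U - Z) \<union> Z \<in> lmeasurable"
    using U(3) negligible_imp_measurable[OF Z] by (rule fmeasurable.Un)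
  then have "U \<in> lmeasurable" using eq by simp
  moreover have "measure lebesgue U = measure lebesgue (U - Z)"
    by (subst eq, rule measure_Un_null_set) (use U(3) Z in \<open>auto simp: fmeasurableD negligible_iff_null_sets\<close>)
  moreover have "measure lebesgue (U - Z) < \<delta>"
    using U(4) \<delta> unfolding emeasure_eq_measure2[OF U(3)] by (simp add: ennreal_less_iff del: measure_completion)
  ultimately show ?thesis using that U(1,2) by simp
qed

text \<open>
  Cousin's lemma provides a tagged division that is fine both for the differentiability at the tags
  outside \<open>Z\<close> and for a small open neighbourhood of \<open>Z\<close>. Absolute continuity controls the second
  kind of intervals.
\<close>

lemma abs_cont_mean_value:
  fixes g :: "real \<Rightarrow> 'b::real_normed_vector"
  assumes ac: "abs_cont a b g" and ab: "a \<le> b" and Z: "negligible Z" and k: "0 \<le> k"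
    and deriv: "\<And>t. t \<in> {a..b} - Z \<Longrightarrow> \<exists>D. (g has_vector_derivative D) (at t within {a..b}) \<and> norm D \<le> k"
  shows "norm (g b - g a) \<le> k * (b - a)"
proof -
  \<comment> \<open>the intervals tagged in \<open>Z\<close> lie in an open set so small that they contribute at most \<open>\<epsilon>\<close>\<close>
  have *: "norm (g b - g a) \<le> (k + \<epsilon>) * (b - a) + \<epsilon>" if e: "\<epsilon> > 0" for \<epsilon> :: real
  proof -
    obtain \<delta> where \<delta>: "\<delta> > 0" and small: "\<And>F. F division_of \<Union>F \<Longrightarrow> \<Union>F \<subseteq> {a..b} \<Longrightarrow>
      sum (measure lborel) F < \<delta> \<Longrightarrow> (\<Sum>K\<in>F. dist (g (Inf K)) (g (Sup K))) < \<epsilon>"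
      using abs_cont_intervals[OF ac e] by blast
    obtain U where U: "open U" "Z \<subseteq> U" and U_meas: "U \<in> lmeasurable" "measure lebesgue U < \<delta>"
      using negligible_open_cover[OF Z \<delta>] by blast
    have "\<exists>d>0. (t \<in> Z \<longrightarrow> ball t d \<subseteq> U) \<and> (t \<in> {a..b} - Z \<longrightarrow>
        (\<forall>x\<in>{a..b}. \<forall>y\<in>{a..b}. x \<le> t \<and> t \<le> y \<and> x \<in> ball t d \<and> y \<in> ball t d \<longrightarrow> norm (g y - g x) \<le> (k + \<epsilon>) * (y - x)))" for t
    proof (cases "t \<in> Z")
      case True
      then show ?thesis using U(1,2) by (metis DiffE openE subsetD)
    next
      case nZ: False
      show ?thesis
      proof (cases "t \<in> {a..b}")
        case False then show ?thesis using nZ by (intro exI[of _ 1]) auto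
      next
        case True
        obtain D where D: "(g has_vector_derivative D) (at t within {a..b})" "norm D \<le> k"
          using deriv[of t] True nZ by auto
        obtain d where d: "d > 0" "\<And>y. y \<in> {a..b} \<Longrightarrow> norm (y - t) < d \<Longrightarrow>
            norm (g y - g t - (y - t) *\<^sub>R D) \<le> \<epsilon> * norm (y - t)"
          using D(1) e unfolding has_vector_derivative_def has_derivative_within_alt by blast
        have bd: "norm (g y - g t) \<le> (k + \<epsilon>) * \<bar>y - t\<bar>" if "y \<in> {a..b}" "\<bar>y - t\<bar> < d" for y
        proof -
          have "norm (g y - g t) \<le> norm (g y - g t - (y - t) *\<^sub>R D) + norm ((y - t) *\<^sub>R D)"
            using norm_triangle_ineq[of "g y - g t - (y - t) *\<^sub>R D" "(y - t) *\<^sub>R D"] by simp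
          also have "\<dots> \<le> \<epsilon> * \<bar>y - t\<bar> + \<bar>y - t\<bar> * k"
            using d(2)[of y] that D(2) by (intro add_mono) (auto intro: mult_left_mono)
          finally show ?thesis by (simp add: algebra_simps)
        qed
        have "norm (g y - g x) \<le> (k + \<epsilon>) * (y - x)"
          if "x \<in> {a..b}" "y \<in> {a..b}" "x \<le> t" "t \<le> y" "x \<in> ball t d" "y \<in> ball t d" for x y
        proof -
          have "norm (g y - g x) \<le> norm (g y - g t) + norm (g x - g t)"
            using norm_triangle_ineq4[of "g y - g t" "g x - g t"] by simp
          also have "\<dots> \<le> (k + \<epsilon>) * \<bar>y - t\<bar> + (k + \<epsilon>) * \<bar>x - t\<bar>"
            using that by (intro add_mono bd) (auto simp: dist_real_def)
          also have "\<dots> = (k + \<epsilon>) * (y - x)" using that by (simp add: algebra_simps)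
          finally show ?thesis .
        qed
        then show ?thesis using d(1) nZ by blast
      qed
    qed
    then obtain d where d: "\<And>t. d t > 0" "\<And>t. t \<in> Z \<Longrightarrow> ball t (d t) \<subseteq> U"
      "\<And>t x y. t \<in> {a..b} - Z \<Longrightarrow> x \<in> {a..b} \<Longrightarrow> y \<in> {a..b} \<Longrightarrow> x \<le> t \<Longrightarrow> t \<le> y \<Longrightarrow> x \<in> ball t (d t)
        \<Longrightarrow> y \<in> ball t (d t) \<Longrightarrow> norm (g y - g x) \<le> (k + \<epsilon>) * (y - x)"
      by metis
    have "gauge (\<lambda>t. ball t (d t))" using d(1) by (simp add: gauge_def)
    then obtain p where p: "p tagged_division_of {a..b}" "(\<lambda>t. ball t (d t)) fine p"
      using fine_division_exists_real by blast
    have pK: "t \<in> {Inf K..Sup K}" "K = {Inf K..Sup K}" "Inf K \<le> Sup K" "Inf K \<in> {a..b}" "Sup K \<in> {a..b}"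
      "K \<subseteq> ball t (d t)" "t \<in> {a..b}"
      if "(t, K) \<in> p" for t K
    proof -
      have "t \<in> K" "K \<subseteq> {a..b}" "\<exists>a b. K = cbox a b" using tagged_division_ofD(2-4)[OF p(1) that] by auto
      moreover then obtain x y where "K = {x..y}" by auto
      moreover then have "x \<le> y" using \<open>t \<in> K\<close> by auto
      ultimately show "t \<in> {Inf K..Sup K}" "K = {Inf K..Sup K}" "Inf K \<le> Sup K" "Inf K \<in> {a..b}" "Sup K \<in> {a..b}"
        "t \<in> {a..b}" by auto
      show "K \<subseteq> ball t (d t)" using p(2) that by (auto simp: fine_def)
    qed
    have fin: "finite p" using p(1) by blast
    define q where "q = {(t, K). (t, K) \<in> p \<and> t \<in> Z}"
    have qp: "q \<subseteq> p" by (auto simp: q_def)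
    then have finq: "finite q" using fin finite_subset by blast
    have "q tagged_partial_division_of {a..b}"
      using p(1) qp tagged_partial_division_subset tagged_division_of_def by blast
    then have divq: "snd ` q division_of \<Union>(snd ` q)" by (rule partial_division_of_tagged_division)
    have subab: "\<Union>(snd ` q) \<subseteq> {a..b}" using tagged_division_ofD(3)[OF p(1)] qp by fastforce
    have "sum (measure lborel) (snd ` q) = sum (measure lebesgue) (snd ` q)"
      by (rule sum.cong) (use division_ofD(4)[OF divq] in force)+
    also have "\<dots> = measure lebesgue (\<Union>(snd ` q))"
      by (rule content_division[OF divq])
    also have "\<dots> \<le> measure lebesgue U"
    proof -
      have "\<Union>(snd ` q) \<subseteq> U"
      proof (rule Union_least)
        fix K assume "K \<in> snd ` q"
        then obtain t where "(t, K) \<in> p" "t \<in> Z" by (auto simp: q_def)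
        then show "K \<subseteq> U" using d(2) pK(6) by blast
      qed
      moreover have "\<Union>(snd ` q) \<in> sets lebesgue"
        using lmeasurable_division[OF divq] by (rule fmeasurableD)
      ultimately show ?thesis
        using U_meas(1) by (rule measure_mono_fmeasurable)
    qed
    finally have "sum (measure lborel) (snd ` q) < \<delta>" using U_meas by simp
    from small[OF divq subab this]
    have small': "(\<Sum>K\<in>snd ` q. dist (g (Inf K)) (g (Sup K))) < \<epsilon>" .
    have sq: "(\<Sum>(t, K)\<in>q. norm (g (Sup K) - g (Inf K))) < \<epsilon>"
    proof -
      have "(\<Sum>K\<in>snd ` q. norm (g (Sup K) - g (Inf K))) = (\<Sum>(t, K)\<in>q. norm (g (Sup K) - g (Inf K)))"
      proof (subst sum.reindex_nontrivial[OF finq])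
        fix x y assume xy: "x \<in> q" "y \<in> q" "x \<noteq> y" "snd x = snd y"
        then obtain t t' K where K: "x = (t, K)" "y = (t', K)" "t \<noteq> t'" "(t, K) \<in> p" "(t', K) \<in> p"
          using qp by (metis prod.collapse subsetD)
        have "interior K = {}"
          using tagged_division_ofD(5)[OF p(1) K(4,5)] K(3) by simp
        moreover have "interior K = {Inf K<..<Sup K}"
          by (metis pK(2)[OF K(4)] interior_atLeastAtMost_real)
        ultimately have "Inf (snd x) = Sup (snd x)"
          using pK(3)[OF K(4)] K(1) by auto
        then show "norm (g (Sup (snd x)) - g (Inf (snd x))) = 0" by simp
      qed (auto simp: split_beta)
      then show ?thesis using small' by (simp add: dist_norm norm_minus_commute)
    qed
    have "g b - g a = (\<Sum>(t, K)\<in>p. g (Sup K) - g (Inf K))"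
      using additive_tagged_division_1[OF ab p(1), of g] by simp
    also have "norm \<dots> \<le> (\<Sum>(t, K)\<in>p. norm (g (Sup K) - g (Inf K)))"
      by (rule order_trans[OF norm_sum]) (simp add: split_beta)
    also have "\<dots> = (\<Sum>(t, K)\<in>p - q. norm (g (Sup K) - g (Inf K))) + (\<Sum>(t, K)\<in>q. norm (g (Sup K) - g (Inf K)))"
      by (rule sum.subset_diff[OF qp fin])
    also have "\<dots> \<le> (\<Sum>(t, K)\<in>p. (k + \<epsilon>) * (Sup K - Inf K)) + \<epsilon>"
    proof (rule add_mono)
      have "(\<Sum>(t, K)\<in>p - q. norm (g (Sup K) - g (Inf K))) \<le> (\<Sum>(t, K)\<in>p - q. (k + \<epsilon>) * (Sup K - Inf K))"
      proof (rule sum_mono)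
        fix z assume z: "z \<in> p - q"
        obtain t K where [simp]: "z = (t, K)" by (cases z)
        have tK: "(t, K) \<in> p" "t \<notin> Z" using z by (auto simp: q_def)
        have "{Inf K..Sup K} \<subseteq> ball t (d t)"
          by (metis pK(2,6)[OF tK(1)])
        then have "Inf K \<in> ball t (d t)" "Sup K \<in> ball t (d t)" using pK(3)[OF tK(1)] by auto
        then show "(case z of (t, K) \<Rightarrow> norm (g (Sup K) - g (Inf K))) \<le> (case z of (t, K) \<Rightarrow> (k + \<epsilon>) * (Sup K - Inf K))"
          using d(3)[of t "Inf K" "Sup K"] pK(1,3,4,5,7)[OF tK(1)] tK(2) by auto
      qed
      also have "\<dots> \<le> (\<Sum>(t, K)\<in>p. (k + \<epsilon>) * (Sup K - Inf K))"
        by (rule sum_mono2[OF fin]) (use pK(3) k e in \<open>auto intro!: mult_nonneg_nonneg\<close>)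
      finally show "(\<Sum>(t, K)\<in>p - q. norm (g (Sup K) - g (Inf K))) \<le> (\<Sum>(t, K)\<in>p. (k + \<epsilon>) * (Sup K - Inf K))" .
    qed (use sq in simp)
    also have "(\<Sum>(t, K)\<in>p. (k + \<epsilon>) * (Sup K - Inf K)) = (k + \<epsilon>) * (b - a)"
      using additive_tagged_division_1[OF ab p(1), of "\<lambda>x. x"]
      by (simp add: split_beta flip: sum_distrib_left)
    finally show ?thesis .
  qed
  show ?thesis
  proof (rule field_le_epsilon)
    fix e :: real assume "e > 0"
    define \<epsilon> where "\<epsilon> = e / (b - a + 1)"
    have "\<epsilon> > 0" "\<epsilon> * (b - a + 1) = e" using ab \<open>e > 0\<close> by (auto simp: \<epsilon>_def)
    then show "norm (g b - g a) \<le> k * (b - a) + e" using *[of \<epsilon>] by (simp add: algebra_simps)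
  qed
qed

section \<open>Differentiability almost everywhere\<close>

text \<open>
  The points at which arbitrarily short intervals have slope above \<open>q\<close>. The intervals contain the
  point in their interior, which makes this a countable intersection of open sets, hence Borel.
\<close>

definition steep :: "(real \<Rightarrow> real) \<Rightarrow> real \<Rightarrow> real \<Rightarrow> real \<Rightarrow> real set" where
  "steep g a b q = {t. \<forall>d>0. \<exists>x y. a \<le> x \<and> x < t \<and> t < y \<and> y \<le> b \<and> y - x < d \<and>
     q * (y - x) < g y - g x}"

lemma steep_borel: "steep g a b q \<in> sets borel"
proof -
  let ?A = "\<lambda>n::nat. \<Union>(x,y)\<in>{(x,y). a \<le> x \<and> y \<le> b \<and> y - x < 1 / real (Suc n) \<and> q * (y - x) < g y - g x}. {x<..<y}"
  have "steep g a b q = (\<Inter>n. ?A n)"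
  proof (intro equalityI subsetI)
    fix t assume t: "t \<in> steep g a b q"
    show "t \<in> (\<Inter>n. ?A n)"
    proof
      fix n
      have "1 / real (Suc n) > 0" by simp
      then obtain x y where "a \<le> x" "x < t" "t < y" "y \<le> b" "y - x < 1 / real (Suc n)" "q * (y - x) < g y - g x"
        using t unfolding steep_def by blast
      then show "t \<in> ?A n" by force
    qed
  next
    fix t assume t: "t \<in> (\<Inter>n. ?A n)"
    show "t \<in> steep g a b q"
      unfolding steep_def
    proof (safe)
      fix d :: real assume "d > 0"
      then obtain n where n: "1 / real (Suc n) < d" using nat_approx_posE by blast
      from t have "t \<in> ?A n" by blast
      then obtain x y where "a \<le> x" "x < t" "t < y" "y \<le> b" "y - x < 1 / real (Suc n)" "q * (y - x) < g y - g x"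
        by auto
      then show "\<exists>x y. a \<le> x \<and> x < t \<and> t < y \<and> y \<le> b \<and> y - x < d \<and> q * (y - x) < g y - g x"
        using n less_trans by blast
    qed
  qed
  moreover have "open (?A n)" for n by (intro open_UN) auto
  ultimately show ?thesis by auto
qed

lemma steep_subset: "steep g a b q \<subseteq> {a<..<b}"
  unfolding steep_def by (force dest: spec[of _ 1])

lemma steep_lmeasurable: "steep g a b q \<in> lmeasurable"
  by (rule bounded_set_imp_lmeasurable)
    (use steep_borel bounded_subset[OF bounded_Ioo steep_subset] in auto)

lemma sum_intervals_mono:
  fixes g :: "real \<Rightarrow> real"
  assumes "\<And>K. K \<in> F \<Longrightarrow> \<exists>x y. K = {x..y} \<and> x < y \<and> q * (y - x) \<le> g y - g x"
  shows "q * sum (measure lborel) F \<le> (\<Sum>K\<in>F. g (Sup K) - g (Inf K))"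
proof -
  have "q * measure lborel K \<le> g (Sup K) - g (Inf K)" if "K \<in> F" for K
    using assms[OF that] by auto
  then show ?thesis unfolding sum_distrib_left by (rule sum_mono)
qed

text \<open>
  Where the slopes are unbounded, disjoint short intervals of fixed total length would have
  arbitrarily large increments.
\<close>

lemma negligible_steep_infinite:
  assumes ac: "abs_cont a b g"
  shows "negligible (\<Inter>n::nat. steep g a b (real n))"
proof -
  define E where "E = (\<Inter>n::nat. steep g a b (real n))"
  obtain \<delta> where \<delta>: "\<delta> > 0" and small: "\<And>F. F division_of \<Union>F \<Longrightarrow> \<Union>F \<subseteq> {a..b} \<Longrightarrow>
      sum (measure lborel) F < \<delta> \<Longrightarrow> (\<Sum>K\<in>F. dist (g (Inf K)) (g (Sup K))) < 1"
    using abs_cont_intervals[OF ac zero_less_one] by blast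
  have E_sub: "E \<subseteq> {a<..<b}" using steep_subset[of g a b "real 0"] unfolding E_def by blast
  have E_meas: "E \<in> lmeasurable"
  proof (rule bounded_set_imp_lmeasurable)
    show "bounded E" using bounded_subset[OF bounded_Ioo E_sub] .
    have "E \<in> sets borel" unfolding E_def by (intro sets.countable_INT) (use steep_borel in auto)
    then show "E \<in> sets lebesgue" by simp
  qed
  have loc: "negligible (E \<inter> {l<..<l + \<delta>/2})" for l
  proof (rule ccontr)
    let ?W = "{l<..<l + \<delta>/2} \<inter> {a<..<b}"
    let ?E = "E \<inter> {l<..<l + \<delta>/2}"
    have E'm: "?E \<in> lmeasurable" using E_meas by (rule fmeasurable_Int_fmeasurable) auto
    assume "\<not> negligible ?E"
    then have e: "measure lebesgue ?E > 0"
      using negligible_iff_measure0[OF E'm] by (simp add: zero_less_measure_iff del: measure_completion)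
    define e where "e = measure lebesgue ?E"
    have "e > 0" using e by (simp add: e_def)
    \<comment> \<open>the intervals below have total length at least \<open>e/2\<close> and slope above \<open>n\<close>, but total increment below \<open>1\<close>\<close>
    obtain n :: nat where n: "real n * (e/2) > 1"
      using ex_less_of_nat_mult[of "e/2" 1] \<open>e > 0\<close> by auto
    obtain F where F: "finite F" "disjoint F"
      "\<And>K. K \<in> F \<Longrightarrow> \<exists>x y. K = {x..y} \<and> x < y \<and> real n * (y - x) < g y - g x"
      "\<Union>F \<subseteq> ?W" "measure lebesgue (?E - \<Union>F) < e/2"
    proof (rule vitali_finite[OF E'm, of ?W "\<lambda>x y. real n * (y - x) < g y - g x" "e/2"])
      fix t d :: real assume "t \<in> ?E" "d > 0"
      then have "t \<in> steep g a b (real n)" by (auto simp: E_def)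
      then show "\<exists>x y. real n * (y - x) < g y - g x \<and> x < y \<and> x \<le> t \<and> t \<le> y \<and> y - x < d"
        using \<open>d > 0\<close> unfolding steep_def by (fastforce dest: spec[of _ d])
    qed (use E_sub \<open>e > 0\<close> in \<open>auto intro: open_Int\<close>)
    have F': "\<exists>x y. K = {x..y} \<and> x < y" if "K \<in> F" for K using F(3)[OF that] by blast
    note dv = disjoint_intervals_division[OF F(1,2) F']
    have "e \<le> measure lebesgue ((?E - \<Union>F) \<union> \<Union>F)"
      unfolding e_def by (rule measure_mono_fmeasurable) (use E'm dv(3) in \<open>auto intro: fmeasurable.Un fmeasurable_Diff fmeasurableD\<close>)
    also have "\<dots> \<le> measure lebesgue (?E - \<Union>F) + measure lebesgue (\<Union>F)"
      by (rule measure_Un_le) (use E'm dv(3) in \<open>auto intro: fmeasurable_Diff fmeasurableD\<close>)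
    finally have "sum (measure lborel) F > e/2" using dv(2) F(5) by simp
    moreover have "real n * sum (measure lborel) F \<le> (\<Sum>K\<in>F. g (Sup K) - g (Inf K))"
      by (rule sum_intervals_mono) (use F(3) in fastforce)
    moreover have "(\<Sum>K\<in>F. g (Sup K) - g (Inf K)) \<le> (\<Sum>K\<in>F. dist (g (Inf K)) (g (Sup K)))"
      by (rule sum_mono) (simp add: dist_real_def)
    moreover have "(\<Sum>K\<in>F. dist (g (Inf K)) (g (Sup K))) < 1"
    proof (rule small[OF dv(1)])
      show "\<Union>F \<subseteq> {a..b}" using F(4) by auto
      have "measure lebesgue (\<Union>F) \<le> measure lebesgue {l..l + \<delta>/2}"
        by (rule measure_mono_fmeasurable) (use F(4) dv(3) in \<open>auto intro: fmeasurableD\<close>)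
      then show "sum (measure lborel) F < \<delta>" using dv(2) \<delta> by simp
    qed
    ultimately have "real n * sum (measure lborel) F < 1" "sum (measure lborel) F > e/2" by simp_all
    moreover have "real n * (e/2) \<le> real n * sum (measure lborel) F"
      using \<open>sum (measure lborel) F > e/2\<close> by (intro mult_left_mono) auto
    ultimately show False using n by simp
  qed
  have "E \<subseteq> (\<Union>l\<in>\<rat>. E \<inter> {l<..<l + \<delta>/2})"
  proof
    fix t assume "t \<in> E"
    obtain l where "l \<in> \<rat>" "t - \<delta>/2 < l" "l < t" using Rats_dense_in_real[of "t - \<delta>/2" t] \<delta> by auto
    then show "t \<in> (\<Union>l\<in>\<rat>. E \<inter> {l<..<l + \<delta>/2})" using \<open>t \<in> E\<close> by auto
  qed
  moreover have "negligible (\<Union>l\<in>\<rat>. E \<inter> {l<..<l + \<delta>/2})"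
    by (rule negligible_countable_Union) (use loc countable_rat in auto)
  ultimately show ?thesis unfolding E_def[symmetric] by (rule negligible_subset[rotated])
qed

text \<open>
  Suppose that the set of points near which there are short intervals of slope below \<open>p\<close> and of
  slope above \<open>q\<close> had measure \<open>e > 0\<close>. Disjoint intervals \<open>F\<close> of the first kind fill the set up to a
  small error, and inside them so do disjoint intervals \<open>J\<close> of the second kind. The gaps of \<open>J\<close> in
  \<open>F\<close> are so short that absolute continuity makes their increments negligible; so the same total
  increment is at most about \<open>p e\<close> and at least about \<open>q e\<close>.
\<close>

lemma negligible_steep_between:
  assumes ac: "abs_cont a b g" and pq: "p < q"
  shows "negligible (steep g a b q \<inter> steep (\<lambda>x. - g x) a b (- p))"
proof (rule ccontr)
  define E where "E = steep g a b q \<inter> steep (\<lambda>x. - g x) a b (- p)"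
  have E_sub: "E \<subseteq> {a<..<b}" using steep_subset unfolding E_def by blast
  have E_meas: "E \<in> lmeasurable"
    unfolding E_def by (intro fmeasurable_Int_fmeasurable steep_lmeasurable fmeasurableD)
  assume "\<not> negligible (steep g a b q \<inter> steep (\<lambda>x. - g x) a b (- p))"
  then have "measure lebesgue E > 0"
    using negligible_iff_measure0[OF E_meas] by (simp add: zero_less_measure_iff E_def del: measure_completion)
  moreover define e where "e = measure lebesgue E"
  ultimately have e: "e > 0" by simp
  define \<epsilon> where "\<epsilon> = (q - p) * e / 8"
  have \<epsilon>: "\<epsilon> > 0" using pq e by (simp add: \<epsilon>_def)
  obtain \<delta> where \<delta>: "\<delta> > 0" and small: "\<And>F. F division_of \<Union>F \<Longrightarrow> \<Union>F \<subseteq> {a..b} \<Longrightarrow>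
      sum (measure lborel) F < \<delta> \<Longrightarrow> (\<Sum>K\<in>F. dist (g (Inf K)) (g (Sup K))) < \<epsilon>"
    using abs_cont_intervals[OF ac \<epsilon>] by blast
  \<comment> \<open>three losses of \<open>\<eta>\<close> occur: one in \<open>W\<close>, one in \<open>F\<close> and one in \<open>J\<close>\<close>
  define \<eta> where "\<eta> = min (\<delta>/4) (min (e/8) (\<epsilon> / (3 * (\<bar>p\<bar> + 1))))"
  have \<eta>: "\<eta> > 0" "3 * \<eta> < \<delta>" "\<eta> \<le> e/8" "3 * \<eta> * (\<bar>p\<bar> + 1) \<le> \<epsilon>"
  proof -
    show "\<eta> > 0" using \<delta> e \<epsilon> by (simp add: \<eta>_def)
    have "\<eta> \<le> \<delta>/4" unfolding \<eta>_def by (rule min.cobounded1)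
    then show "3 * \<eta> < \<delta>" using \<delta> by simp
    show "\<eta> \<le> e/8" unfolding \<eta>_def by (intro min.coboundedI2 min.cobounded1)
    have "\<eta> \<le> \<epsilon> / (3 * (\<bar>p\<bar> + 1))" unfolding \<eta>_def by (intro min.coboundedI2 min.cobounded2)
    then show "3 * \<eta> * (\<bar>p\<bar> + 1) \<le> \<epsilon>" by (simp add: field_simps)
  qed
  obtain W0 where W0: "open W0" "E \<subseteq> W0" "W0 - E \<in> lmeasurable" "emeasure lebesgue (W0 - E) < ennreal \<eta>"
    using sets_lebesgue_outer_open[OF fmeasurableD[OF E_meas] \<eta>(1)] by metis
  define W where "W = W0 \<inter> {a<..<b}"
  have W: "open W" "E \<subseteq> W" "W \<subseteq> {a<..<b}" using W0 E_sub by (auto simp: W_def)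
  have W_meas: "W \<in> lmeasurable"
    using W(1) bounded_subset[OF bounded_Ioo W(3)] by (intro bounded_set_imp_lmeasurable) auto
  have "measure lebesgue W \<le> measure lebesgue E + measure lebesgue (W0 - E)"
  proof -
    have "measure lebesgue W \<le> measure lebesgue (E \<union> (W0 - E))"
    proof (rule measure_mono_fmeasurable)
      show "W \<subseteq> E \<union> (W0 - E)" by (auto simp: W_def)
      show "E \<union> (W0 - E) \<in> lmeasurable" using E_meas W0(3) by (rule fmeasurable.Un)
    qed (use W_meas in \<open>rule fmeasurableD\<close>)
    also have "\<dots> \<le> measure lebesgue E + measure lebesgue (W0 - E)"
      by (rule measure_Un_le) (use E_meas W0(3) in \<open>auto intro: fmeasurableD\<close>)
    finally show ?thesis .
  qed
  moreover have "measure lebesgue (W0 - E) < \<eta>"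
    using W0(4) \<eta>(1) unfolding emeasure_eq_measure2[OF W0(3)] by (simp add: ennreal_less_iff del: measure_completion)
  ultimately have W_small: "measure lebesgue W < e + \<eta>" by (simp add: e_def)
  \<comment> \<open>intervals of small slope\<close>
  obtain F where F: "finite F" "disjoint F"
      "\<And>K. K \<in> F \<Longrightarrow> \<exists>x y. K = {x..y} \<and> x < y \<and> - p * (y - x) < - g y - - g x"
      "\<Union>F \<subseteq> W" "measure lebesgue (E - \<Union>F) < \<eta>"
  proof (rule vitali_finite[OF E_meas W(1,2), of "\<lambda>x y. - p * (y - x) < - g y - - g x" \<eta>])
    fix t d :: real assume "t \<in> E" "d > 0"
    then have "t \<in> steep (\<lambda>x. - g x) a b (- p)" by (auto simp: E_def)
    then obtain x y where "a \<le> x" "x < t" "t < y" "y \<le> b" "y - x < d" "- p * (y - x) < - g y - - g x"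
      using \<open>d > 0\<close> unfolding steep_def by blast
    then show "\<exists>x y. - p * (y - x) < - g y - - g x \<and> x < y \<and> x \<le> t \<and> t \<le> y \<and> y - x < d"
      by (intro exI[of _ x] exI[of _ y]) auto
  qed (use \<eta> in auto)
  have F': "\<exists>x y. K = {x..y} \<and> x < y" if "K \<in> F" for K using F(3)[OF that] by blast
  note dF = disjoint_intervals_division[OF F(1,2) F']
  define W2 where "W2 = (\<Union>K\<in>F. interior K)"
  have W2: "open W2" "W2 \<subseteq> \<Union>F" using interior_subset by (auto simp: W2_def)
  define E2 where "E2 = E \<inter> W2"
  have E2m: "E2 \<in> lmeasurable" unfolding E2_def
    by (intro fmeasurable_Int_fmeasurable E_meas) (use W2(1) in auto)
  have E2: "measure lebesgue E2 > e - \<eta>"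
  proof -
    define P where "P = (\<Union>K\<in>F. {Inf K, Sup K})"
    have "finite P" using F(1) by (simp add: P_def)
    then have P: "P \<in> null_sets lebesgue" using negligible_finite negligible_iff_null_sets by blast
    have "E \<subseteq> E2 \<union> (E - \<Union>F) \<union> P"
    proof
      fix t assume t: "t \<in> E"
      show "t \<in> E2 \<union> (E - \<Union>F) \<union> P"
      proof (cases "t \<in> \<Union>F")
        case True
        then obtain K where K: "K \<in> F" "t \<in> K" by auto
        then obtain x y where "K = {x..y}" "x < y" using F' by blast
        then have "t \<in> interior K \<or> t \<in> {Inf K, Sup K}" using K by auto
        then show ?thesis using K t by (auto simp: E2_def W2_def P_def)
      qed (use t in auto)
    qed
    then have "e \<le> measure lebesgue (E2 \<union> (E - \<Union>F) \<union> P)"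
      unfolding e_def
    proof (rule measure_mono_fmeasurable)
      have "P \<in> lmeasurable" using P by (simp add: negligible_imp_measurable negligible_iff_null_sets)
      then show "E2 \<union> (E - \<Union>F) \<union> P \<in> lmeasurable"
        using E_meas E2m dF(3) by (intro fmeasurable.Un fmeasurable_Diff) (auto intro: fmeasurableD)
    qed (use E_meas in \<open>rule fmeasurableD\<close>)
    also have "\<dots> = measure lebesgue (E2 \<union> (E - \<Union>F))"
      by (rule measure_Un_null_set) (use P E2m E_meas dF(3) in \<open>auto intro: fmeasurableD\<close>)
    also have "\<dots> \<le> measure lebesgue E2 + measure lebesgue (E - \<Union>F)"
      by (rule measure_Un_le) (use E2m E_meas dF(3) in \<open>auto intro: fmeasurableD\<close>)
    finally show ?thesis using F(5) by simp
  qed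
  \<comment> \<open>inside them, intervals of large slope\<close>
  obtain J where J: "finite J" "disjoint J"
      "\<And>K. K \<in> J \<Longrightarrow> \<exists>x y. K = {x..y} \<and> x < y \<and> q * (y - x) < g y - g x"
      "\<Union>J \<subseteq> W2" "measure lebesgue (E2 - \<Union>J) < \<eta>"
  proof (rule vitali_finite[OF E2m W2(1), of "\<lambda>x y. q * (y - x) < g y - g x" \<eta>])
    fix t d :: real assume "t \<in> E2" "d > 0"
    then have "t \<in> steep g a b q" by (auto simp: E_def E2_def)
    then obtain x y where "a \<le> x" "x < t" "t < y" "y \<le> b" "y - x < d" "q * (y - x) < g y - g x"
      using \<open>d > 0\<close> unfolding steep_def by blast
    then show "\<exists>x y. q * (y - x) < g y - g x \<and> x < y \<and> x \<le> t \<and> t \<le> y \<and> y - x < d"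
      by (intro exI[of _ x] exI[of _ y]) auto
  qed (use \<eta> in \<open>auto simp: E2_def\<close>)
  have J': "\<exists>x y. K = {x..y} \<and> x < y" if "K \<in> J" for K using J(3)[OF that] by blast
  note dJ = disjoint_intervals_division[OF J(1,2) J']
  have lenJ: "sum (measure lborel) J > e - 2 * \<eta>"
  proof -
    have "measure lebesgue E2 \<le> measure lebesgue ((E2 - \<Union>J) \<union> \<Union>J)"
      by (rule measure_mono_fmeasurable) (use E2m dJ(3) in \<open>auto intro: fmeasurable.Un fmeasurable_Diff fmeasurableD\<close>)
    also have "\<dots> \<le> measure lebesgue (E2 - \<Union>J) + measure lebesgue (\<Union>J)"
      by (rule measure_Un_le) (use E2m dJ(3) in \<open>auto intro: fmeasurable_Diff fmeasurableD\<close>)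
    finally show ?thesis using dJ(2) J(5) E2 by simp
  qed
  have lenF: "sum (measure lborel) F < e + \<eta>"
  proof -
    have "measure lebesgue (\<Union>F) \<le> measure lebesgue W"
      by (rule measure_mono_fmeasurable) (use F(4) dF(3) W_meas in \<open>auto intro: fmeasurableD\<close>)
    then show ?thesis using W_small dF(2) by simp
  qed
  have "\<Union>F \<subseteq> {a..b}" using F(4) W(3) by force
  then obtain D where D: "F \<subseteq> D" "D division_of {a..b}"
    using partial_division_extend_interval[OF dF(1)] by (metis cbox_interval)
  \<comment> \<open>\<open>F\<close> is completed by \<open>R\<close> to a division of \<open>{a..b}\<close>, and \<open>J\<close> and \<open>R\<close> by \<open>C\<close> to another one; hence \<open>C\<close> fills up the gaps of \<open>J\<close> in \<open>F\<close>\<close>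
  define R where "R = D - F"
  have finD: "finite D" using D(2) by blast
  have int_R: "interior K1 \<inter> interior K2 = {}" if K: "K1 \<in> J" "K2 \<in> R" for K1 K2
  proof (rule ccontr)
    assume "interior K1 \<inter> interior K2 \<noteq> {}"
    then obtain z where z: "z \<in> interior K1" "z \<in> interior K2" by auto
    then have "z \<in> W2" using J(4) K(1) interior_subset by blast
    then obtain K where "K \<in> F" "z \<in> interior K" by (auto simp: W2_def)
    then show False using division_ofD(5)[OF D(2), of K K2] z K(2) D(1) by (auto simp: R_def)
  qed
  have "(J \<union> R) division_of \<Union>(J \<union> R)"
  proof (rule division_ofI)
    show "finite (J \<union> R)" using J(1) finD by (auto simp: R_def)
    fix K assume K: "K \<in> J \<union> R"
    then show "K \<subseteq> \<Union>(J \<union> R)" "K \<noteq> {}" "\<exists>a b. K = cbox a b"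
      using division_ofD(3,4)[OF dJ(1)] division_ofD(3,4)[OF D(2)] by (auto simp: R_def)
    fix K' assume "K' \<in> J \<union> R" "K \<noteq> K'"
    then show "interior K \<inter> interior K' = {}"
      using K int_R[of K K'] int_R[of K' K] division_ofD(5)[OF dJ(1), of K K'] division_ofD(5)[OF D(2), of K K']
      by (auto simp: R_def)
  qed auto
  moreover have "\<Union>(J \<union> R) \<subseteq> {a..b}"
    using J(4) W2(2) \<open>\<Union>F \<subseteq> {a..b}\<close> division_ofD(6)[OF D(2)] by (auto simp: R_def)
  ultimately obtain D' where D': "J \<union> R \<subseteq> D'" "D' division_of {a..b}"
    using partial_division_extend_interval by (metis cbox_interval)
  define C where "C = D' - (J \<union> R)"
  have finD': "finite D'" using D'(2) by blast
  have JR: "J \<inter> R = {}"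
  proof (rule ccontr)
    assume "J \<inter> R \<noteq> {}"
    then obtain K where K: "K \<in> J" "K \<in> R" by auto
    then have "interior K = {}" using int_R[of K K] by simp
    then show False using J'[OF K(1)] by auto
  qed
  have split: "sum s F = sum s J + sum s C" if "sum s D = sum s D'" for s :: "real set \<Rightarrow> real"
  proof -
    have "sum s D = sum s R + sum s F" unfolding R_def by (rule sum.subset_diff[OF D(1) finD])
    moreover have "sum s D' = sum s C + sum s (J \<union> R)"
      unfolding C_def by (rule sum.subset_diff[OF D'(1) finD'])
    moreover have "sum s (J \<union> R) = sum s J + sum s R"
      by (rule sum.union_disjoint) (use J(1) finD JR in \<open>auto simp: R_def\<close>)
    ultimately show ?thesis using that by simp
  qed
  have ab: "a \<le> b" using E_sub e by (cases "a \<le> b") (auto simp: e_def)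
  have len: "sum (measure lborel) F = sum (measure lborel) J + sum (measure lborel) C"
    by (rule split) (use additive_content_division[of D a b] additive_content_division[of D' a b] D(2) D'(2) in simp)
  have incr: "(\<Sum>K\<in>F. g (Sup K) - g (Inf K)) = (\<Sum>K\<in>J. g (Sup K) - g (Inf K)) + (\<Sum>K\<in>C. g (Sup K) - g (Inf K))"
    by (rule split) (use additive_division_1[OF ab D(2), of g] additive_division_1[OF ab D'(2), of g] in simp)
  have "(\<Sum>K\<in>C. dist (g (Inf K)) (g (Sup K))) < \<epsilon>"
  proof (rule small)
    show "C division_of \<Union>C"
      using division_of_subset[OF division_of_union_self[OF D'(2)]] by (auto simp: C_def)
    show "\<Union>C \<subseteq> {a..b}" using division_ofD(6)[OF D'(2)] by (auto simp: C_def)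
    show "sum (measure lborel) C < \<delta>" using len lenF lenJ \<eta>(2) by simp
  qed
  moreover have "- (\<Sum>K\<in>C. g (Sup K) - g (Inf K)) \<le> (\<Sum>K\<in>C. dist (g (Inf K)) (g (Sup K)))"
    unfolding sum_negf[symmetric] by (rule sum_mono) (simp add: dist_real_def)
  ultimately have C: "- (\<Sum>K\<in>C. g (Sup K) - g (Inf K)) < \<epsilon>" by simp
  define f j c where "f = sum (measure lborel) F" "j = sum (measure lborel) J" "c = sum (measure lborel) C"
  have "- p * f \<le> (\<Sum>K\<in>F. - g (Sup K) - - g (Inf K))"
    unfolding f_j_c_def by (rule sum_intervals_mono) (use F(3) less_imp_le in blast)
  also have "\<dots> = - (\<Sum>K\<in>F. g (Sup K) - g (Inf K))"
    unfolding sum_negf[symmetric] by (rule sum.cong) auto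
  finally have 1: "- p * f \<le> - (\<Sum>K\<in>F. g (Sup K) - g (Inf K))" .
  have 2: "q * j \<le> (\<Sum>K\<in>J. g (Sup K) - g (Inf K))"
    unfolding f_j_c_def by (rule sum_intervals_mono) (use J(3) less_imp_le in blast)
  have 3: "f = j + c" "e - 2 * \<eta> < j" "c < 3 * \<eta>" using len lenF lenJ by (auto simp: f_j_c_def)
  have "c \<ge> 0" unfolding f_j_c_def by (intro sum_nonneg) simp
  have "p * c \<le> \<bar>p\<bar> * c" by (intro mult_right_mono \<open>c \<ge> 0\<close>) simp
  also have "\<dots> \<le> \<bar>p\<bar> * (3 * \<eta>)" using 3 by (intro mult_left_mono) auto
  also have "\<dots> \<le> \<epsilon>" using \<eta>(1,4) by (simp add: algebra_simps)
  finally have "p * c \<le> \<epsilon>" .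
  then have "(q - p) * j < 2 * \<epsilon>" using 1 2 3(1) C incr by (simp add: algebra_simps)
  moreover have "(q - p) * j \<ge> (q - p) * (3/4 * e)"
    using 3(2) \<eta>(3) pq by (intro mult_left_mono) auto
  ultimately have "(q - p) * (3/4 * e) < 2 * \<epsilon>" by (meson order.strict_trans1)
  then have "3/4 * ((q - p) * e) < 1/4 * ((q - p) * e)" by (simp add: \<epsilon>_def mult.assoc mult.left_commute)
  moreover have "(q - p) * e > 0" using pq e by simp
  ultimately show False by linarith
qed

text \<open>
  Difference quotients at \<open>t\<close> belong to intervals that have \<open>t\<close> as an end point; by continuity that
  end point can be moved a little so that \<open>t\<close> becomes interior.
\<close>

lemma frequently_steep:
  assumes cont: "continuous_on {a..b} g" and t: "t \<in> {a<..<b}"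
    and freq: "\<exists>\<^sub>F s in at t. (g s - g t) / (s - t) > q"
  shows "t \<in> steep g a b q"
  unfolding steep_def
proof safe
  fix d :: real assume "d > 0"
  define d' where "d' = min (d/2) (min (t - a) (b - t))"
  have "d' > 0" using t \<open>d > 0\<close> by (simp add: d'_def)
  moreover have "d' \<le> d/2" unfolding d'_def by (rule min.cobounded1)
  moreover have "d' \<le> t - a" "d' \<le> b - t" by (auto simp: d'_def)
  ultimately have d': "d' > 0" "d' \<le> d/2" "d' \<le> t - a" "d' \<le> b - t" by blast+
  have "\<forall>\<^sub>F s in at t. dist s t < d' \<and> s \<noteq> t"
    using d'(1) unfolding eventually_at by blast
  from frequently_eventually_frequently[OF freq this]
  obtain s where s: "(g s - g t) / (s - t) > q" "dist s t < d'" "s \<noteq> t"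
    using frequently_ex by blast
  have "isCont g t" using continuous_on_interior[OF cont] t by simp
  then have tend: "(g \<longlongrightarrow> g t) (at t within S)" for S
    unfolding isCont_def using tendsto_within_subset by blast
  show "\<exists>x y. a \<le> x \<and> x < t \<and> t < y \<and> y \<le> b \<and> y - x < d \<and> q * (y - x) < g y - g x"
  proof (cases "s > t")
    case True
    have "((\<lambda>x. g s - g x - q * (s - x)) \<longlongrightarrow> g s - g t - q * (s - t)) (at_left t)"
      by (intro tendsto_intros tend)
    moreover have "g s - g t - q * (s - t) > 0" using s(1) True by (simp add: field_simps)
    ultimately have "\<forall>\<^sub>F x in at_left t. g s - g x - q * (s - x) > 0" by (rule order_tendstoD)
    moreover have "\<forall>\<^sub>F x in at_left t. x \<in> {t - d'<..<t}"
      using d'(1) by (intro eventually_at_left_real) simp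
    ultimately have "\<forall>\<^sub>F x in at_left t. g s - g x - q * (s - x) > 0 \<and> x \<in> {t - d'<..<t}"
      by (rule eventually_conj)
    then obtain x where "g s - g x - q * (s - x) > 0" "x \<in> {t - d'<..<t}"
      using eventually_happens'[OF trivial_limit_at_left_real] by blast
    then show ?thesis
      using s True d' by (intro exI[of _ x] exI[of _ s]) (auto simp: dist_real_def)
  next
    case False
    then have st: "s < t" using s(3) by simp
    have "((\<lambda>y. g y - g s - q * (y - s)) \<longlongrightarrow> g t - g s - q * (t - s)) (at_right t)"
      by (intro tendsto_intros tend)
    moreover have "g t - g s - q * (t - s) > 0" using s(1) st by (simp add: field_simps)
    ultimately have "\<forall>\<^sub>F y in at_right t. g y - g s - q * (y - s) > 0" by (rule order_tendstoD)
    moreover have "\<forall>\<^sub>F y in at_right t. y \<in> {t<..<t + d'}"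
      using d'(1) by (intro eventually_at_right_real) simp
    ultimately have "\<forall>\<^sub>F y in at_right t. g y - g s - q * (y - s) > 0 \<and> y \<in> {t<..<t + d'}"
      by (rule eventually_conj)
    then obtain y where "g y - g s - q * (y - s) > 0" "y \<in> {t<..<t + d'}"
      using eventually_happens'[OF trivial_limit_at_right_real] by blast
    then show ?thesis
      using s st d' by (intro exI[of _ s] exI[of _ y]) (auto simp: dist_real_def)
  qed
qed

theorem abs_cont_ae_differentiable_real:
  fixes g :: "real \<Rightarrow> real"
  assumes ac: "abs_cont a b g"
  shows "negligible {t \<in> {a..b}. \<not> (\<exists>D. (g has_real_derivative D) (at t))}"
proof -
  let ?m = "\<lambda>x. - g x"
  define Z where "Z = (\<Union>p\<in>\<rat>. \<Union>q\<in>{q\<in>\<rat>. p < q}. steep g a b q \<inter> steep ?m a b (- p))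
     \<union> (\<Inter>n::nat. steep g a b (real n)) \<union> (\<Inter>n::nat. steep ?m a b (real n)) \<union> {a, b}"
  have cont: "continuous_on {a..b} g" using ac by (rule abs_cont_imp_continuous)
  have cont': "continuous_on {a..b} ?m" using cont by (rule continuous_on_minus)
  have "negligible (\<Union>q\<in>{q\<in>\<rat>. p < q}. steep g a b q \<inter> steep ?m a b (- p))" for p
    by (rule negligible_countable_Union)
      (use negligible_steep_between[OF ac] countable_rat in \<open>auto intro: countable_subset\<close>)
  then have "negligible (\<Union>p\<in>\<rat>. \<Union>q\<in>{q\<in>\<rat>. p < q}. steep g a b q \<inter> steep ?m a b (- p))"
    by (intro negligible_countable_Union) (use countable_rat in auto)
  then have Z: "negligible Z"
    unfolding Z_def
    using negligible_steep_infinite[OF ac] negligible_steep_infinite[OF abs_cont_uminus[OF ac]]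
    by (intro negligible_Un) auto
  have "\<exists>D. (g has_real_derivative D) (at t)" if tZ: "t \<in> {a..b} - Z" for t
  proof -
    have t: "t \<in> {a<..<b}" using tZ by (auto simp: Z_def)
    define Q where "Q = (\<lambda>s. (g s - g t) / (s - t))"
    have up: "t \<in> steep g a b q" if "\<exists>\<^sub>F s in at t. Q s > q" for q
      using frequently_steep[OF cont t] that unfolding Q_def by blast
    have dn: "t \<in> steep ?m a b (- q)" if "\<exists>\<^sub>F s in at t. Q s < q" for q
    proof -
      have "\<exists>\<^sub>F s in at t. (?m s - ?m t) / (s - t) > - q"
        using that
      proof (rule frequently_elim1)
        fix s assume "Q s < q"
        moreover have "(?m s - ?m t) / (s - t) = - Q s"
          by (simp add: Q_def minus_divide_left)
        ultimately show "(?m s - ?m t) / (s - t) > - q" by simp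
      qed
      then show ?thesis by (rule frequently_steep[OF cont' t])
    qed
    define l u where "l = Liminf (at t) (\<lambda>s. ereal (Q s))" and "u = Limsup (at t) (\<lambda>s. ereal (Q s))"
    have freq_u: "\<exists>\<^sub>F s in at t. Q s > q" if "ereal q < u" for q
    proof (rule ccontr)
      assume "\<not> (\<exists>\<^sub>F s in at t. Q s > q)"
      then have "\<forall>\<^sub>F s in at t. ereal (Q s) \<le> ereal q" by (simp add: frequently_def not_less)
      then have "u \<le> ereal q" unfolding u_def by (rule Limsup_bounded)
      then show False using that by simp
    qed
    have freq_l: "\<exists>\<^sub>F s in at t. Q s < q" if "l < ereal q" for q
    proof (rule ccontr)
      assume "\<not> (\<exists>\<^sub>F s in at t. Q s < q)"
      then have "\<forall>\<^sub>F s in at t. ereal q \<le> ereal (Q s)" by (simp add: frequently_def not_less)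
      then have "ereal q \<le> l" unfolding l_def by (rule Liminf_bounded)
      then show False using that by simp
    qed
    have "l \<le> u" unfolding l_def u_def by (rule Liminf_le_Limsup) simp
    have "\<not> l < u"
    proof
      assume "l < u"
      then obtain r s where rs: "l < ereal r" "r < s" "ereal s < u"
        by (metis ereal_dense2 ereal_less_eq(3) less_ereal.simps(1))
      obtain p where p: "p \<in> \<rat>" "r < p" "p < s" using Rats_dense_in_real[OF rs(2)] by blast
      obtain q where q: "q \<in> \<rat>" "p < q" "q < s" using Rats_dense_in_real[OF p(3)] by blast
      have "l < ereal p" using rs p by (meson less_ereal.simps(1) less_trans)
      moreover have "ereal q < u" using rs q by (meson less_ereal.simps(1) less_trans)
      ultimately have "t \<in> Z" using up[OF freq_u] dn[OF freq_l] p q by (auto simp: Z_def)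
      then show False using tZ by simp
    qed
    then have "l = u" using \<open>l \<le> u\<close> by simp
    have "u \<noteq> \<infinity>"
    proof
      assume "u = \<infinity>"
      then have "t \<in> Z" using up[OF freq_u] by (auto simp: Z_def)
      then show False using tZ by simp
    qed
    moreover have "l \<noteq> - \<infinity>"
    proof
      assume "l = - \<infinity>"
      then have "t \<in> steep ?m a b (- (- real n))" for n by (intro dn freq_l) simp
      then have "t \<in> Z" by (auto simp: Z_def)
      then show False using tZ by simp
    qed
    ultimately obtain D where D: "u = ereal D" "l = ereal D" using \<open>l = u\<close> by (cases u) auto
    have "((\<lambda>s. ereal (Q s)) \<longlongrightarrow> ereal D) (at t)"
      by (rule iffD2[OF tendsto_iff_Liminf_eq_Limsup]) (use D in \<open>auto simp: l_def u_def\<close>)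
    then have "(Q \<longlongrightarrow> D) (at t)" by simp
    then show ?thesis unfolding Q_def has_field_derivative_iff by blast
  qed
  then have "{t \<in> {a..b}. \<not> (\<exists>D. (g has_real_derivative D) (at t))} \<subseteq> Z" by blast
  then show ?thesis using Z negligible_subset by blast
qed

section \<open>Finite-dimensional normed spaces\<close>

text \<open>
  Coordinates with respect to a basis are bounded because a norm attains a positive minimum on the
  compact set of coordinate vectors of \<open>1\<close>-norm one. The coordinates live in a function space,
  since the dimension is not a type here.
\<close>

lemma finite_dim_coordinates:
  assumes "\<exists>B :: 'a::real_normed_vector set. finite B \<and> span B = UNIV"
  obtains C :: "'a::real_normed_vector set" and x :: "'a::real_normed_vector \<Rightarrow> 'a \<Rightarrow> real"
  where "finite C" "\<And>b. b \<in> C \<Longrightarrow> bounded_linear (x b)" "\<And>v. (\<Sum>b\<in>C. x b v *\<^sub>R b) = v"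
proof -
  obtain B :: "'a set" where B: "finite B" "span B = UNIV" using assms by blast
  obtain C where C: "C \<subseteq> B" "independent C" "span C = UNIV"
    using real_vector.maximal_independent_subset[of B] B(2) by (metis real_vector.span_eq top.extremum_uniqueI
        real_vector.span_superset real_vector.span_mono real_vector.span_span)
  have finC: "finite C" using B C finite_subset by blast
  define x where "x = (\<lambda>b v. representation C v b)"
  have sum: "(\<Sum>b\<in>C. x b v *\<^sub>R b) = v" for v
    unfolding x_def using real_vector.sum_representation_eq[OF C(2) _ finC order_refl, of v] C(3) by simp
  define \<Phi> where "\<Phi> = (\<lambda>y::'a \<Rightarrow> real. \<Sum>b\<in>C. y b *\<^sub>R b)"
  have cont: "continuous_on S \<Phi>" for S
    unfolding \<Phi>_def by (intro continuous_intros continuous_on_subset[OF continuous_on_product_coordinates]) auto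
  \<comment> \<open>the unit sphere of the \<open>1\<close>-norm on coordinates; it is compact in the product topology\<close>
  define K where "K = (PiE UNIV (\<lambda>b. if b \<in> C then {-1..1} else {0::real})) \<inter> {y. (\<Sum>b\<in>C. \<bar>y b\<bar>) = 1}"
  have "compactin (product_topology (\<lambda>_. euclidean) UNIV) (PiE UNIV (\<lambda>b. if b \<in> C then {-1..1} else {0::real}))"
    unfolding compactin_PiE by auto
  then have "compact (PiE UNIV (\<lambda>b. if b \<in> C then {-1..1} else {0::real}))"
    by (simp add: euclidean_product_topology compactin_euclidean_iff)
  moreover have "closed {y::'a \<Rightarrow> real. (\<Sum>b\<in>C. \<bar>y b\<bar>) = 1}"
    by (intro closed_Collect_eq continuous_intros continuous_on_subset[OF continuous_on_product_coordinates]) auto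
  ultimately have K: "compact K" unfolding K_def by (rule compact_Int_closed)
  have pos: "norm (\<Phi> y) > 0" if "y \<in> K" for y
  proof -
    have "\<Phi> y \<noteq> 0"
    proof
      assume "\<Phi> y = 0"
      then have "y b = 0" if "b \<in> C" for b
        using real_vector.independentD[OF C(2) finC order_refl _ that, of y] by (simp add: \<Phi>_def)
      then show False using \<open>y \<in> K\<close> by (simp add: K_def)
    qed
    then show ?thesis by simp
  qed
  obtain m where m: "m > 0" "\<And>y. y \<in> K \<Longrightarrow> m \<le> norm (\<Phi> y)"
  proof (cases "K = {}")
    case True then show ?thesis using that[of 1] by auto
  next
    case False
    obtain y0 where "y0 \<in> K" "\<And>y. y \<in> K \<Longrightarrow> norm (\<Phi> y0) \<le> norm (\<Phi> y)"
      using continuous_attains_inf[OF K False, of "\<lambda>y. norm (\<Phi> y)"] continuous_on_norm[OF cont] by blast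
    then show ?thesis using that[of "norm (\<Phi> y0)"] pos by blast
  qed
  have bound: "m * (\<Sum>b\<in>C. \<bar>x b v\<bar>) \<le> norm v" for v
  proof (cases "(\<Sum>b\<in>C. \<bar>x b v\<bar>) = 0")
    case False
    define s where "s = (\<Sum>b\<in>C. \<bar>x b v\<bar>)"
    have s: "s > 0" using False unfolding s_def by (simp add: less_le sum_nonneg)
    define y where "y = (\<lambda>b. if b \<in> C then x b v / s else 0)"
    have le: "\<bar>x b v\<bar> \<le> s" if "b \<in> C" for b
      unfolding s_def using finC that by (intro member_le_sum) auto
    have "\<bar>y b\<bar> \<le> 1" if "b \<in> C" for b using le[OF that] s that by (simp add: y_def)
    then have "- 1 \<le> y b \<and> y b \<le> 1" if "b \<in> C" for b using that by (simp add: abs_le_iff)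
    then have "y \<in> PiE UNIV (\<lambda>b. if b \<in> C then {-1..1} else {0::real})"
      by (auto, simp add: y_def)
    moreover have "(\<Sum>b\<in>C. \<bar>y b\<bar>) = 1"
    proof -
      have "(\<Sum>b\<in>C. \<bar>y b\<bar>) = (\<Sum>b\<in>C. \<bar>x b v\<bar> / s)" using s by (intro sum.cong) (auto simp: y_def)
      also have "\<dots> = 1" using s by (simp add: s_def flip: sum_divide_distrib)
      finally show ?thesis .
    qed
    ultimately have "m \<le> norm (\<Phi> y)" by (intro m(2)) (simp add: K_def)
    also have "\<Phi> y = (1/s) *\<^sub>R (\<Sum>b\<in>C. x b v *\<^sub>R b)"
      unfolding \<Phi>_def scaleR_sum_right by (intro sum.cong) (auto simp: y_def)
    also have "norm \<dots> = norm v / s" using s by (simp add: sum)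
    finally show ?thesis using s by (simp add: field_simps s_def)
  qed simp
  have "bounded_linear (x b)" if b: "b \<in> C" for b
  proof (rule bounded_linear_intro[where K = "1/m"])
    show "x b (u + v) = x b u + x b v" for u v
      unfolding x_def using C(3) by (subst real_vector.representation_add[OF C(2)]) auto
    show "x b (r *\<^sub>R u) = r *\<^sub>R x b u" for r u
      unfolding x_def using C(3) by (subst real_vector.representation_scale[OF C(2)]) auto
    fix v
    have "\<bar>x b v\<bar> \<le> (\<Sum>b\<in>C. \<bar>x b v\<bar>)" using finC b by (intro member_le_sum) auto
    then have "m * \<bar>x b v\<bar> \<le> norm v" using bound[of v] m(1) by (meson mult_left_mono less_imp_le order_trans)
    then show "norm (x b v) \<le> norm v * (1/m)" using m(1) by (simp add: field_simps)
  qed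
  then show ?thesis using that[OF finC _ sum] by blast
qed

lemma finite_dim_bounded_linear:
  fixes h :: "'a::real_normed_vector \<Rightarrow> 'b::real_normed_vector"
  assumes "\<exists>B :: 'a set. finite B \<and> span B = UNIV" and "linear h"
  shows "bounded_linear h"
proof -
  obtain C :: "'a set" and x :: "'a \<Rightarrow> 'a \<Rightarrow> real" where C: "finite C"
    "\<And>b. b \<in> C \<Longrightarrow> bounded_linear (x b)" "\<And>v. (\<Sum>b\<in>C. x b v *\<^sub>R b) = v"
    using finite_dim_coordinates[OF assms(1)] by blast
  have "bounded_linear (\<lambda>v. \<Sum>b\<in>C. x b v *\<^sub>R h b)"
    by (intro bounded_linear_sum bounded_linear_scaleR_left[THEN bounded_linear_compose] C(2))
  moreover have "(\<lambda>v. \<Sum>b\<in>C. x b v *\<^sub>R h b) = h"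
  proof
    fix v
    have "h (\<Sum>b\<in>C. x b v *\<^sub>R b) = (\<Sum>b\<in>C. x b v *\<^sub>R h b)"
      by (simp add: linear_sum[OF assms(2)] linear_scale[OF assms(2)])
    then show "(\<Sum>b\<in>C. x b v *\<^sub>R h b) = h v" by (simp add: C(3))
  qed
  ultimately show ?thesis by simp
qed

text \<open>
  A closed ball lies in the continuous image of a compact box of coordinates.
\<close>

lemma finite_dim_compact_cball:
  assumes "\<exists>B :: 'a::real_normed_vector set. finite B \<and> span B = UNIV"
  shows "compact (cball (p :: 'a::real_normed_vector) r)"
proof -
  obtain C :: "'a set" and x :: "'a \<Rightarrow> 'a \<Rightarrow> real" where C: "finite C"
    "\<And>b. b \<in> C \<Longrightarrow> bounded_linear (x b)" "\<And>v. (\<Sum>b\<in>C. x b v *\<^sub>R b) = v"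
    using finite_dim_coordinates[OF assms] by blast
  have "\<exists>c. \<forall>v\<in>cball p r. \<bar>x b v\<bar> \<le> c" if bC: "b \<in> C" for b
  proof -
    obtain k where k: "\<And>v. norm (x b v) \<le> norm v * k" "k \<ge> 0"
      using bounded_linear.nonneg_bounded[OF C(2)[OF bC]] by blast
    have "\<bar>x b v\<bar> \<le> (norm p + r) * k" if "v \<in> cball p r" for v
    proof -
      have "norm v \<le> norm p + r"
        using that norm_triangle_ineq2[of v p] by (simp add: dist_norm norm_minus_commute)
      then show ?thesis using k(1)[of v] k(2) by (simp add: mult_right_mono order_trans)
    qed
    then show ?thesis by blast
  qed
  then obtain c where c: "\<And>b v. b \<in> C \<Longrightarrow> v \<in> cball p r \<Longrightarrow> \<bar>x b v\<bar> \<le> c b" by metis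
  define \<Phi> where "\<Phi> = (\<lambda>y::'a \<Rightarrow> real. \<Sum>b\<in>C. y b *\<^sub>R b)"
  have cont: "continuous_on S \<Phi>" for S
    unfolding \<Phi>_def by (intro continuous_intros continuous_on_subset[OF continuous_on_product_coordinates]) auto
  let ?K = "PiE UNIV (\<lambda>b. if b \<in> C then {-c b..c b} else {0::real})"
  have "compactin (product_topology (\<lambda>_. euclidean) UNIV) ?K"
    unfolding compactin_PiE by auto
  then have "compact ?K"
    by (simp add: euclidean_product_topology compactin_euclidean_iff)
  then have "compact (\<Phi> ` ?K)" by (rule compact_continuous_image[OF cont])
  moreover have "cball p r \<subseteq> \<Phi> ` ?K"
  proof
    fix v assume v: "v \<in> cball p r"
    define y where "y = (\<lambda>b. if b \<in> C then x b v else 0)"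
    have "y \<in> ?K" using c[OF _ v] by (auto simp: y_def abs_le_iff minus_le_iff)
    moreover have "\<Phi> y = v" unfolding \<Phi>_def y_def using C(3)[of v] by simp
    ultimately show "v \<in> \<Phi> ` ?K" by blast
  qed
  ultimately show ?thesis
    using compact_Int_closed[of "\<Phi> ` ?K" "cball p r"] by (simp add: Int_absorb1)
qed

lemma finite_dim_countable_dense:
  assumes "\<exists>B :: 'a::real_normed_vector set. finite B \<and> span B = UNIV"
  obtains d :: "nat \<Rightarrow> 'a::real_normed_vector" where "\<And>v \<epsilon>. \<epsilon> > 0 \<Longrightarrow> \<exists>k. dist v (d k) < \<epsilon>"
proof -
  have "\<exists>k. finite k \<and> cball (0::'a) (real n) \<subseteq> (\<Union>x\<in>k. ball x (1 / real (Suc m)))" for n m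
    using finite_dim_compact_cball[OF assms, of 0 "real n"] unfolding compact_eq_totally_bounded
    by (meson divide_pos_pos of_nat_0_less_iff zero_less_Suc zero_less_one)
  then obtain F where F: "\<And>n m. finite (F n m)" "\<And>n m. cball (0::'a) (real n) \<subseteq> (\<Union>x\<in>F n m. ball x (1 / real (Suc m)))"
    by metis
  define D where "D = (\<Union>n m. F n m)"
  have "countable D" unfolding D_def using F(1) by (intro countable_UN) (auto intro: countable_finite)
  have dense: "\<exists>w\<in>D. dist v w < \<epsilon>" if \<epsilon>: "\<epsilon> > 0" for v :: 'a and \<epsilon>
  proof -
    obtain n where "norm v \<le> real n" using real_arch_simple by blast
    then have v: "v \<in> cball 0 (real n)" by simp
    obtain m where m: "1 / real (Suc m) < \<epsilon>" using nat_approx_posE[OF \<epsilon>] by blast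
    obtain w where "w \<in> F n m" "v \<in> ball w (1 / real (Suc m))" using F(2) v by blast
    then have "w \<in> D" "dist v w < \<epsilon>" using m by (auto simp: D_def dist_commute)
    then show ?thesis by blast
  qed
  then have "D \<noteq> {}" using zero_less_one by blast
  show ?thesis
  proof (rule that[of "from_nat_into D"])
    fix v :: 'a and \<epsilon> :: real assume "\<epsilon> > 0"
    then show "\<exists>k. dist v (from_nat_into D k) < \<epsilon>"
      using dense from_nat_into_surj[OF \<open>countable D\<close>] by metis
  qed
qed

theorem abs_cont_ae_differentiable:
  fixes g :: "real \<Rightarrow> 'b::real_normed_vector"
  assumes fd: "\<exists>B :: 'b set. finite B \<and> span B = UNIV" and ac: "abs_cont a b g"
  shows "negligible {t \<in> {a..b}. \<not> (\<exists>D. (g has_vector_derivative D) (at t))}"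
proof -
  obtain C :: "'b set" and x :: "'b \<Rightarrow> 'b \<Rightarrow> real" where C: "finite C"
    "\<And>b. b \<in> C \<Longrightarrow> bounded_linear (x b)" "\<And>v. (\<Sum>b\<in>C. x b v *\<^sub>R b) = v"
    using finite_dim_coordinates[OF fd] by blast
  define Z where "Z = (\<Union>c\<in>C. {t \<in> {a..b}. \<not> (\<exists>D. ((\<lambda>t. x c (g t)) has_real_derivative D) (at t))})"
  have "negligible {t \<in> {a..b}. \<not> (\<exists>D. ((\<lambda>t. x c (g t)) has_real_derivative D) (at t))}" if "c \<in> C" for c
    using abs_cont_bounded_linear[OF ac C(2)[OF that]] by (rule abs_cont_ae_differentiable_real)
  then have "negligible Z"
    unfolding Z_def by (intro negligible_countable_Union) (use countable_finite[OF C(1)] in auto)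
  moreover have "\<exists>D. (g has_vector_derivative D) (at t)" if "t \<in> {a..b} - Z" for t
  proof -
    have "\<forall>c\<in>C. \<exists>D. ((\<lambda>t. x c (g t)) has_real_derivative D) (at t)"
      using that by (auto simp: Z_def)
    then obtain D where D: "\<And>c. c \<in> C \<Longrightarrow> ((\<lambda>t. x c (g t)) has_real_derivative D c) (at t)" by metis
    have "((\<lambda>t. \<Sum>c\<in>C. x c (g t) *\<^sub>R c) has_vector_derivative (\<Sum>c\<in>C. D c *\<^sub>R c)) (at t)"
      using D by (auto intro!: derivative_eq_intros has_vector_derivative_scaleR)
    then show ?thesis unfolding C(3) by blast
  qed
  then have "{t \<in> {a..b}. \<not> (\<exists>D. (g has_vector_derivative D) (at t))} \<subseteq> Z" by blast
  ultimately show ?thesis using negligible_subset by blast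
qed

section \<open>Measurable selection\<close>

text \<open>
  The function \<open>u\<close> is the limit of measurable functions with values in the countable dense set, for
  which the claim is clear; continuity of \<open>h t\<close> passes it on to the limit.
\<close>

lemma caratheodory_composition:
  fixes h :: "'a \<Rightarrow> 'e::metric_space \<Rightarrow> 'c::metric_space" and d :: "nat \<Rightarrow> 'e"
  assumes dense: "\<And>v \<epsilon>. \<epsilon> > 0 \<Longrightarrow> \<exists>k. dist v (d k) < \<epsilon>"
    and meas: "\<And>e. (\<lambda>t. h t e) \<in> borel_measurable M"
    and cont: "\<And>t. t \<in> space M \<Longrightarrow> continuous_on UNIV (h t)"
    and u: "u \<in> borel_measurable M"
  shows "(\<lambda>t. h t (u t)) \<in> borel_measurable M"
proof -
  define k where "k = (\<lambda>n t. LEAST k. dist (u t) (d k) < 1 / real (Suc n))"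
  have near: "dist (u t) (d (k n t)) < 1 / real (Suc n)" for n t
    unfolding k_def by (rule LeastI_ex) (use dense in simp)
  have k: "k n \<in> measurable M (count_space UNIV)" for n
    unfolding k_def
  proof (rule measurable_Least)
    fix i
    have "u -` ball (d i) (1 / real (Suc n)) \<inter> space M \<in> sets M"
      using u by (rule measurable_sets) simp
    moreover have "u -` ball (d i) (1 / real (Suc n)) \<inter> space M = {t \<in> space M. dist (u t) (d i) < 1 / real (Suc n)}"
      by (auto simp: dist_commute)
    ultimately show "Measurable.pred M (\<lambda>t. dist (u t) (d i) < 1 / real (Suc n))"
      by (simp add: pred_def)
  qed
  show ?thesis
  proof (rule borel_measurable_LIMSEQ_metric)
    show "(\<lambda>t. h t (d (k n t))) \<in> borel_measurable M" for n
      using measurable_compose_countable[of "\<lambda>i t. h t (d i)" M borel "k n"] meas k by simp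
    fix t assume t: "t \<in> space M"
    have "(\<lambda>n. dist (d (k n t)) (u t)) \<longlonglongrightarrow> 0"
    proof (rule tendsto_sandwich[OF _ _ tendsto_const LIMSEQ_Suc[OF lim_1_over_n]])
      show "\<forall>\<^sub>F n in sequentially. dist (d (k n t)) (u t) \<le> 1 / of_nat (Suc n)"
        using near by (intro always_eventually allI less_imp_le) (simp add: dist_commute)
    qed auto
    then have "(\<lambda>n. d (k n t)) \<longlonglongrightarrow> u t" by (rule tendsto_dist_iff[THEN iffD2])
    then show "(\<lambda>n. h t (d (k n t))) \<longlonglongrightarrow> h t (u t)"
      using cont[OF t] by (auto intro: continuous_on_tendsto_compose)
  qed
qed

text \<open>
  By compactness a zero in the closed ball exists iff points of the countable dense set come
  arbitrarily close both to the ball and to being a zero.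
\<close>

lemma zero_set_hits_ball_measurable:
  fixes H :: "'a \<Rightarrow> 'e::metric_space \<Rightarrow> real" and d :: "nat \<Rightarrow> 'e"
  assumes dense: "\<And>v \<epsilon>. \<epsilon> > 0 \<Longrightarrow> \<exists>k. dist v (d k) < \<epsilon>"
    and cpt: "\<And>c r. compact (cball (c::'e) r)"
    and meas: "\<And>e. (\<lambda>t. H t e) \<in> borel_measurable M"
    and cont: "\<And>t. t \<in> space M \<Longrightarrow> continuous_on UNIV (H t)"
  shows "{t \<in> space M. \<exists>u\<in>cball c r. H t u = 0} \<in> sets M"
proof -
  have "(\<exists>u\<in>cball c r. H t u = 0) \<longleftrightarrow>
      (\<forall>n. \<exists>k. dist c (d k) < r + 1 / real (Suc n) \<and> \<bar>H t (d k)\<bar> < 1 / real (Suc n))" (is "?L \<longleftrightarrow> ?R")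
    if t: "t \<in> space M" for t
  proof
    assume ?L
    then obtain u where u: "dist c u \<le> r" "H t u = 0" by auto
    show ?R
    proof
      fix n
      have "\<exists>e>0. \<forall>y. dist y u < e \<longrightarrow> dist (H t y) (H t u) < 1 / real (Suc n)"
        using cont[OF t] unfolding continuous_on_iff
        by (metis UNIV_I divide_pos_pos of_nat_0_less_iff zero_less_Suc zero_less_one)
      then obtain e where e: "e > 0" "\<And>y. dist y u < e \<Longrightarrow> dist (H t y) (H t u) < 1 / real (Suc n)"
        by blast
      obtain k where k: "dist u (d k) < min e (1 / real (Suc n))"
        using dense[of "min e (1 / real (Suc n))" u] e(1) by auto
      have "dist c (d k) < r + 1 / real (Suc n)"
        using dist_triangle[of c "d k" u] u(1) k by auto
      moreover have "\<bar>H t (d k)\<bar> < 1 / real (Suc n)"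
        using e(2)[of "d k"] k u(2) by (simp add: dist_commute dist_real_def)
      ultimately show "\<exists>k. dist c (d k) < r + 1 / real (Suc n) \<and> \<bar>H t (d k)\<bar> < 1 / real (Suc n)" by blast
    qed
  next
    assume ?R
    then obtain k where k: "\<And>n. dist c (d (k n)) < r + 1 / real (Suc n)" "\<And>n. \<bar>H t (d (k n))\<bar> < 1 / real (Suc n)"
      by metis
    have "d (k n) \<in> cball c (r + 1)" for n
    proof -
      have "1 / real (Suc n) \<le> 1" by simp
      then have "dist c (d (k n)) \<le> r + 1" using k(1)[of n] by linarith
      then show ?thesis by simp
    qed
    then obtain u s where us: "strict_mono s" "((\<lambda>n. d (k n)) \<circ> s) \<longlonglongrightarrow> u"
      using cpt[of c "r + 1"] unfolding compact_def by (metis (no_types, lifting))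
    have inv: "(\<lambda>n. 1 / real (Suc (s n))) \<longlonglongrightarrow> 0"
      using LIMSEQ_subseq_LIMSEQ[OF LIMSEQ_Suc[OF lim_1_over_n] us(1)] by (simp add: o_def)
    have "dist c u \<le> r + 0"
    proof (rule LIMSEQ_le)
      show "(\<lambda>n. dist c (d (k (s n)))) \<longlonglongrightarrow> dist c u" using us(2) by (intro tendsto_intros) (simp add: o_def)
      show "(\<lambda>n. r + 1 / real (Suc (s n))) \<longlonglongrightarrow> r + 0" by (intro tendsto_intros inv)
    qed (use k(1) less_imp_le in blast)
    moreover have "H t u = 0"
    proof -
      have "(\<lambda>n. H t (d (k (s n)))) \<longlonglongrightarrow> H t u"
        using cont[OF t] us(2) by (auto intro: continuous_on_tendsto_compose simp: o_def)
      moreover have "(\<lambda>n. H t (d (k (s n)))) \<longlonglongrightarrow> 0"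
        by (rule tendsto_rabs_zero_cancel, rule tendsto_sandwich[OF _ _ tendsto_const inv])
          (use k(2) in \<open>auto intro!: always_eventually less_imp_le\<close>)
      ultimately show ?thesis by (rule LIMSEQ_unique)
    qed
    ultimately show ?L by auto
  qed
  then have "{t \<in> space M. \<exists>u\<in>cball c r. H t u = 0} = {t \<in> space M. \<forall>n. \<exists>k. dist c (d k) < r + 1 / real (Suc n) \<and> \<bar>H t (d k)\<bar> < 1 / real (Suc n)}"
    by blast
  also have "\<dots> \<in> sets M"
    using meas by measurable
  finally show ?thesis .
qed

text \<open>
  The Kuratowski and Ryll-Nardzewski construction: balls around points of a dense sequence, of radius
  \<open>2\<^sup>-\<^sup>n\<close>, are chosen one after the other so that each meets the set of zeros in the previous balls. The
  restriction to the chosen balls is expressed by adding to the function a term that vanishes exactly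
  there, so that the sets in question are always the zeros of one function.
\<close>

definition first_ball :: "(nat \<Rightarrow> 'e::metric_space) \<Rightarrow> ('a \<Rightarrow> 'e \<Rightarrow> real) \<Rightarrow> nat \<Rightarrow> 'a \<Rightarrow> nat" where
  "first_ball d G n t = (LEAST k. \<exists>u\<in>cball (d k) ((1/2)^n). G t u = 0)"

primrec shrink :: "(nat \<Rightarrow> 'e::metric_space) \<Rightarrow> ('a \<Rightarrow> 'e \<Rightarrow> real) \<Rightarrow> nat \<Rightarrow> 'a \<Rightarrow> 'e \<Rightarrow> real" where
  "shrink d H 0 = H"
| "shrink d H (Suc n) = (\<lambda>t u. shrink d H n t u + max 0 (dist u (d (first_ball d (shrink d H n) n t)) - (1/2)^n))"

text \<open>
  The centres of the chosen balls form a Cauchy sequence of measurable functions, and its limit is a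
  limit of zeros.
\<close>

lemma measurable_zero_selection_total:
  fixes H :: "'a \<Rightarrow> 'e::banach \<Rightarrow> real" and d :: "nat \<Rightarrow> 'e"
  assumes dense: "\<And>v \<epsilon>. \<epsilon> > 0 \<Longrightarrow> \<exists>k. dist v (d k) < \<epsilon>"
    and cpt: "\<And>c r. compact (cball (c::'e) r)"
    and meas: "\<And>e. (\<lambda>t. H t e) \<in> borel_measurable M"
    and cont: "\<And>t. t \<in> space M \<Longrightarrow> continuous_on UNIV (H t)"
    and nonneg: "\<And>t e. t \<in> space M \<Longrightarrow> H t e \<ge> 0"
    and ex: "\<And>t. t \<in> space M \<Longrightarrow> \<exists>e. H t e = 0"
  obtains u where "u \<in> borel_measurable M" "\<And>t. t \<in> space M \<Longrightarrow> H t (u t) = 0"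
proof -
  let ?G = "shrink d H"
  define p where "p = (\<lambda>n. first_ball d (?G n) n)"
  define Inv where "Inv n \<longleftrightarrow> (\<forall>e. (\<lambda>t. ?G n t e) \<in> borel_measurable M) \<and>
      (\<forall>t\<in>space M. continuous_on UNIV (?G n t) \<and> (\<forall>e. ?G n t e \<ge> 0) \<and> (\<exists>e. ?G n t e = 0))" for n
  have p_meas: "p n \<in> measurable M (count_space UNIV)" if "Inv n" for n
    unfolding p_def first_ball_def
  proof (rule measurable_Least)
    show "Measurable.pred M (\<lambda>t. \<exists>u\<in>cball (d i) ((1/2)^n). ?G n t u = 0)" for i
      unfolding pred_def
      by (rule zero_set_hits_ball_measurable[OF dense cpt]) (use that in \<open>auto simp: Inv_def\<close>)
  qed
  have hit: "\<exists>e\<in>cball (d (p n t)) ((1/2)^n). ?G n t e = 0" if "Inv n" and t: "t \<in> space M" for n t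
  proof -
    obtain e where e: "?G n t e = 0" using \<open>Inv n\<close> t unfolding Inv_def by blast
    obtain k where "dist e (d k) < (1/2)^n" using dense[of "(1/2)^n" e] by auto
    then have "\<exists>u\<in>cball (d k) ((1/2)^n). ?G n t u = 0"
      using e by (intro bexI[of _ e]) (auto simp: dist_commute)
    then show ?thesis
      unfolding p_def first_ball_def by (rule LeastI)
  qed
  have Inv: "Inv n" for n
  proof (induction n)
    case 0
    show ?case using meas cont nonneg ex by (simp add: Inv_def)
  next
    case (Suc n)
    have G: "?G (Suc n) = (\<lambda>t u. ?G n t u + max 0 (dist u (d (p n t)) - (1/2)^n))"
      by (simp add: p_def)
    show ?case
      unfolding Inv_def
    proof (intro conjI allI ballI)
      fix e
      have "(\<lambda>t. dist e (d (p n t))) \<in> borel_measurable M"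
        using measurable_compose_countable[of "\<lambda>i t. dist e (d i)" M borel "p n"] p_meas[OF Suc] by simp
      moreover have "(\<lambda>t. ?G n t e) \<in> borel_measurable M" using Suc by (auto simp: Inv_def)
      ultimately show "(\<lambda>t. ?G (Suc n) t e) \<in> borel_measurable M"
        unfolding G by measurable
    next
      fix t assume t: "t \<in> space M"
      show "continuous_on UNIV (?G (Suc n) t)"
        unfolding G using Suc t by (intro continuous_intros) (auto simp: Inv_def)
      show "?G (Suc n) t e \<ge> 0" for e unfolding G using Suc t by (intro add_nonneg_nonneg) (auto simp: Inv_def)
      obtain e where "e \<in> cball (d (p n t)) ((1/2)^n)" "?G n t e = 0" using hit[OF Suc t] by blast
      then show "\<exists>e. ?G (Suc n) t e = 0" unfolding G by (intro exI[of _ e]) (simp add: dist_commute)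
    qed
  qed
  note p = p_meas[OF Inv]
  have close: "dist (d (p n t)) e \<le> (1/2)^n" and zero: "?G n t e = 0"
    if "t \<in> space M" "?G (Suc n) t e = 0" for n t e
  proof -
    have "?G n t e \<ge> 0" using Inv[of n] that(1) unfolding Inv_def by blast
    moreover have "?G n t e + max 0 (dist e (d (p n t)) - (1/2)^n) = 0"
      using that(2) by (simp add: p_def)
    ultimately have "?G n t e = 0 \<and> max 0 (dist e (d (p n t)) - (1/2)^n) = 0" by linarith
    then show "dist (d (p n t)) e \<le> (1/2)^n" "?G n t e = 0" by (auto simp: dist_commute max_def split: if_splits)
  qed
  have zero_le: "?G n t e = 0" if "t \<in> space M" "n \<le> m" "?G m t e = 0" for n m t e
    using that(2,3) by (induction m rule: dec_induct) (use zero[OF that(1)] in blast)+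
  have "\<exists>u. (\<lambda>n. d (p n t)) \<longlonglongrightarrow> u \<and> H t u = 0" if t: "t \<in> space M" for t
  proof -
    have "\<exists>e. ?G n t e = 0" for n using Inv[of n] t unfolding Inv_def by blast
    then obtain x where x: "\<And>n. ?G n t (x n) = 0" by metis
    have near: "dist (d (p n t)) (x m) \<le> (1/2)^n" if "n < m" for n m
      using close[OF t, of n "x m"] zero_le[OF t _ x, of "Suc n" m] that by simp
    have half: "(\<lambda>n. (1/2)^n :: real) \<longlonglongrightarrow> 0" by (rule LIMSEQ_power_zero) simp
    have "Cauchy (\<lambda>n. d (p n t))"
    proof (rule metric_CauchyI)
      fix e :: real assume "e > 0"
      then have "\<forall>\<^sub>F n in sequentially. (1/2)^n < e/2" using order_tendstoD(2)[OF half, of "e/2"] by simp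
      then obtain N where N: "\<And>n. n \<ge> N \<Longrightarrow> (1/2)^n < e/2" unfolding eventually_sequentially by blast
      show "\<exists>M. \<forall>m\<ge>M. \<forall>n\<ge>M. dist (d (p m t)) (d (p n t)) < e"
      proof (intro exI allI impI)
        fix m n assume mn: "N \<le> m" "N \<le> n"
        have "dist (d (p m t)) (d (p n t)) \<le> dist (d (p m t)) (x (Suc (max m n))) + dist (d (p n t)) (x (Suc (max m n)))"
          by (rule dist_triangle2)
        also have "\<dots> \<le> (1/2)^m + (1/2)^n" by (intro add_mono near) auto
        also have "\<dots> < e" using N[OF mn(1)] N[OF mn(2)] by simp
        finally show "dist (d (p m t)) (d (p n t)) < e" .
      qed
    qed
    then obtain u where u: "(\<lambda>n. d (p n t)) \<longlonglongrightarrow> u" using Cauchy_convergent_iff convergent_def by blast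
    have "(\<lambda>n. dist (d (p n t)) (x (Suc n))) \<longlonglongrightarrow> 0"
      by (rule tendsto_sandwich[OF _ _ tendsto_const half]) (auto intro!: always_eventually near)
    from tendsto_dist_iff[THEN iffD1, OF u] this
    have "(\<lambda>n. dist (d (p n t)) u + dist (d (p n t)) (x (Suc n))) \<longlonglongrightarrow> 0 + 0" by (rule tendsto_add)
    then have sum0: "(\<lambda>n. dist (d (p n t)) u + dist (d (p n t)) (x (Suc n))) \<longlonglongrightarrow> 0" by simp
    have "dist (x (Suc n)) u \<le> dist (d (p n t)) u + dist (d (p n t)) (x (Suc n))" for n
      using dist_triangle3[of "x (Suc n)" u "d (p n t)"] by simp
    then have "(\<lambda>n. dist (x (Suc n)) u) \<longlonglongrightarrow> 0"
      by (intro tendsto_sandwich[OF _ _ tendsto_const sum0] always_eventually allI) auto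
    then have "(\<lambda>n. x (Suc n)) \<longlonglongrightarrow> u" by (rule tendsto_dist_iff[THEN iffD2])
    then have "(\<lambda>n. H t (x (Suc n))) \<longlonglongrightarrow> H t u"
      using cont[OF t] by (auto intro: continuous_on_tendsto_compose)
    moreover have "H t (x (Suc n)) = 0" for n using zero_le[OF t _ x, of 0 "Suc n"] by simp
    ultimately have "(\<lambda>n::nat. 0) \<longlonglongrightarrow> H t u" by simp
    then have "H t u = 0" by (rule LIMSEQ_unique[OF _ tendsto_const])
    then show ?thesis using u by blast
  qed
  then obtain u where u: "\<And>t. t \<in> space M \<Longrightarrow> (\<lambda>n. d (p n t)) \<longlonglongrightarrow> u t" "\<And>t. t \<in> space M \<Longrightarrow> H t (u t) = 0"
    by metis
  have "u \<in> borel_measurable M"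
  proof (rule borel_measurable_LIMSEQ_metric[OF _ u(1)])
    show "(\<lambda>t. d (p n t)) \<in> borel_measurable M" for n
      using measurable_compose_countable[of "\<lambda>i t. d i" M borel "p n"] p by simp
  qed
  then show ?thesis using that u(2) by blast
qed

text \<open>
  Where there is no zero, the norm is substituted for \<open>H\<close>.
\<close>

lemma measurable_zero_selection:
  fixes H :: "'a \<Rightarrow> 'e::banach \<Rightarrow> real" and d :: "nat \<Rightarrow> 'e"
  assumes dense: "\<And>v \<epsilon>. \<epsilon> > 0 \<Longrightarrow> \<exists>k. dist v (d k) < \<epsilon>"
    and cpt: "\<And>c r. compact (cball (c::'e) r)"
    and meas: "\<And>e. (\<lambda>t. H t e) \<in> borel_measurable M"
    and cont: "\<And>t. t \<in> space M \<Longrightarrow> continuous_on UNIV (H t)"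
    and nonneg: "\<And>t e. t \<in> space M \<Longrightarrow> H t e \<ge> 0"
  shows "{t \<in> space M. \<exists>e. H t e = 0} \<in> sets M"
    and "\<exists>u. u \<in> borel_measurable M \<and> (\<forall>t\<in>space M. (\<exists>e. H t e = 0) \<longrightarrow> H t (u t) = 0)"
proof -
  let ?T = "{t \<in> space M. \<exists>e. H t e = 0}"
  have "?T = (\<Union>n::nat. {t \<in> space M. \<exists>u\<in>cball 0 (real n). H t u = 0})"
  proof (intro equalityI subsetI)
    fix t assume "t \<in> ?T"
    then obtain e where e: "t \<in> space M" "H t e = 0" by blast
    obtain n where "norm e \<le> real n" using real_arch_simple by blast
    then have "t \<in> {t \<in> space M. \<exists>u\<in>cball 0 (real n). H t u = 0}" using e by auto
    then show "t \<in> (\<Union>n::nat. {t \<in> space M. \<exists>u\<in>cball 0 (real n). H t u = 0})" by blast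
  qed auto
  then show T: "?T \<in> sets M"
    using zero_set_hits_ball_measurable[OF dense cpt meas cont] by auto
  define G where "G = (\<lambda>t e. if t \<in> ?T then H t e else norm e)"
  obtain u where u: "u \<in> borel_measurable M" "\<And>t. t \<in> space M \<Longrightarrow> G t (u t) = 0"
  proof (rule measurable_zero_selection_total[OF dense cpt, of G M])
    show "(\<lambda>t. G t e) \<in> borel_measurable M" for e
      unfolding G_def using T meas by measurable
    show "continuous_on UNIV (G t)" if "t \<in> space M" for t
      using cont[OF that] by (cases "t \<in> ?T") (auto simp: G_def intro: continuous_intros)
    show "G t e \<ge> 0" if "t \<in> space M" for t e using nonneg[OF that] by (simp add: G_def)
    show "\<exists>e. G t e = 0" if "t \<in> space M" for t by (auto simp: G_def)
  qed blast+
  then show "\<exists>u. u \<in> borel_measurable M \<and> (\<forall>t\<in>space M. (\<exists>e. H t e = 0) \<longrightarrow> H t (u t) = 0)"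
  proof (intro exI[of _ u] conjI ballI impI)
    fix t assume t: "t \<in> space M" "\<exists>e. H t e = 0"
    then have "G t (u t) = H t (u t)" unfolding G_def by (intro if_P) blast
    then show "H t (u t) = 0" using u(2)[OF t(1)] by simp
  qed (rule u(1))
qed

section \<open>Reparametrization by a multiple of arc length\<close>

text \<open>
  A case of the Vitali--Caratheodory theorem: \<open>w\<close> is approximated within \<open>\<delta>\<close> by \<open>\<delta>\<close> times the sum of
  the indicators of its superlevel sets at the multiples of \<open>\<delta>\<close>, and these sets are enlarged to open
  sets at a small cost of measure. A sum of nonnegative multiples of indicators of open sets is lower
  semicontinuous.
\<close>

lemma lower_semicontinuous_majorant:
  fixes w :: "real \<Rightarrow> real"
  assumes ab: "a < b" and w: "w \<in> borel_measurable borel" "\<And>t. 0 \<le> w t"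
    and fin: "(\<integral>\<^sup>+t\<in>{a..b}. ennreal (w t) \<partial>lborel) < ennreal \<Lambda>"
  obtains g :: "real \<Rightarrow> ennreal" and \<delta> :: real
  where "g \<in> borel_measurable borel" "\<delta> > 0" "\<And>t. ennreal \<delta> \<le> g t"
    "\<And>t. t \<in> {a..b} \<Longrightarrow> ennreal (w t + \<delta>) \<le> g t"
    "\<And>t c. c < g t \<Longrightarrow> \<exists>e>0. \<forall>s\<in>ball t e. c \<le> g s"
    "(\<integral>\<^sup>+t\<in>{a..b}. g t \<partial>lborel) \<le> ennreal \<Lambda>"
proof -
  obtain L where L: "(\<integral>\<^sup>+t\<in>{a..b}. ennreal (w t) \<partial>lborel) = ennreal L" "0 \<le> L"
    using fin by (cases "\<integral>\<^sup>+t\<in>{a..b}. ennreal (w t) \<partial>lborel") auto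
  with fin have "L < \<Lambda>" by (simp add: ennreal_less_iff)
  note L = L this
  define \<delta> where "\<delta> = (\<Lambda> - L) / (2 * (b - a) + 2)"
  have \<delta>: "\<delta> > 0" "L + 2 * \<delta> * (b - a) + 2 * \<delta> = \<Lambda>"
  proof -
    have pos: "2 * (b - a) + 2 > 0" using ab by simp
    then show "\<delta> > 0" using L(3) by (simp add: \<delta>_def)
    have "\<delta> * (2 * (b - a) + 2) = \<Lambda> - L" using pos unfolding \<delta>_def by simp
    then show "L + 2 * \<delta> * (b - a) + 2 * \<delta> = \<Lambda>" by (simp add: algebra_simps)
  qed
  define A where "A k = {t \<in> {a..b}. real k * \<delta> < w t}" for k :: nat
  have A: "A k \<in> sets borel" for k unfolding A_def using w(1) by measurable
  have "\<exists>U. open U \<and> A k \<subseteq> U \<and> emeasure lborel (U - A k) \<le> ennreal ((1/2)^k)" for k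
  proof -
    have "A k \<in> sets lebesgue" using A by simp
    moreover have "(0::real) < (1/2)^k" by simp
    ultimately obtain U where U: "open U" "A k \<subseteq> U" "U - A k \<in> lmeasurable"
        "emeasure lebesgue (U - A k) < ennreal ((1/2)^k)"
      by (rule sets_lebesgue_outer_open)
    have "U - A k \<in> sets lborel" using A[of k] U(1) by auto
    then have "emeasure lebesgue (U - A k) = emeasure lborel (U - A k)" by simp
    then have "emeasure lborel (U - A k) < ennreal ((1/2)^k)" using U(4) by (simp only:)
    then have "emeasure lborel (U - A k) \<le> ennreal ((1/2)^k)" by (rule less_imp_le)
    then show ?thesis using U(1,2) by blast
  qed
  then obtain U where U: "\<And>k. open (U k)" "\<And>k. A k \<subseteq> U k" "\<And>k. emeasure lborel (U k - A k) \<le> ennreal ((1/2)^k)"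
    by metis
  \<comment> \<open>the whole line is added to the family so that the majorant exceeds \<open>w\<close> by \<open>\<delta>\<close>\<close>
  define V where "V k = (case k of 0 \<Rightarrow> UNIV | Suc k \<Rightarrow> U k)" for k
  have V: "open (V k)" for k using U(1) by (auto simp: V_def split: nat.split)
  define g where "g t = (\<Sum>k. ennreal \<delta> * indicator (V k) t)" for t
  have g_split: "g t = ennreal \<delta> + (\<Sum>k. ennreal \<delta> * indicator (U k) t)" for t
    unfolding g_def by (subst suminf_offset[of _ 1]) (auto simp: V_def)
  have sumA: "ennreal (w t) \<le> (\<Sum>k. ennreal \<delta> * indicator (A k) t)"
    "(\<Sum>k. ennreal \<delta> * indicator (A k) t) \<le> ennreal (w t + \<delta>)" if t: "t \<in> {a..b}" for t
  proof -
    \<comment> \<open>\<open>t\<close> belongs to exactly the first \<open>n\<close> of the superlevel sets\<close>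
    define n where "n = nat \<lceil>w t / \<delta>\<rceil>"
    have pos: "0 \<le> w t / \<delta>" using w(2) \<delta>(1) by simp
    have n: "w t \<le> real n * \<delta>" "real n * \<delta> \<le> w t + \<delta>" "real k * \<delta> < w t \<longleftrightarrow> k < n" for k
    proof -
      have rn: "real n = of_int \<lceil>w t / \<delta>\<rceil>" using pos by (simp add: n_def)
      have "w t / \<delta> \<le> real n" unfolding rn by simp
      then show "w t \<le> real n * \<delta>" using \<delta>(1) by (simp add: field_simps)
      have "real n \<le> w t / \<delta> + 1" unfolding rn by linarith
      then show "real n * \<delta> \<le> w t + \<delta>" using \<delta>(1) by (simp add: field_simps)
      have "real k * \<delta> < w t \<longleftrightarrow> real k < w t / \<delta>" using \<delta>(1) by (simp add: field_simps)
      also have "\<dots> \<longleftrightarrow> int k < \<lceil>w t / \<delta>\<rceil>" by (simp add: less_ceiling_iff)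
      also have "\<dots> \<longleftrightarrow> k < n" using pos unfolding n_def by (simp add: zless_nat_eq_int_zless)
      finally show "real k * \<delta> < w t \<longleftrightarrow> k < n" .
    qed
    have ind: "indicator (A k) t = (if k < n then 1 else 0 :: ennreal)" for k
      using n(3)[of k] t by (auto simp: A_def)
    have "(\<Sum>k. ennreal \<delta> * indicator (A k) t) = (\<Sum>k<n. ennreal \<delta> * indicator (A k) t)"
      by (rule suminf_finite) (auto simp: ind)
    also have "\<dots> = (\<Sum>k<n. ennreal \<delta>)" by (rule sum.cong) (auto simp: ind)
    also have "\<dots> = ennreal (real n * \<delta>)" using \<delta>(1) by (simp add: ennreal_mult ennreal_of_nat_eq_real_of_nat)
    finally have eq: "(\<Sum>k. ennreal \<delta> * indicator (A k) t) = ennreal (real n * \<delta>)" .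
    show "ennreal (w t) \<le> (\<Sum>k. ennreal \<delta> * indicator (A k) t)"
      "(\<Sum>k. ennreal \<delta> * indicator (A k) t) \<le> ennreal (w t + \<delta>)"
      unfolding eq using n(1,2) by (auto intro: ennreal_leI)
  qed
  show ?thesis
  proof (rule that[of g \<delta>])
    have [measurable]: "V k \<in> sets borel" for k using V by simp
    show "g \<in> borel_measurable borel" unfolding g_def by measurable
    show "ennreal \<delta> \<le> g t" for t unfolding g_split by simp
    show "ennreal (w t + \<delta>) \<le> g t" if t: "t \<in> {a..b}" for t
    proof -
      have "ennreal (w t) \<le> (\<Sum>k. ennreal \<delta> * indicator (A k) t)" by (rule sumA[OF t])
      also have "\<dots> \<le> (\<Sum>k. ennreal \<delta> * indicator (U k) t)"
        by (intro suminf_le mult_left_mono summableI) (use U(2) in \<open>auto simp: indicator_def\<close>)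
      finally have "ennreal \<delta> + ennreal (w t) \<le> g t" unfolding g_split by (rule add_left_mono)
      then show ?thesis using w(2)[of t] \<delta>(1) by (simp add: ennreal_plus add.commute)
    qed
    show "\<exists>e>0. \<forall>s\<in>ball t e. c \<le> g s" if c: "c < g t" for t c
    proof -
      obtain n where n: "c < (\<Sum>k<n. ennreal \<delta> * indicator (V k) t)"
        using c unfolding g_def suminf_eq_SUP less_SUP_iff by blast
      define W where "W = (\<Inter>k\<in>{k. k < n \<and> t \<in> V k}. V k)"
      have "open W" unfolding W_def by (intro open_INT) (use V in auto)
      moreover have "t \<in> W" by (auto simp: W_def)
      ultimately obtain e where e: "e > 0" "ball t e \<subseteq> W" by (meson openE)
      have "c \<le> g s" if "s \<in> ball t e" for s
      proof -
        have "s \<in> W" using that e by auto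
        have "c \<le> (\<Sum>k<n. ennreal \<delta> * indicator (V k) t)" using n by simp
        also have "\<dots> \<le> (\<Sum>k<n. ennreal \<delta> * indicator (V k) s)"
          by (intro sum_mono mult_left_mono) (use \<open>s \<in> W\<close> in \<open>auto simp: W_def indicator_def\<close>)
        also have "\<dots> \<le> g s" unfolding g_def by (rule sum_le_suminf) auto
        finally show ?thesis .
      qed
      then show ?thesis using e(1) by blast
    qed
    have "(\<integral>\<^sup>+t\<in>{a..b}. g t \<partial>lborel) \<le> (\<integral>\<^sup>+t. (ennreal (w t) * indicator {a..b} t + ennreal (2 * \<delta>) * indicator {a..b} t)
        + (\<Sum>k. ennreal \<delta> * indicator (U k - A k) t) \<partial>lborel)"
    proof (rule nn_integral_mono)
      fix t
      show "g t * indicator {a..b} t \<le> (ennreal (w t) * indicator {a..b} t + ennreal (2 * \<delta>) * indicator {a..b} t)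
        + (\<Sum>k. ennreal \<delta> * indicator (U k - A k) t)"
      proof (cases "t \<in> {a..b}")
        case True
        have "(\<Sum>k. ennreal \<delta> * indicator (U k) t) = (\<Sum>k. ennreal \<delta> * indicator (A k) t + ennreal \<delta> * indicator (U k - A k) t)"
        proof (rule suminf_cong)
          fix k
          show "ennreal \<delta> * indicator (U k) t = ennreal \<delta> * indicator (A k) t + ennreal \<delta> * indicator (U k - A k) t"
            using U(2)[of k] by (auto simp: indicator_def)
        qed
        also have "\<dots> = (\<Sum>k. ennreal \<delta> * indicator (A k) t) + (\<Sum>k. ennreal \<delta> * indicator (U k - A k) t)"
          by (rule suminf_add[symmetric]) auto
        also have "\<dots> \<le> ennreal (w t + \<delta>) + (\<Sum>k. ennreal \<delta> * indicator (U k - A k) t)"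
          by (intro add_right_mono sumA(2)[OF True])
        finally have "g t \<le> ennreal \<delta> + (ennreal (w t + \<delta>) + (\<Sum>k. ennreal \<delta> * indicator (U k - A k) t))"
          unfolding g_split by (rule add_left_mono)
        also have "\<dots> = ennreal (w t) + ennreal (2 * \<delta>) + (\<Sum>k. ennreal \<delta> * indicator (U k - A k) t)"
          using w(2)[of t] \<delta>(1) by (simp add: add.assoc[symmetric] flip: ennreal_plus)
        finally show ?thesis using True by simp
      qed simp
    qed
    also have "\<dots> = (\<integral>\<^sup>+t\<in>{a..b}. ennreal (w t) \<partial>lborel) + ennreal (2 * \<delta>) * emeasure lborel {a..b}
        + (\<Sum>k. ennreal \<delta> * emeasure lborel (U k - A k))"
    proof -
      have [measurable]: "U k - A k \<in> sets borel" for k using U(1)[of k] A[of k] by auto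
      have [measurable]: "w \<in> borel_measurable borel" by (rule w(1))
      have "(\<integral>\<^sup>+t. (\<Sum>k. ennreal \<delta> * indicator (U k - A k) t) \<partial>lborel) = (\<Sum>k. ennreal \<delta> * emeasure lborel (U k - A k))"
        by (subst nn_integral_suminf) (auto simp: nn_integral_cmult_indicator simp del: ennreal_suminf_cmult)
      moreover have "(\<integral>\<^sup>+t. ennreal (2 * \<delta>) * indicator {a..b} t \<partial>lborel) = ennreal (2 * \<delta>) * emeasure lborel {a..b}"
        by (rule nn_integral_cmult_indicator) simp
      ultimately show ?thesis by (simp add: nn_integral_add del: ennreal_suminf_cmult)
    qed
    also have "\<dots> \<le> ennreal L + ennreal (2 * \<delta> * (b - a)) + ennreal (2 * \<delta>)"
    proof (intro add_mono)
      show "(\<integral>\<^sup>+t\<in>{a..b}. ennreal (w t) \<partial>lborel) \<le> ennreal L" using L(1) by simp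
      show "ennreal (2 * \<delta>) * emeasure lborel {a..b} \<le> ennreal (2 * \<delta> * (b - a))"
        using ab \<delta>(1) by (simp add: ennreal_mult'')
      have "(\<Sum>k. ennreal \<delta> * emeasure lborel (U k - A k)) \<le> (\<Sum>k. ennreal (\<delta> * (1/2)^k))"
        using U(3) \<delta>(1) by (intro suminf_le summableI) (auto simp: ennreal_mult intro!: mult_left_mono)
      also have "\<dots> = ennreal (2 * \<delta>)"
      proof -
        have "(\<lambda>k. \<delta> * (1/2)^k) sums (\<delta> * (1 / (1 - 1/2)))"
          by (intro sums_mult geometric_sums) simp
        then have "(\<lambda>k. \<delta> * (1/2)^k) sums (2 * \<delta>)" by (simp add: mult.commute)
        then show ?thesis using \<delta>(1) by (intro suminf_ennreal_eq) auto
      qed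
      finally show "(\<Sum>k. ennreal \<delta> * emeasure lborel (U k - A k)) \<le> ennreal (2 * \<delta>)" .
    qed
    also have "\<dots> = ennreal \<Lambda>"
      using L(2) \<delta> ab by (simp flip: ennreal_plus)
    finally show "(\<integral>\<^sup>+t\<in>{a..b}. g t \<partial>lborel) \<le> ennreal \<Lambda>" .
  qed (rule \<delta>(1))
qed

text \<open>
  Let \<open>g\<close> be a lower semicontinuous majorant of \<open>w\<close>, \<open>\<mu>\<close> the measure on \<open>[a,b]\<close> with density \<open>g\<close>, and \<open>\<psi>\<close>
  its distribution function, with total mass \<open>T \<le> \<Lambda>\<close>. As \<open>g\<close> is bounded below by a positive constant,
  \<open>\<psi>\<close> is a homeomorphism onto \<open>[0,T]\<close> with Lipschitz inverse, and \<open>\<sigma>(x)\<close> is defined by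
  \<open>\<psi>(\<sigma>(x)) = T x\<close>. The image of Lebesgue measure under \<open>\<sigma>\<close> is \<open>\<mu> / T\<close>, which yields the statement on
  null sets.
\<close>

lemma speed_reparametrization:
  fixes w :: "real \<Rightarrow> real"
  assumes ab: "a < b" and w: "w \<in> borel_measurable borel" "\<And>t. 0 \<le> w t"
    and fin: "(\<integral>\<^sup>+t\<in>{a..b}. ennreal (w t) \<partial>lborel) < ennreal \<Lambda>"
  obtains \<sigma> :: "real \<Rightarrow> real" and K :: real
  where "\<sigma> 0 = a" "\<sigma> 1 = b" "K > 0"
    "\<And>x y. 0 \<le> x \<Longrightarrow> x < y \<Longrightarrow> y \<le> 1 \<Longrightarrow> \<sigma> x < \<sigma> y \<and> \<sigma> y - \<sigma> x \<le> K * (y - x)"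
    "\<And>Z. negligible Z \<Longrightarrow> negligible {x \<in> {0..1}. \<sigma> x \<in> Z}"
    "\<And>x D. x \<in> {0<..<1} \<Longrightarrow> (\<sigma> has_real_derivative D) (at x) \<Longrightarrow> D * w (\<sigma> x) \<le> \<Lambda>"
proof -
  obtain g :: "real \<Rightarrow> ennreal" and \<delta> :: real where g: "g \<in> borel_measurable borel" and \<delta>: "\<delta> > 0"
    and g_ge: "\<And>t. ennreal \<delta> \<le> g t" "\<And>t. t \<in> {a..b} \<Longrightarrow> ennreal (w t + \<delta>) \<le> g t"
    and lsc: "\<And>t c. c < g t \<Longrightarrow> \<exists>e>0. \<forall>s\<in>ball t e. c \<le> g s"
    and g_int: "(\<integral>\<^sup>+t\<in>{a..b}. g t \<partial>lborel) \<le> ennreal \<Lambda>"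
    using lower_semicontinuous_majorant[OF ab w fin] by blast
  note [measurable] = g
  have \<Lambda>: "\<Lambda> \<ge> 0" using fin by (metis ennreal_neg less_ennreal_def linorder_not_le not_less_zero order_less_imp_le)
  define \<mu> where "\<mu> = density lborel (\<lambda>t. g t * indicator {a..b} t)"
  have \<mu>_eq: "emeasure \<mu> S = (\<integral>\<^sup>+t. g t * indicator {a..b} t * indicator S t \<partial>lborel)" if "S \<in> sets borel" for S
    unfolding \<mu>_def using that by (subst emeasure_density) auto
  have \<mu>_space: "emeasure \<mu> UNIV \<le> ennreal \<Lambda>"
    using g_int by (subst \<mu>_eq) auto
  interpret finite_borel_measure \<mu>
  proof (rule finite_borel_measure.intro)
    show "finite_measure \<mu>"
      by (rule finite_measureI) (use \<mu>_space in \<open>auto simp: \<mu>_def top_unique\<close>)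
    show "finite_borel_measure_axioms \<mu>"
      by unfold_locales (simp add: \<mu>_def)
  qed
  define \<psi> where "\<psi> = cdf \<mu>"
  define T where "T = \<psi> b"
  have sing: "emeasure \<mu> S = 0" if "S \<in> sets borel" "emeasure lborel S = 0" for S
  proof -
    have "AE t in lborel. t \<notin> S"
      using that by (intro AE_not_in) (auto simp: null_sets_def)
    then have "AE t in lborel. g t * indicator {a..b} t * indicator S t = 0" by eventually_elim simp
    then have "(\<integral>\<^sup>+t. g t * indicator {a..b} t * indicator S t \<partial>lborel) = (\<integral>\<^sup>+(t::real). 0 \<partial>lborel)"
      by (rule nn_integral_cong_AE)
    then have "emeasure \<mu> S = 0" unfolding \<mu>_eq[OF that(1)] by simp
    then show ?thesis by simp
  qed
  have \<psi>_cont: "continuous_on S \<psi>" for S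
  proof -
    have "isCont \<psi> x" for x
      unfolding \<psi>_def isCont_cdf using sing[of "{x}"] by (simp add: measure_def)
    then show ?thesis by (simp add: continuous_at_imp_continuous_on)
  qed
  have \<psi>_left: "\<psi> x = 0" if "x \<le> a" for x
  proof -
    have "emeasure \<mu> {..x} = (\<integral>\<^sup>+(t::real). 0 \<partial>lborel)"
    proof (subst \<mu>_eq, simp, rule nn_integral_cong_AE)
      show "AE t in lborel. g t * indicator {a..b} t * indicator {..x} t = 0"
        using AE_lborel_singleton[of a] by eventually_elim (use that in \<open>auto simp: indicator_def\<close>)
    qed
    then show ?thesis by (simp add: \<psi>_def cdf_def measure_def)
  qed
  have \<psi>_inc: "c * (y - x) \<le> \<psi> y - \<psi> x"
    if "x \<le> y" "a \<le> x" "y \<le> b" "c \<ge> 0" "\<And>t. t \<in> {x..y} \<Longrightarrow> ennreal c \<le> g t" for x y c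
  proof (cases "x = y")
    case False
    then have xy: "x < y" using that(1) by simp
    have "ennreal (c * (y - x)) = ennreal c * emeasure lborel {x<..y}"
      using that xy by (simp add: ennreal_mult)
    also have "\<dots> = (\<integral>\<^sup>+t. ennreal c * indicator {x<..y} t \<partial>lborel)" by (simp add: nn_integral_cmult_indicator)
    also have "\<dots> \<le> (\<integral>\<^sup>+t. g t * indicator {a..b} t * indicator {x<..y} t \<partial>lborel)"
      by (rule nn_integral_mono) (use that in \<open>auto simp: indicator_def\<close>)
    also have "\<dots> = emeasure \<mu> {x<..y}" by (subst \<mu>_eq) auto
    also have "\<dots> = ennreal (\<psi> y - \<psi> x)"
      unfolding \<psi>_def cdf_diff_eq[OF xy] by (rule emeasure_eq_measure)
    finally show ?thesis
      using cdf_nondecreasing[of x y] that(1) by (simp add: \<psi>_def ennreal_le_iff)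
  qed simp
  have \<psi>_\<delta>: "\<delta> * (y - x) \<le> \<psi> y - \<psi> x" if "x \<le> y" "a \<le> x" "y \<le> b" for x y
    by (rule \<psi>_inc) (use that \<delta> g_ge(1) in auto)
  have \<psi>_strict: "\<psi> x < \<psi> y" if "x < y" "a \<le> x" "y \<le> b" for x y
  proof -
    have "0 < \<delta> * (y - x)" using that \<delta> by simp
    then show ?thesis using \<psi>_\<delta>[of x y] that by simp
  qed
  have T: "T > 0" using \<psi>_strict[of a b] \<psi>_left[of a] ab by (simp add: T_def)
  have "T \<le> \<Lambda>"
  proof -
    have "ennreal T \<le> emeasure \<mu> UNIV"
      unfolding T_def \<psi>_def cdf_def emeasure_eq_measure[symmetric] by (rule emeasure_mono) (auto simp: M_is_borel)
    then show ?thesis using \<mu>_space \<Lambda> by (metis ennreal_le_iff order_trans)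
  qed
  have \<psi>_b: "emeasure \<mu> UNIV = ennreal T"
  proof -
    have "emeasure \<mu> UNIV = emeasure \<mu> {..b}"
      by (simp only: \<mu>_eq[OF space_in_borel[unfolded space_borel]] \<mu>_eq[OF atMost_borel])
        (rule nn_integral_cong, auto simp: indicator_def)
    then show ?thesis by (simp add: T_def \<psi>_def cdf_def emeasure_eq_measure)
  qed
  \<comment> \<open>the inverse function of \<open>\<psi> / T\<close>\<close>
  have "\<exists>t. t \<in> {a..b} \<and> \<psi> t = T * x" if x: "x \<in> {0..1}" for x
  proof -
    have "\<exists>t. a \<le> t \<and> t \<le> b \<and> \<psi> t = T * x"
    proof (rule IVT')
      show "\<psi> a \<le> T * x" using x T \<psi>_left[of a] by simp
      show "T * x \<le> \<psi> b" using x T unfolding T_def[symmetric] by (simp add: mult_left_le)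
    qed (use ab \<psi>_cont in auto)
    then show ?thesis by auto
  qed
  then obtain \<sigma> where \<sigma>: "\<And>x. x \<in> {0..1} \<Longrightarrow> \<sigma> x \<in> {a..b}" "\<And>x. x \<in> {0..1} \<Longrightarrow> \<psi> (\<sigma> x) = T * x" by metis
  have inj: "s = t" if "s \<in> {a..b}" "t \<in> {a..b}" "\<psi> s = \<psi> t" for s t
    using \<psi>_strict[of s t] \<psi>_strict[of t s] that by (cases s t rule: linorder_cases) auto
  have \<sigma>0: "\<sigma> 0 = a" and \<sigma>1: "\<sigma> 1 = b"
    using inj[of "\<sigma> 0" a] inj[of "\<sigma> 1" b] \<sigma>[of 0] \<sigma>[of 1] \<psi>_left[of a] ab by (auto simp: T_def)
  have \<sigma>_mono: "\<sigma> x < \<sigma> y" and \<sigma>_lip: "\<sigma> y - \<sigma> x \<le> T / \<delta> * (y - x)" if "0 \<le> x" "x < y" "y \<le> 1" for x y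
  proof -
    have lt: "\<psi> (\<sigma> x) < \<psi> (\<sigma> y)" using \<sigma>(2)[of x] \<sigma>(2)[of y] that T by simp
    show "\<sigma> x < \<sigma> y"
    proof (rule ccontr)
      assume "\<not> \<sigma> x < \<sigma> y"
      then have "\<psi> (\<sigma> y) \<le> \<psi> (\<sigma> x)" unfolding \<psi>_def by (intro cdf_nondecreasing) simp
      then show False using lt by simp
    qed
    then have "\<delta> * (\<sigma> y - \<sigma> x) \<le> T * (y - x)"
      using \<psi>_\<delta>[of "\<sigma> x" "\<sigma> y"] \<sigma>[of x] \<sigma>[of y] that by (simp add: algebra_simps)
    then show "\<sigma> y - \<sigma> x \<le> T / \<delta> * (y - x)" using \<delta> by (simp add: field_simps)
  qed
  have \<sigma>_cont: "continuous_on {0..1} \<sigma>"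
  proof (rule continuous_on_iff[THEN iffD2], intro ballI allI impI)
    fix x e :: real assume x: "x \<in> {0..1}" and e: "0 < e"
    have "dist (\<sigma> y) (\<sigma> x) \<le> T / \<delta> * dist y x" if "y \<in> {0..1}" for y
      using \<sigma>_mono[of x y] \<sigma>_mono[of y x] \<sigma>_lip[of x y] \<sigma>_lip[of y x] that x
      by (cases x y rule: linorder_cases) (auto simp: dist_real_def)
    moreover have "T / \<delta> * dist y x < e" if "dist y x < e * \<delta> / T" for y
      using that T \<delta> by (simp add: field_simps)
    ultimately show "\<exists>d>0. \<forall>x'\<in>{0..1}. dist x' x < d \<longrightarrow> dist (\<sigma> x') (\<sigma> x) < e"
      using e T \<delta> by (intro exI[of _ "e * \<delta> / T"] conjI ballI impI) (simp, meson le_less_trans)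
  qed
  \<comment> \<open>\<open>\<sigma>\<close> transports Lebesgue measure to a multiple of \<open>\<mu>\<close>\<close>
  let ?I = "restrict_space lborel {0..1::real}"
  have \<sigma>_meas: "\<sigma> \<in> measurable ?I borel"
    using borel_measurable_continuous_on_restrict[OF \<sigma>_cont]
    by (simp cong: measurable_cong_sets add: sets_restrict_space_cong[OF sets_lborel])
  have distr_eq: "distr ?I borel \<sigma> = scale_measure (ennreal (1/T)) \<mu>"
  proof (rule measure_eqI_lessThan)
    show "sets (distr ?I borel \<sigma>) = sets borel" by simp
    show "sets (scale_measure (ennreal (1/T)) \<mu>) = sets borel" by (simp add: M_is_borel)
    fix x
    have D: "emeasure (distr ?I borel \<sigma>) {x<..} = emeasure lborel {y \<in> {0..1}. x < \<sigma> y}"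
    proof -
      have "emeasure (distr ?I borel \<sigma>) {x<..} = emeasure ?I (\<sigma> -` {x<..} \<inter> space ?I)"
        by (rule emeasure_distr[OF \<sigma>_meas]) simp
      also have "\<sigma> -` {x<..} \<inter> space ?I = {y \<in> {0..1}. x < \<sigma> y}" by (auto simp: space_restrict_space)
      also have "emeasure ?I {y \<in> {0..1}. x < \<sigma> y} = emeasure lborel {y \<in> {0..1}. x < \<sigma> y}"
        by (rule emeasure_restrict_space) auto
      finally show ?thesis .
    qed
    have "emeasure lborel {y \<in> {0..1}. x < \<sigma> y} \<le> emeasure lborel {0..1::real}" by (rule emeasure_mono) auto
    then show "emeasure (distr ?I borel \<sigma>) {x<..} < \<infinity>" unfolding D by (auto simp: top_unique less_top[symmetric])
    have N: "emeasure \<mu> {x<..} = ennreal (T - \<psi> x)"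
    proof -
      have "measure \<mu> {x<..} = measure \<mu> UNIV - measure \<mu> {..x}"
        using finite_measure_Diff[of UNIV "{..x}"] by (simp add: M_is_borel Compl_eq_Diff_UNIV[symmetric] Compl_atMost)
      also have "measure \<mu> UNIV = T" using \<psi>_b T by (simp add: measure_def)
      finally show ?thesis by (simp add: emeasure_eq_measure \<psi>_def cdf_def)
    qed
    have "emeasure lborel {y \<in> {0..1}. x < \<sigma> y} = ennreal ((T - \<psi> x) / T)"
    proof (cases "x < a")
      case True
      then have "{y \<in> {0..1}. x < \<sigma> y} = {0..1}" using \<sigma>(1) by fastforce
      then show ?thesis using \<psi>_left[of x] True T by simp
    next
      case ax: False
      show ?thesis
      proof (cases "x \<le> b")
        case True
        have \<psi>x: "0 \<le> \<psi> x" "\<psi> x \<le> T" unfolding T_def \<psi>_def by (rule cdf_nonneg, rule cdf_nondecreasing[OF True])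
        have "x < \<sigma> y \<longleftrightarrow> \<psi> x < T * y" if "y \<in> {0..1}" for y
        proof
          assume "x < \<sigma> y"
          then show "\<psi> x < T * y" using \<psi>_strict[of x "\<sigma> y"] \<sigma>[OF that] ax by simp
        next
          assume *: "\<psi> x < T * y"
          show "x < \<sigma> y"
          proof (rule ccontr)
            assume "\<not> x < \<sigma> y"
            then have "\<psi> (\<sigma> y) \<le> \<psi> x" unfolding \<psi>_def by (intro cdf_nondecreasing) simp
            then show False using * \<sigma>(2)[OF that] by simp
          qed
        qed
        then have "{y \<in> {0..1}. x < \<sigma> y} = {y \<in> {0..1}. \<psi> x < T * y}" by blast
        also have "\<dots> = {\<psi> x / T<..1}"
          using T \<psi>x by (auto simp: field_simps intro: order_trans[of 0 "\<psi> x / T"])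
        finally show ?thesis using T \<psi>x by (simp add: diff_divide_distrib)
      next
        case False
        then have none: "{y \<in> {0..1}. x < \<sigma> y} = {}" using \<sigma>(1) by fastforce
        have "T \<le> \<psi> x" unfolding T_def \<psi>_def by (rule cdf_nondecreasing) (use False in simp)
        then show ?thesis unfolding none using T by (simp add: ennreal_neg divide_nonpos_pos)
      qed
    qed
    moreover have "\<dots> = ennreal (1/T) * ennreal (T - \<psi> x)"
    proof (cases "T - \<psi> x \<ge> 0")
      case True then show ?thesis using T by (simp flip: ennreal_mult)
    next
      case False then show ?thesis using T by (simp add: ennreal_neg divide_nonpos_pos)
    qed
    ultimately show "emeasure (distr ?I borel \<sigma>) {x<..} = emeasure (scale_measure (ennreal (1/T)) \<mu>) {x<..}"
      unfolding D emeasure_scale_measure N by simp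
  qed
  show ?thesis
  proof (rule that[of \<sigma> "T / \<delta>"])
    show "\<sigma> 0 = a" "\<sigma> 1 = b" by (fact \<sigma>0, fact \<sigma>1)
    show "T / \<delta> > 0" using T \<delta> by simp
    show "\<sigma> x < \<sigma> y \<and> \<sigma> y - \<sigma> x \<le> T / \<delta> * (y - x)" if "0 \<le> x" "x < y" "y \<le> 1" for x y
      using \<sigma>_mono[OF that] \<sigma>_lip[OF that] by blast
    show "negligible {x \<in> {0..1}. \<sigma> x \<in> Z}" if "negligible Z" for Z
    proof -
      obtain Z' where Z': "Z' \<in> null_sets lborel" "Z \<subseteq> Z'"
        using \<open>negligible Z\<close> unfolding negligible_iff_null_sets null_sets_completion_iff2 by blast
      then have Z'b: "Z' \<in> sets borel" "emeasure lborel Z' = 0" by auto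
      have "emeasure ?I (\<sigma> -` Z' \<inter> space ?I) = emeasure (distr ?I borel \<sigma>) Z'"
        by (rule emeasure_distr[symmetric, OF \<sigma>_meas Z'b(1)])
      also have "\<dots> = 0" unfolding distr_eq using sing[OF Z'b] by simp
      finally have 0: "emeasure ?I (\<sigma> -` Z' \<inter> space ?I) = 0" .
      have eq: "\<sigma> -` Z' \<inter> space ?I = {x \<in> {0..1}. \<sigma> x \<in> Z'}" by (auto simp: space_restrict_space)
      have "\<sigma> -` Z' \<inter> space ?I \<in> sets ?I" using \<sigma>_meas Z'b(1) by (rule measurable_sets)
      then have m: "{x \<in> {0..1}. \<sigma> x \<in> Z'} \<in> sets lborel" unfolding eq by (simp add: sets_restrict_space_iff)
      have "emeasure lborel {x \<in> {0..1}. \<sigma> x \<in> Z'} = 0"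
        using 0 unfolding eq by (subst (asm) emeasure_restrict_space) auto
      then have "{x \<in> {0..1}. \<sigma> x \<in> Z'} \<in> null_sets lborel" using m by auto
      then have "{x \<in> {0..1}. \<sigma> x \<in> Z'} \<in> null_sets lebesgue" by (rule null_sets_completionI)
      then have "negligible {x \<in> {0..1}. \<sigma> x \<in> Z'}" by (simp add: negligible_iff_null_sets)
      then show ?thesis by (rule negligible_subset) (use Z'(2) in auto)
    qed
    show "D * w (\<sigma> x) \<le> \<Lambda>" if x: "x \<in> {0<..<1}" and D: "(\<sigma> has_real_derivative D) (at x)" for x D
    proof -
      define t where "t = \<sigma> x"
      have t: "t \<in> {a..b}" using \<sigma>(1)[of x] x by (simp add: t_def)
      \<comment> \<open>by lower semicontinuity \<open>\<psi>\<close> has slope at least \<open>c\<close> near \<open>t\<close>, so \<open>\<sigma>\<close> has slope at most \<open>T / c\<close> near \<open>x\<close>\<close>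
      define c where "c = w t + \<delta>/2"
      have c: "c > 0" using w(2)[of t] \<delta> by (simp add: c_def)
      have "ennreal c < ennreal (w t + \<delta>)" using w(2)[of t] \<delta> by (simp add: c_def ennreal_less_iff)
      also have "\<dots> \<le> g t" by (rule g_ge(2)[OF t])
      finally obtain e where e: "e > 0" "\<And>s. s \<in> ball t e \<Longrightarrow> ennreal c \<le> g s" using lsc by blast
      have "isCont \<sigma> x" using D by (rule DERIV_isCont)
      then have "\<forall>\<^sub>F y in at x. \<sigma> y \<in> ball t e"
        using e(1) unfolding isCont_def t_def by (auto dest!: tendstoD simp: dist_commute)
      moreover have "\<forall>\<^sub>F y in at x. y \<in> {0<..<1}"
        using x by (intro eventually_at_in_open') auto
      moreover have "\<forall>\<^sub>F y in at x. y \<noteq> x" by (simp add: eventually_at_filter)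
      ultimately have "\<forall>\<^sub>F y in at x. (\<sigma> y - \<sigma> x) / (y - x) \<le> T / c"
      proof eventually_elim
        case (elim y)
        have key: "c * (\<sigma> v - \<sigma> u) \<le> T * (v - u)" if uv: "0 < u" "u < v" "v < 1" "\<sigma> u \<in> ball t e" "\<sigma> v \<in> ball t e" for u v
        proof -
          have "c * (\<sigma> v - \<sigma> u) \<le> \<psi> (\<sigma> v) - \<psi> (\<sigma> u)"
          proof (rule \<psi>_inc)
            show "\<sigma> u \<le> \<sigma> v" using \<sigma>_mono[of u v] uv by simp
            show "a \<le> \<sigma> u" "\<sigma> v \<le> b" using \<sigma>(1)[of u] \<sigma>(1)[of v] uv by auto
            show "ennreal c \<le> g s" if "s \<in> {\<sigma> u..\<sigma> v}" for s
              using that uv(4,5) by (intro e(2)) (auto simp: dist_real_def abs_less_iff)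
          qed (use c in simp)
          also have "\<dots> = T * (v - u)" using \<sigma>(2)[of u] \<sigma>(2)[of v] uv by (simp add: algebra_simps)
          finally show ?thesis .
        qed
        have xt: "\<sigma> x \<in> ball t e" using e(1) by (simp add: t_def)
        show ?case
        proof (cases "y < x")
          case True
          then have "c * (\<sigma> x - \<sigma> y) \<le> T * (x - y)" using key[of y x] elim x xt by auto
          then show ?thesis using True c by (simp add: field_simps)
        next
          case False
          then have "c * (\<sigma> y - \<sigma> x) \<le> T * (y - x)" "x < y" using key[of x y] elim x xt by auto
          then show ?thesis using c by (simp add: field_simps)
        qed
      qed
      moreover have "((\<lambda>y. (\<sigma> y - \<sigma> x) / (y - x)) \<longlongrightarrow> D) (at x)"
        using D by (simp add: has_field_derivative_iff)
      ultimately have "D \<le> T / c" by (intro tendsto_upperbound) auto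
      then have "D * c \<le> T" using c by (simp add: field_simps)
      have "D * w t \<le> \<Lambda>"
      proof (cases "D \<ge> 0")
        case True
        then have "D * w t \<le> D * c" using \<delta> by (intro mult_left_mono) (auto simp: c_def)
        then show ?thesis using \<open>D * c \<le> T\<close> \<open>T \<le> \<Lambda>\<close> by simp
      next
        case False
        then have "D * w t \<le> 0" using w(2)[of t] by (simp add: mult_nonpos_nonneg)
        then show ?thesis using \<Lambda> by simp
      qed
      then show ?thesis by (simp add: t_def)
    qed
  qed
qed

section \<open>Velocities and controls\<close>

lemma is_chartD:
  assumes "is_chart c"
  shows "open (chart_dom c)" "continuous_on (chart_dom c) (chart_map c)" "inj_on (chart_map c) (chart_dom c)"
    "\<And>x. x \<in> chart_dom c \<Longrightarrow> chart_inv c (chart_map c x) = x"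
proof -
  have h: "homeomorphism (chart_dom c) (chart_map c ` chart_dom c) (chart_map c) (chart_inv c)"
    using assms by (simp add: is_chart_def)
  show inv: "chart_inv c (chart_map c x) = x" if "x \<in> chart_dom c" for x
    using h that by (simp add: homeomorphism_def)
  then show "inj_on (chart_map c) (chart_dom c)" by (rule inj_on_inverseI)
qed (use assms in \<open>auto simp: is_chart_def homeomorphism_def\<close>)

lemma AE_lebesgue_on_iff_negligible:
  assumes "S \<in> sets lebesgue"
  shows "(AE t in lebesgue_on S. P t) \<longleftrightarrow> negligible {t \<in> S. \<not> P t}"
proof -
  have "(AE t in lebesgue_on S. P t) \<longleftrightarrow> (AE t in lebesgue. t \<in> S \<longrightarrow> P t)"
    using assms by (subst AE_restrict_space_iff) auto
  also have "\<dots> \<longleftrightarrow> {t. \<not> (t \<in> S \<longrightarrow> P t)} \<in> null_sets lebesgue"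
    by (subst completion.AE_iff_null_sets) auto
  finally show ?thesis by (simp add: negligible_iff_null_sets)
qed

lemma has_vector_derivative_imp_seq:
  fixes x :: "real \<Rightarrow> 'b::real_normed_vector"
  assumes "(x has_vector_derivative v) (at t)"
  shows "(\<lambda>j. real (Suc j) *\<^sub>R (x (t + 1 / real (Suc j)) - x t)) \<longlonglongrightarrow> v"
proof -
  have lim: "((\<lambda>h. norm (x (t + h) - x t - h *\<^sub>R v) / norm h) \<longlongrightarrow> 0) (at 0)"
    using assms unfolding has_vector_derivative_def has_derivative_at by auto
  have h: "filterlim (\<lambda>j. 1 / real (Suc j)) (at 0) sequentially"
    unfolding filterlim_at using LIMSEQ_Suc[OF lim_1_over_n] by simp
  have "(\<lambda>j. norm (real (Suc j) *\<^sub>R (x (t + 1 / real (Suc j)) - x t) - v)) \<longlonglongrightarrow> 0"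
  proof (rule Lim_transform_eventually[OF filterlim_compose[OF lim h]])
    show "\<forall>\<^sub>F j in sequentially. norm (x (t + 1 / real (Suc j)) - x t - (1 / real (Suc j)) *\<^sub>R v) / norm (1 / real (Suc j))
      = norm (real (Suc j) *\<^sub>R (x (t + 1 / real (Suc j)) - x t) - v)"
    proof (intro always_eventually allI)
      fix j
      have "real (Suc j) *\<^sub>R (x (t + 1 / real (Suc j)) - x t) - v
          = real (Suc j) *\<^sub>R (x (t + 1 / real (Suc j)) - x t - (1 / real (Suc j)) *\<^sub>R v)"
        by (simp add: scaleR_diff_right)
      then show "norm (x (t + 1 / real (Suc j)) - x t - (1 / real (Suc j)) *\<^sub>R v) / norm (1 / real (Suc j))
        = norm (real (Suc j) *\<^sub>R (x (t + 1 / real (Suc j)) - x t) - v)"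
        by (simp only: norm_scaleR) (simp add: mult.commute)
    qed
  qed
  then show ?thesis by (simp add: tendsto_norm_zero_iff LIM_zero_iff)
qed

lemma at_within_Icc_neq_bot:
  fixes a b t :: real
  assumes "a < b" "t \<in> {a..b}" shows "at t within {a..b} \<noteq> bot"
  using assms by (simp add: trivial_limit_within)

text \<open>
  The hypotheses of the theorem. The name refers to the range of \<open>f p\<close>, a subspace of the tangent
  space at \<open>p\<close> on which \<open>speed f N p\<close> is a norm.
\<close>

locale polarized_manifold =
  fixes A :: "('m::{t2_space, second_countable_topology}, 'b::banach) chart set"
    and f :: "'m \<Rightarrow> 'e::banach \<Rightarrow> ('m, 'b) tvec"
    and N :: "'m \<Rightarrow> 'e \<Rightarrow> real"
  assumes finite_dim_b: "\<exists>B :: 'b set. finite B \<and> span B = UNIV"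
    and atlas: "smooth_atlas A"
    and finite_dim_e: "\<exists>B :: 'e set. finite B \<and> span B = UNIV"
    and lip: "lipschitz_vf_structure A f"
    and norm: "continuously_varying_norm N"
begin

lemma chart: "c \<in> A \<Longrightarrow> is_chart c"
  and chart_ex: "\<exists>c\<in>A. p \<in> chart_dom c"
  using atlas unfolding smooth_atlas_def by auto

lemma transition_derivative:
  assumes "c \<in> A" "d \<in> A" "p \<in> chart_dom c" "p \<in> chart_dom d"
  shows "(transition c d has_derivative frechet_derivative (transition c d) (at (chart_map c p))) (at (chart_map c p))"
proof -
  have "Ck_on (Suc 0) (chart_map c ` (chart_dom c \<inter> chart_dom d)) (transition c d)"
    using atlas assms unfolding smooth_atlas_def smooth_on_def by blast
  then have "transition c d differentiable at (chart_map c p)" using assms by auto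
  then show ?thesis by (simp add: frechet_derivative_works)
qed

lemma chart_change_vector_derivative:
  assumes cd: "c \<in> A" "d \<in> A" "\<gamma> t \<in> chart_dom c" "\<gamma> t \<in> chart_dom d"
    and cont: "continuous (at t within S) \<gamma>" and tS: "t \<in> S"
    and v: "((chart_map c \<circ> \<gamma>) has_vector_derivative v) (at t within S)"
  shows "((chart_map d \<circ> \<gamma>) has_vector_derivative
    frechet_derivative (transition c d) (at (chart_map c (\<gamma> t))) v) (at t within S)"
proof -
  let ?F = "frechet_derivative (transition c d) (at (chart_map c (\<gamma> t)))"
  have F: "(transition c d has_derivative ?F) (at (chart_map c (\<gamma> t)))"
    by (rule transition_derivative[OF cd])
  then interpret F: bounded_linear ?F by (rule has_derivative_bounded_linear)
  have "((transition c d \<circ> (chart_map c \<circ> \<gamma>)) has_derivative ?F \<circ> (\<lambda>h. h *\<^sub>R v)) (at t within S)"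
    by (rule diff_chain_within)
      (use v F in \<open>auto simp: has_vector_derivative_def intro: has_derivative_at_withinI\<close>)
  then have *: "((transition c d \<circ> (chart_map c \<circ> \<gamma>)) has_vector_derivative ?F v) (at t within S)"
    by (simp add: has_vector_derivative_def o_def F.scaleR)
  have "\<forall>\<^sub>F s in at t within S. \<gamma> s \<in> chart_dom c"
    by (rule topological_tendstoD[OF cont[unfolded continuous_within] is_chartD(1)[OF chart[OF cd(1)]] cd(3)])
  then obtain e where e: "e > 0" "\<And>s. s \<in> S \<Longrightarrow> s \<noteq> t \<Longrightarrow> dist s t < e \<Longrightarrow> \<gamma> s \<in> chart_dom c"
    unfolding eventually_at by blast
  show ?thesis
  proof (rule has_vector_derivative_transform_within[OF * e(1) tS])
    fix s assume "s \<in> S" "dist s t < e"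
    then have "\<gamma> s \<in> chart_dom c" using e(2) cd(3) by (cases "s = t") auto
    then show "(transition c d \<circ> (chart_map c \<circ> \<gamma>)) s = (chart_map d \<circ> \<gamma>) s"
      using is_chartD(4)[OF chart[OF cd(1)]] by (simp add: transition_def)
  qed
qed

text \<open>
  Differentiability in one chart suffices: the transition maps are differentiable, so all charts see
  a derivative, and uniqueness of derivatives makes these transform as a tangent vector must.
\<close>

lemma has_velocity_velocity:
  assumes c: "c \<in> A" "\<gamma> t \<in> chart_dom c"
    and cont: "continuous (at t within S) \<gamma>" and tS: "t \<in> S" "at t within S \<noteq> bot"
    and v: "((chart_map c \<circ> \<gamma>) has_vector_derivative v) (at t within S)"
  shows "has_velocity A \<gamma> (velocity A \<gamma> S t) t S"
proof -
  have *: "((chart_map d \<circ> \<gamma>) has_vector_derivative velocity A \<gamma> S t d) (at t within S)"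
    if "d \<in> A" "\<gamma> t \<in> chart_dom d" for d
  proof -
    have "(chart_map d \<circ> \<gamma>) differentiable (at t within S)"
      using chart_change_vector_derivative[OF c(1) that(1) c(2) that(2) cont tS(1) v] has_vector_derivative_def
      by (auto simp: differentiable_def)
    then show ?thesis
      using that vector_derivative_works by (auto simp: velocity_def)
  qed
  moreover have "velocity A \<gamma> S t \<in> tangent_space A (\<gamma> t)"
    unfolding tangent_space_def
  proof (intro CollectI conjI allI impI ballI)
    fix c' d assume "c' \<in> A" "d \<in> A" "\<gamma> t \<in> chart_dom c' \<inter> chart_dom d"
    then show "velocity A \<gamma> S t d = frechet_derivative (transition c' d) (at (chart_map c' (\<gamma> t))) (velocity A \<gamma> S t c')"
      using chart_change_vector_derivative[of c' d, OF _ _ _ _ cont tS(1) *] *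
      by (intro vector_derivative_unique_within[OF tS(2)]) auto
  qed (auto simp: velocity_def)
  ultimately show ?thesis unfolding has_velocity_def by blast
qed

lemma has_velocity_unique:
  assumes "has_velocity A \<gamma> v t S" "at t within S \<noteq> bot"
  shows "v = velocity A \<gamma> S t"
proof
  fix c
  show "v c = velocity A \<gamma> S t c"
  proof (cases "c \<in> A \<and> \<gamma> t \<in> chart_dom c")
    case True
    then have "((chart_map c \<circ> \<gamma>) has_vector_derivative v c) (at t within S)"
      using assms(1) by (simp add: has_velocity_def)
    then show ?thesis using True assms(2) by (simp add: velocity_def vector_derivative_within)
  next
    case False
    have "v \<in> tangent_space A (\<gamma> t)" using assms(1) by (simp add: has_velocity_def)
    then have "v c = 0" using False unfolding tangent_space_def by blast
    then show ?thesis using False by (auto simp: velocity_def)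
  qed
qed

lemma tangent_space_eqI:
  assumes "v \<in> tangent_space A p" "w \<in> tangent_space A p" "c \<in> A" "p \<in> chart_dom c" "v c = w c"
  shows "v = w"
proof
  fix d
  show "v d = w d"
  proof (cases "d \<in> A \<and> p \<in> chart_dom d")
    case True
    then have "v d = frechet_derivative (transition c d) (at (chart_map c p)) (v c)"
      "w d = frechet_derivative (transition c d) (at (chart_map c p)) (w c)"
      using assms(1-4) unfolding tangent_space_def by blast+
    then show ?thesis using assms(5) by simp
  next
    case False
    then have "v d = 0" "w d = 0" using assms(1,2) unfolding tangent_space_def by blast+
    then show ?thesis by simp
  qed
qed

lemma f_tangent: "f p u \<in> tangent_space A p"
  using lip unfolding lipschitz_vf_structure_def by blast

lemma f_bounded_linear: "bounded_linear (\<lambda>u. f p u c)"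
proof -
  have "linear (\<lambda>u. f p u c)" using lip unfolding lipschitz_vf_structure_def by blast
  then show ?thesis by (rule finite_dim_bounded_linear[OF finite_dim_e])
qed

lemma f_scaleR: "f p (r *\<^sub>R u) = (\<lambda>c. r *\<^sub>R f p u c)"
  using linear_scale[OF bounded_linear.linear[OF f_bounded_linear]] by (intro ext) blast

text \<open>
  The Lipschitz condition evaluated at a control and pulled back from coordinates to the manifold.
\<close>

lemma f_local_lipschitz:
  assumes c: "c \<in> A" and p: "p \<in> chart_dom c"
  obtains r L where "r > 0" "L \<ge> 0"
    "\<And>q q' u. q \<in> chart_dom c \<Longrightarrow> q' \<in> chart_dom c \<Longrightarrow> chart_map c q \<in> cball (chart_map c p) r \<Longrightarrow>
      chart_map c q' \<in> cball (chart_map c p) r \<Longrightarrow>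
      norm (f q u c - f q' u c) \<le> L * norm (chart_map c q - chart_map c q') * norm u"
proof -
  let ?F = "\<lambda>y. Blinfun (\<lambda>u. f (chart_inv c y) u c)"
  have "\<forall>x\<in>chart_map c ` chart_dom c. \<exists>r>0. \<exists>L.
        L-lipschitz_on (cball x r \<inter> chart_map c ` chart_dom c) ?F"
    using lip c unfolding lipschitz_vf_structure_def by simp
  then obtain r L where rL: "r > 0" "L-lipschitz_on (cball (chart_map c p) r \<inter> chart_map c ` chart_dom c) ?F"
    using p by blast
  have F: "blinfun_apply (?F (chart_map c q)) u = f q u c" if "q \<in> chart_dom c" for q u
    using is_chartD(4)[OF chart[OF c] that] by (simp add: bounded_linear_Blinfun_apply f_bounded_linear)
  show ?thesis
  proof (rule that[OF rL(1) lipschitz_on_nonneg[OF rL(2)]])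
    fix q q' u assume q: "q \<in> chart_dom c" "q' \<in> chart_dom c" "chart_map c q \<in> cball (chart_map c p) r"
      "chart_map c q' \<in> cball (chart_map c p) r"
    have "norm (f q u c - f q' u c) = norm (blinfun_apply (?F (chart_map c q) - ?F (chart_map c q')) u)"
      by (simp add: blinfun.diff_left F[OF q(1)] F[OF q(2)])
    also have "\<dots> \<le> norm (?F (chart_map c q) - ?F (chart_map c q')) * norm u" by (rule norm_blinfun)
    also have "\<dots> \<le> (L * norm (chart_map c q - chart_map c q')) * norm u"
      using lipschitz_onD[OF rL(2), of "chart_map c q" "chart_map c q'"] q
      by (intro mult_right_mono) (auto simp: dist_norm)
    finally show "norm (f q u c - f q' u c) \<le> L * norm (chart_map c q - chart_map c q') * norm u" .
  qed
qed

lemma f_continuous: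
  assumes c: "c \<in> A"
  shows "continuous_on (chart_dom c) (\<lambda>q. f q u c)"
  unfolding continuous_on_def
proof
  fix p assume p: "p \<in> chart_dom c"
  obtain r L where r: "r > 0" "L \<ge> 0"
    and L: "\<And>q q' u. q \<in> chart_dom c \<Longrightarrow> q' \<in> chart_dom c \<Longrightarrow> chart_map c q \<in> cball (chart_map c p) r \<Longrightarrow>
      chart_map c q' \<in> cball (chart_map c p) r \<Longrightarrow>
      norm (f q u c - f q' u c) \<le> L * norm (chart_map c q - chart_map c q') * norm u"
    using f_local_lipschitz[OF c p] by metis
  have x: "(chart_map c \<longlongrightarrow> chart_map c p) (at p within chart_dom c)"
    using is_chartD(2)[OF chart[OF c]] p by (simp add: continuous_on_def)
  have "((\<lambda>q. L * norm (chart_map c q - chart_map c p) * norm u) \<longlongrightarrow> L * norm (chart_map c p - chart_map c p) * norm u)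
      (at p within chart_dom c)"
    by (intro tendsto_intros x)
  then have lim: "((\<lambda>q. L * norm (chart_map c q - chart_map c p) * norm u) \<longlongrightarrow> 0) (at p within chart_dom c)" by simp
  have "\<forall>\<^sub>F q in at p within chart_dom c. dist (chart_map c q) (chart_map c p) < r"
    using tendstoD[OF x r(1)] .
  moreover have "\<forall>\<^sub>F q in at p within chart_dom c. q \<in> chart_dom c" by (simp add: eventually_at_filter)
  ultimately have "\<forall>\<^sub>F q in at p within chart_dom c. norm (f q u c - f p u c) \<le> L * norm (chart_map c q - chart_map c p) * norm u"
    by eventually_elim (use p r(1) in \<open>auto intro!: L simp: dist_commute\<close>)
  then have "((\<lambda>q. f q u c - f p u c) \<longlongrightarrow> 0) (at p within chart_dom c)"
    using lim by (rule Lim_null_comparison)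
  then show "((\<lambda>q. f q u c) \<longlongrightarrow> f p u c) (at p within chart_dom c)"
    by (simp add: LIM_zero_iff)
qed

lemma N_norm: "is_norm (N p)" and N_continuous: "continuous_on UNIV (\<lambda>(p, u). N p u)"
  using norm unfolding continuously_varying_norm_def by auto

lemma N_nonneg: "0 \<le> N p u" and N_scaleR: "N p (r *\<^sub>R u) = \<bar>r\<bar> * N p u" and N_zero_iff: "N p u = 0 \<longleftrightarrow> u = 0"
  using N_norm[of p] unfolding is_norm_def by auto

lemma N_continuous_on:
  assumes "continuous_on S \<gamma>" "continuous_on S u"
  shows "continuous_on S (\<lambda>t. N (\<gamma> t) (u t))"
  using continuous_on_compose2[OF N_continuous, of S "\<lambda>t. (\<gamma> t, u t)"] assms
  by (auto intro: continuous_on_Pair)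

lemma N_lower_bound:
  assumes K: "compact K"
  obtains k where "k > 0" "\<And>p u. p \<in> K \<Longrightarrow> k * norm u \<le> N p u"
proof -
  have "compact (cball (0::'e) 1)" by (rule finite_dim_compact_cball[OF finite_dim_e])
  moreover have "closed (sphere (0::'e) 1)"
    unfolding sphere_def by (intro closed_Collect_eq continuous_intros)
  ultimately have "compact (cball (0::'e) 1 \<inter> sphere 0 1)" by (rule compact_Int_closed)
  then have "compact (sphere (0::'e) 1)" by (simp add: Int_absorb1 sphere_cball)
  then have cpt: "compact (K \<times> sphere (0::'e) 1)" using K by (rule compact_Times[rotated])
  obtain k where k: "k > 0" "\<And>p u. p \<in> K \<Longrightarrow> norm u = 1 \<Longrightarrow> k \<le> N p u"
  proof (cases "K \<times> sphere (0::'e) 1 = {}")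
    case True
    then show ?thesis by (intro that[of 1]) auto
  next
    case False
    obtain z where z: "z \<in> K \<times> sphere (0::'e) 1" "\<And>y. y \<in> K \<times> sphere (0::'e) 1 \<Longrightarrow>
        (\<lambda>(p, u). N p u) z \<le> (\<lambda>(p, u). N p u) y"
      using continuous_attains_inf[OF cpt False continuous_on_subset[OF N_continuous subset_UNIV]] by blast
    obtain p u where pu: "z = (p, u)" by (cases z)
    have "u \<noteq> 0" using z(1) pu by auto
    then have "N p u > 0" using N_nonneg[of p u] N_zero_iff[of p u] by linarith
    then show ?thesis using z(2) pu by (intro that[of "N p u"]) auto
  qed
  have "k * norm u \<le> N p u" if p: "p \<in> K" for p u
  proof (cases "u = 0")
    case False
    then have "k \<le> N p ((1 / norm u) *\<^sub>R u)" using p by (intro k(2)) auto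
    also have "\<dots> = N p u / norm u" by (simp add: N_scaleR)
    finally show ?thesis using False by (simp add: field_simps)
  qed (simp add: N_nonneg)
  then show ?thesis using that k(1) by blast
qed

text \<open>
  Intervals with rational end points are countable, hence so is the family of charts chosen for them.
  This reduces statements almost everywhere to a single chart, although the atlas may be uncountable.
\<close>

lemma chart_cover:
  fixes \<gamma> :: "real \<Rightarrow> 'm"
  assumes cont: "continuous_on {a..b} \<gamma>" and ab: "a < b"
  obtains c :: "nat \<Rightarrow> ('m, 'b) chart" and r s :: "nat \<Rightarrow> real"
  where "\<And>n. c n \<in> A" "\<And>n. a \<le> r n" "\<And>n. r n < s n" "\<And>n. s n \<le> b" "\<And>n. \<gamma> ` {r n..s n} \<subseteq> chart_dom (c n)"
    "\<And>t. t \<in> {a<..<b} \<Longrightarrow> \<exists>n. r n < t \<and> t < s n"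
proof -
  define I where "I = {(r, s). r \<in> \<rat> \<and> s \<in> \<rat> \<and> a \<le> r \<and> r < s \<and> s \<le> b \<and> (\<exists>c\<in>A. \<gamma> ` {r..s} \<subseteq> chart_dom c)}"
  have "I \<subseteq> \<rat> \<times> \<rat>" by (auto simp: I_def)
  then have cI: "countable I" by (rule countable_subset) (simp add: countable_rat)
  have cov: "\<exists>(r, s)\<in>I. r < t \<and> t < s" if t: "t \<in> {a<..<b}" for t
  proof -
    obtain c where c: "c \<in> A" "\<gamma> t \<in> chart_dom c" using chart_ex by blast
    have "isCont \<gamma> t" using continuous_on_interior[OF cont] t by simp
    then have "\<forall>\<^sub>F x in at t. \<gamma> x \<in> chart_dom c"
      unfolding isCont_def by (rule topological_tendstoD[OF _ is_chartD(1)[OF chart[OF c(1)]] c(2)])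
    then obtain e where e: "e > 0" "\<And>x. x \<noteq> t \<Longrightarrow> dist x t < e \<Longrightarrow> \<gamma> x \<in> chart_dom c"
      unfolding eventually_at by auto
    obtain r where r: "r \<in> \<rat>" "max a (t - e) < r" "r < t" using Rats_dense_in_real[of "max a (t - e)" t] t e by auto
    obtain s where s: "s \<in> \<rat>" "t < s" "s < min b (t + e)" using Rats_dense_in_real[of t "min b (t + e)"] t e by auto
    have "\<gamma> x \<in> chart_dom c" if "x \<in> {r..s}" for x
      using e(2)[of x] c(2) that r s by (cases "x = t") (auto simp: dist_real_def abs_less_iff)
    then have "\<gamma> ` {r..s} \<subseteq> chart_dom c" by auto
    then have "\<exists>c\<in>A. \<gamma> ` {r..s} \<subseteq> chart_dom c" using c(1) by blast
    then have "(r, s) \<in> I" using r s by (simp add: I_def)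
    then show ?thesis using r s by auto
  qed
  from cov[of "(a + b)/2"] ab have ne: "I \<noteq> {}" by auto
  define p where "p = from_nat_into I"
  have p: "p n \<in> I" for n unfolding p_def by (rule from_nat_into[OF ne])
  have "\<exists>c\<in>A. \<gamma> ` {fst (p n)..snd (p n)} \<subseteq> chart_dom c" for n
    using p[of n]
    by (simp add: I_def split_beta)
  then obtain c where c: "\<And>n. c n \<in> A" "\<And>n. \<gamma> ` {fst (p n)..snd (p n)} \<subseteq> chart_dom (c n)" by metis
  show ?thesis
  proof (rule that[of c "\<lambda>n. fst (p n)" "\<lambda>n. snd (p n)"])
    show "a \<le> fst (p n)" "fst (p n) < snd (p n)" "snd (p n) \<le> b" for n
      using p[of n] by (auto simp: I_def)
    show "\<exists>n. fst (p n) < t \<and> t < snd (p n)" if t: "t \<in> {a<..<b}" for t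
    proof -
      obtain r s where "(r, s) \<in> I" "r < t" "t < s" using cov[OF t] by blast
      moreover then obtain n where "p n = (r, s)" using from_nat_into_surj[OF cI] unfolding p_def by metis
      ultimately show ?thesis by (intro exI[of _ n]) simp
    qed
  qed (use c in auto)
qed

lemma abs_cont_curve_chart:
  assumes "abs_cont_curve A a b \<gamma>" "c \<in> A" "a \<le> s" "s \<le> t" "t \<le> b" "\<gamma> ` {s..t} \<subseteq> chart_dom c"
  shows "abs_cont s t (chart_map c \<circ> \<gamma>)"
  using assms unfolding abs_cont_curve_def by blast

lemma ae_has_velocity:
  assumes ac: "abs_cont_curve A a b \<gamma>" and ab: "a < b"
  shows "negligible {t \<in> {a..b}. \<not> has_velocity A \<gamma> (velocity A \<gamma> {a..b} t) t {a..b}}"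
proof -
  have cont: "continuous_on {a..b} \<gamma>" using ac by (simp add: abs_cont_curve_def)
  obtain c :: "nat \<Rightarrow> ('m, 'b) chart" and r s :: "nat \<Rightarrow> real" where cov: "\<And>n. c n \<in> A" "\<And>n. a \<le> r n" "\<And>n. r n < s n" "\<And>n. s n \<le> b"
    "\<And>n. \<gamma> ` {r n..s n} \<subseteq> chart_dom (c n)" "\<And>t. t \<in> {a<..<b} \<Longrightarrow> \<exists>n. r n < t \<and> t < s n"
    using chart_cover[OF cont ab] by blast
  define Z where "Z n = {t \<in> {r n..s n}. \<not> (\<exists>D. ((chart_map (c n) \<circ> \<gamma>) has_vector_derivative D) (at t))}" for n
  have "negligible (Z n)" for n
    unfolding Z_def
    by (intro abs_cont_ae_differentiable[OF finite_dim_b] abs_cont_curve_chart[OF ac] cov less_imp_le)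
  then have "negligible (\<Union>n. Z n)" by (intro negligible_countable_Union) auto
  then have neg: "negligible ((\<Union>n. Z n) \<union> {a, b})" by (intro negligible_Un) auto
  show ?thesis
  proof (rule negligible_subset[OF neg], rule subsetI, rule ccontr)
    fix t assume t: "t \<in> {t \<in> {a..b}. \<not> has_velocity A \<gamma> (velocity A \<gamma> {a..b} t) t {a..b}}"
      "t \<notin> (\<Union>n. Z n) \<union> {a, b}"
    then have t': "t \<in> {a<..<b}" by auto
    obtain n where n: "r n < t" "t < s n" using cov(6)[OF t'] by blast
    have "t \<notin> Z n" using t(2) by blast
    then obtain D where "((chart_map (c n) \<circ> \<gamma>) has_vector_derivative D) (at t)"
      using n unfolding Z_def by force
    then have "((chart_map (c n) \<circ> \<gamma>) has_vector_derivative D) (at t within {a..b})"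
      by (rule has_vector_derivative_at_within)
    moreover have "\<gamma> t \<in> chart_dom (c n)" using cov(5)[of n] n by auto
    moreover have "continuous (at t within {a..b}) \<gamma>"
      using cont t' by (simp add: continuous_on_eq_continuous_within)
    ultimately have "has_velocity A \<gamma> (velocity A \<gamma> {a..b} t) t {a..b}"
      using t' at_within_Icc_neq_bot[OF ab] by (intro has_velocity_velocity[OF cov(1)[of n]]) auto
    then show False using t(1) by simp
  qed
qed

text \<open>
  The equation \<open>f(\<gamma>, u) = \<gamma>'\<close> for the control, written as the zero set of a Caratheodory function. It is
  enough to compare both sides in one chart; the chart is chosen measurably in \<open>t\<close>, and \<open>\<gamma>'\<close> is
  measurable as a limit of difference quotients. The exceptional null set is removed in the form of
  the Borel set \<open>G\<close>, so that Borel measurability is available.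
\<close>

lemma velocity_caratheodory:
  assumes ac: "abs_cont_curve A a b \<gamma>" and ab: "a < b"
  obtains G :: "real set" and Q :: "real \<Rightarrow> 'e \<Rightarrow> real"
  where "G \<in> sets borel" "G \<subseteq> {a<..<b}" "negligible ({a..b} - G)"
    "\<And>u. (\<lambda>t. Q t u) \<in> borel_measurable (restrict_space borel G)"
    "\<And>t. t \<in> G \<Longrightarrow> continuous_on UNIV (Q t)" "\<And>t u. 0 \<le> Q t u"
    "\<And>t. t \<in> G \<Longrightarrow> has_velocity A \<gamma> (velocity A \<gamma> {a..b} t) t {a..b}"
    "\<And>t u. t \<in> G \<Longrightarrow> Q t u = 0 \<longleftrightarrow> f (\<gamma> t) u = velocity A \<gamma> {a..b} t"
proof -
  let ?V = "velocity A \<gamma> {a..b}"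
  have cont: "continuous_on {a..b} \<gamma>" using ac by (simp add: abs_cont_curve_def)
  obtain c :: "nat \<Rightarrow> ('m, 'b) chart" and r s :: "nat \<Rightarrow> real" where cov: "\<And>n. c n \<in> A" "\<And>n. a \<le> r n" "\<And>n. r n < s n" "\<And>n. s n \<le> b"
    "\<And>n. \<gamma> ` {r n..s n} \<subseteq> chart_dom (c n)" "\<And>t. t \<in> {a<..<b} \<Longrightarrow> \<exists>n. r n < t \<and> t < s n"
    using chart_cover[OF cont ab] by blast
  have "negligible ({t \<in> {a..b}. \<not> has_velocity A \<gamma> (?V t) t {a..b}} \<union> {a, b})"
    by (intro negligible_Un ae_has_velocity[OF ac ab]) auto
  then obtain Z where Z: "Z \<in> null_sets lborel" "{t \<in> {a..b}. \<not> has_velocity A \<gamma> (?V t) t {a..b}} \<union> {a, b} \<subseteq> Z"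
    unfolding negligible_iff_null_sets null_sets_completion_iff2 by blast
  define G where "G = {a..b} - Z"
  have G: "G \<in> sets borel" "G \<subseteq> {a<..<b}" using Z by (auto simp: G_def less_le)
  have vel: "has_velocity A \<gamma> (?V t) t {a..b}" if "t \<in> G" for t using that Z(2) by (auto simp: G_def)
  have "negligible Z" using Z(1) by (simp add: negligible_iff_null_sets null_sets_completionI)
  then have negG: "negligible ({a..b} - G)" by (rule negligible_subset) (auto simp: G_def)
  \<comment> \<open>a measurable choice of a chart around \<open>\<gamma> t\<close>\<close>
  define k where "k t = (LEAST n. r n < t \<and> t < s n)" for t
  have k: "r (k t) < t \<and> t < s (k t)" if "t \<in> {a<..<b}" for t
    unfolding k_def by (rule LeastI_ex[OF cov(6)[OF that]])
  have k_meas: "k \<in> measurable (restrict_space borel G) (count_space UNIV)"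
    unfolding k_def by (rule measurable_Least) (intro measurable_restrict_space1, simp)
  define Qn where "Qn n t u = (if t \<in> {r n<..<s n} then norm (f (\<gamma> t) u (c n) - ?V t (c n)) else 0)" for n t u
  define Q where "Q t u = Qn (k t) t u" for t u
  have Q_eq: "Q t u = norm (f (\<gamma> t) u (c (k t)) - ?V t (c (k t)))" if "t \<in> G" for t u
    using k[of t] that G(2) by (auto simp: Q_def Qn_def)
  have "(\<lambda>t. Qn n t u) \<in> borel_measurable (restrict_space borel G)" for n u
  proof (rule borel_measurable_LIMSEQ_metric)
    let ?x = "chart_map (c n) \<circ> \<gamma>"
    \<comment> \<open>difference quotients; the minimum keeps their arguments inside the chart\<close>
    let ?g = "\<lambda>j t. if t \<in> {r n<..<s n} then norm (f (\<gamma> t) u (c n)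
      - real (Suc j) *\<^sub>R (?x (min (t + 1 / real (Suc j)) (s n)) - ?x t)) else 0"
    have sub: "continuous_on {r n..s n} \<gamma>"
      by (rule continuous_on_subset[OF cont]) (use cov(2,4)[of n] in auto)
    have x: "continuous_on {r n..s n} ?x"
      by (rule continuous_on_compose[OF sub])
        (rule continuous_on_subset[OF is_chartD(2)[OF chart[OF cov(1)]] cov(5)])
    have fx: "continuous_on {r n..s n} (\<lambda>t. f (\<gamma> t) u (c n))"
      by (rule continuous_on_compose2[OF f_continuous[OF cov(1)] sub cov(5)])
    show "?g j \<in> borel_measurable (restrict_space borel G)" for j
    proof (rule measurable_restrict_space1)
      have "continuous_on {r n<..<s n} (\<lambda>t. ?x (min (t + 1 / real (Suc j)) (s n)))"
      proof (rule continuous_on_compose2[OF x])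
        show "continuous_on {r n<..<s n} (\<lambda>t. min (t + 1 / real (Suc j)) (s n))" by (intro continuous_intros)
        show "(\<lambda>t. min (t + 1 / real (Suc j)) (s n)) ` {r n<..<s n} \<subseteq> {r n..s n}"
        proof (rule image_subsetI)
          fix t assume t: "t \<in> {r n<..<s n}"
          have "0 < 1 / real (Suc j)" by simp
          then show "min (t + 1 / real (Suc j)) (s n) \<in> {r n..s n}" using t by (auto simp only: min_def greaterThanLessThan_iff atLeastAtMost_iff split: if_splits)
        qed
      qed
      note xm = this
      have sub': "{r n<..<s n} \<subseteq> {r n..s n}" by auto
      have "continuous_on {r n<..<s n} (\<lambda>t. norm (f (\<gamma> t) u (c n)
          - real (Suc j) *\<^sub>R (?x (min (t + 1 / real (Suc j)) (s n)) - ?x t)))"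
        by (rule continuous_on_norm[OF continuous_on_diff[OF continuous_on_subset[OF fx sub']
          continuous_on_scaleR[OF continuous_on_const continuous_on_diff[OF xm continuous_on_subset[OF x sub']]]]])
      then show "?g j \<in> borel_measurable borel"
        by (intro borel_measurable_continuous_on_if) auto
    qed
    fix t assume "t \<in> space (restrict_space borel G)"
    then have t: "t \<in> G" by (simp add: space_restrict_space)
    show "(\<lambda>j. ?g j t) \<longlonglongrightarrow> Qn n t u"
    proof (cases "t \<in> {r n<..<s n}")
      case True
      have "\<gamma> t \<in> chart_dom (c n)" using cov(5)[of n] True by auto
      then have "(?x has_vector_derivative ?V t (c n)) (at t within {a..b})"
        using vel[OF t] cov(1) unfolding has_velocity_def by blast
      then have "(?x has_vector_derivative ?V t (c n)) (at t)"
        using at_within_interior[of t "{a..b}"] t G(2) by auto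
      from has_vector_derivative_imp_seq[OF this]
      have lim: "(\<lambda>j. norm (f (\<gamma> t) u (c n) - real (Suc j) *\<^sub>R (?x (t + 1 / real (Suc j)) - ?x t)))
          \<longlonglongrightarrow> norm (f (\<gamma> t) u (c n) - ?V t (c n))"
        by (intro tendsto_intros)
      have "\<forall>\<^sub>F j in sequentially. 1 / real (Suc j) < s n - t"
        using order_tendstoD(2)[OF LIMSEQ_Suc[OF lim_1_over_n], of "s n - t"] True by simp
      then have "\<forall>\<^sub>F j in sequentially. norm (f (\<gamma> t) u (c n) - real (Suc j) *\<^sub>R (?x (t + 1 / real (Suc j)) - ?x t)) = ?g j t"
        by eventually_elim (use True in \<open>simp add: min_def\<close>)
      from Lim_transform_eventually[OF lim this] show ?thesis using True by (simp add: Qn_def)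
    next
      case False
      then show ?thesis by (auto simp: Qn_def)
    qed
  qed
  then have "(\<lambda>t. Q t u) \<in> borel_measurable (restrict_space borel G)" for u
    unfolding Q_def using k_meas
    by (intro measurable_compose_countable[of "\<lambda>n t. Qn n t u" "restrict_space borel G" borel k]) auto
  moreover have "continuous_on UNIV (Q t)" if "t \<in> G" for t
  proof -
    have "continuous_on UNIV (\<lambda>u. norm (f (\<gamma> t) u (c (k t)) - ?V t (c (k t))))"
      by (intro continuous_intros linear_continuous_on f_bounded_linear)
    then show ?thesis by (simp add: Q_eq[OF that, abs_def])
  qed
  moreover have "0 \<le> Q t u" for t u by (simp add: Q_def Qn_def)
  moreover have "Q t u = 0 \<longleftrightarrow> f (\<gamma> t) u = ?V t" if t: "t \<in> G" for t u
  proof -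
    have "t \<in> {a<..<b}" using t G(2) by auto
    then have "\<gamma> t \<in> chart_dom (c (k t))" using cov(5)[of "k t"] k[of t] by auto
    moreover have "?V t \<in> tangent_space A (\<gamma> t)" using vel[OF t] by (simp add: has_velocity_def)
    ultimately have "f (\<gamma> t) u (c (k t)) = ?V t (c (k t)) \<longleftrightarrow> f (\<gamma> t) u = ?V t"
      using tangent_space_eqI[OF f_tangent _ cov(1)] by metis
    then show ?thesis by (simp add: Q_eq[OF t])
  qed
  ultimately show ?thesis using that[OF G negG] vel by blast
qed

text \<open>
  Adding the positive part of \<open>N(\<gamma>, u) - \<rho>\<close> to \<open>Q\<close> imposes the bound on the norm as well.
\<close>

lemma controls_measurable:
  fixes Q :: "real \<Rightarrow> 'e \<Rightarrow> real"
  assumes cont: "continuous_on {a..b} \<gamma>" and G: "G \<subseteq> {a..b}"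
    and Q: "\<And>u. (\<lambda>t. Q t u) \<in> borel_measurable (restrict_space borel G)"
      "\<And>t. t \<in> G \<Longrightarrow> continuous_on UNIV (Q t)" "\<And>t u. 0 \<le> Q t u"
  shows "{t \<in> G. \<exists>u. Q t u = 0 \<and> N (\<gamma> t) u \<le> \<rho>} \<in> sets (restrict_space borel G)"
    and "\<exists>u. u \<in> borel_measurable (restrict_space borel G) \<and>
      (\<forall>t\<in>G. (\<exists>u. Q t u = 0 \<and> N (\<gamma> t) u \<le> \<rho>) \<longrightarrow> Q t (u t) = 0 \<and> N (\<gamma> t) (u t) \<le> \<rho>)"
proof -
  let ?M = "restrict_space borel G"
  have sp: "space ?M = G" by (simp add: space_restrict_space)
  obtain d :: "nat \<Rightarrow> 'e" where d: "\<And>v \<epsilon>. \<epsilon> > 0 \<Longrightarrow> \<exists>k. dist v (d k) < \<epsilon>"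
    using finite_dim_countable_dense[OF finite_dim_e] by blast
  define H where "H t u = Q t u + max 0 (N (\<gamma> t) u - \<rho>)" for t u
  have H0: "H t u = 0 \<longleftrightarrow> Q t u = 0 \<and> N (\<gamma> t) u \<le> \<rho>" for t u
    using Q(3)[of t u] by (auto simp: H_def add_nonneg_eq_0_iff max_def)
  have N: "(\<lambda>t. N (\<gamma> t) u) \<in> borel_measurable ?M" for u
    by (intro borel_measurable_continuous_on_restrict N_continuous_on continuous_on_subset[OF cont G] continuous_intros)
  have H1: "(\<lambda>t. H t u) \<in> borel_measurable ?M" for u
    unfolding H_def using Q(1)[of u] N[of u] by measurable
  have H2: "continuous_on UNIV (H t)" if "t \<in> space ?M" for t
    unfolding H_def using Q(2)[of t] that sp by (intro continuous_intros N_continuous_on) auto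
  have H3: "0 \<le> H t u" for t u using Q(3)[of t u] by (simp add: H_def)
  note sel = measurable_zero_selection[of d H ?M, OF d finite_dim_compact_cball[OF finite_dim_e] H1 H2 H3]
  show "{t \<in> G. \<exists>u. Q t u = 0 \<and> N (\<gamma> t) u \<le> \<rho>} \<in> sets ?M"
    using sel(1) unfolding sp H0 .
  show "\<exists>u. u \<in> borel_measurable (restrict_space borel G) \<and>
      (\<forall>t\<in>G. (\<exists>u. Q t u = 0 \<and> N (\<gamma> t) u \<le> \<rho>) \<longrightarrow> Q t (u t) = 0 \<and> N (\<gamma> t) (u t) \<le> \<rho>)"
    using sel(2) unfolding sp H0 .
qed

lemma speed_less_iff:
  "speed f N p v < y \<longleftrightarrow> (\<exists>u. f p u = v \<and> ennreal (N p u) < y)"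
  unfolding speed_def Inf_less_iff by auto

lemma speed_measurable:
  fixes Q :: "real \<Rightarrow> 'e \<Rightarrow> real"
  assumes cont: "continuous_on {a..b} \<gamma>" and G: "G \<subseteq> {a..b}"
    and Q: "\<And>u. (\<lambda>t. Q t u) \<in> borel_measurable (restrict_space borel G)"
      "\<And>t. t \<in> G \<Longrightarrow> continuous_on UNIV (Q t)" "\<And>t u. 0 \<le> Q t u"
      "\<And>t u. t \<in> G \<Longrightarrow> Q t u = 0 \<longleftrightarrow> f (\<gamma> t) u = v t"
  shows "(\<lambda>t. speed f N (\<gamma> t) (v t)) \<in> borel_measurable (restrict_space borel G)"
proof (rule borel_measurableI_less)
  fix y :: ennreal
  have sp: "space (restrict_space borel G) = G" by (simp add: space_restrict_space)
  let ?R = "{\<rho> \<in> \<rat>. 0 \<le> \<rho> \<and> ennreal \<rho> < y}"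
  have "speed f N (\<gamma> t) (v t) < y \<longleftrightarrow> (\<exists>\<rho>\<in>?R. \<exists>u. Q t u = 0 \<and> N (\<gamma> t) u \<le> \<rho>)" if t: "t \<in> G" for t
  proof
    assume "speed f N (\<gamma> t) (v t) < y"
    then obtain u where u: "f (\<gamma> t) u = v t" "ennreal (N (\<gamma> t) u) < y" unfolding speed_less_iff by blast
    then obtain z where z: "ennreal (N (\<gamma> t) u) < z" "z < y" using dense by blast
    obtain x where x: "z = ennreal x" "x \<ge> 0" using z(2) by (cases z) auto
    have "N (\<gamma> t) u < x" using z(1) N_nonneg unfolding x by (simp add: ennreal_less_iff)
    then obtain \<rho> where \<rho>: "\<rho> \<in> \<rat>" "N (\<gamma> t) u < \<rho>" "\<rho> < x" using Rats_dense_in_real by blast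
    have "0 \<le> \<rho>" using N_nonneg[of "\<gamma> t" u] \<rho> by simp
    moreover have "ennreal \<rho> < y" using \<rho>(3) \<open>0 \<le> \<rho>\<close> z(2) unfolding x
      by (meson ennreal_less_iff less_trans)
    ultimately show "\<exists>\<rho>\<in>?R. \<exists>u. Q t u = 0 \<and> N (\<gamma> t) u \<le> \<rho>"
      using \<rho> u(1) Q(4)[OF t] by (intro bexI[of _ \<rho>] exI[of _ u]) auto
  next
    assume "\<exists>\<rho>\<in>?R. \<exists>u. Q t u = 0 \<and> N (\<gamma> t) u \<le> \<rho>"
    then obtain \<rho> u where "ennreal \<rho> < y" "Q t u = 0" "N (\<gamma> t) u \<le> \<rho>" by auto
    then show "speed f N (\<gamma> t) (v t) < y"
      unfolding speed_less_iff using Q(4)[OF t] by (meson ennreal_leI le_less_trans)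
  qed
  then have "{t \<in> space (restrict_space borel G). speed f N (\<gamma> t) (v t) < y}
      = (\<Union>\<rho>\<in>?R. {t \<in> G. \<exists>u. Q t u = 0 \<and> N (\<gamma> t) u \<le> \<rho>})"
    unfolding sp by blast
  also have "\<dots> \<in> sets (restrict_space borel G)"
  proof (rule sets.countable_UN')
    show "countable ?R" by (rule countable_subset[OF _ countable_rat]) auto
  qed (use controls_measurable(1)[OF cont G Q(1-3)] in blast)
  finally show "{t \<in> space (restrict_space borel G). speed f N (\<gamma> t) (v t) < y} \<in> sets (restrict_space borel G)" .
qed

section \<open>Uniqueness of trajectories\<close>

text \<open>
  In a chart the difference \<open>w\<close> of the two curves satisfies \<open>\<parallel>w'\<parallel> \<le> L C \<parallel>w\<parallel>\<close> almost everywhere. If \<open>m\<close> is the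
  maximum of \<open>\<parallel>w\<parallel>\<close> on an interval of length \<open>h\<close> that starts at a zero, the mean value inequality
  gives \<open>m \<le> L C m h\<close>, hence \<open>m = 0\<close> once \<open>L C h < 1\<close>.
\<close>

lemma trajectory_local_unique:
  assumes tr: "is_trajectory A f p u \<gamma>1" "is_trajectory A f p u \<gamma>2"
    and bd: "AE t in lebesgue_on {0..1}. norm (u t) \<le> C" and C: "0 \<le> C"
    and t0: "0 \<le> t0" "t0 < 1" "\<gamma>1 t0 = \<gamma>2 t0"
  obtains h where "h > 0" "t0 + h \<le> 1" "\<And>t. t \<in> {t0..t0 + h} \<Longrightarrow> \<gamma>1 t = \<gamma>2 t"
proof -
  obtain c where c: "c \<in> A" "\<gamma>1 t0 \<in> chart_dom c" using chart_ex by blast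
  note cc = is_chartD[OF chart[OF c(1)]]
  obtain r L where r: "r > 0" "L \<ge> 0"
    and L: "\<And>q q' u. q \<in> chart_dom c \<Longrightarrow> q' \<in> chart_dom c \<Longrightarrow> chart_map c q \<in> cball (chart_map c (\<gamma>1 t0)) r \<Longrightarrow>
      chart_map c q' \<in> cball (chart_map c (\<gamma>1 t0)) r \<Longrightarrow>
      norm (f q u c - f q' u c) \<le> L * norm (chart_map c q - chart_map c q') * norm u"
    using f_local_lipschitz[OF c] by metis
  have near: "\<exists>d>0. \<forall>t\<in>{0..1}. dist t t0 < d \<longrightarrow> \<gamma> t \<in> chart_dom c \<and> chart_map c (\<gamma> t) \<in> cball (chart_map c (\<gamma>1 t0)) r"
    if \<gamma>: "is_trajectory A f p u \<gamma>" "\<gamma> t0 = \<gamma>1 t0" for \<gamma>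
  proof -
    have "continuous_on {0..1} \<gamma>" using \<gamma>(1) by (simp add: is_trajectory_def abs_cont_curve_def)
    then have lim: "(\<gamma> \<longlongrightarrow> \<gamma>1 t0) (at t0 within {0..1})" using t0 \<gamma>(2) unfolding continuous_on_def by force
    have ev: "\<forall>\<^sub>F t in at t0 within {0..1}. \<gamma> t \<in> chart_dom c"
      by (rule topological_tendstoD[OF lim cc(1) c(2)])
    have "isCont (chart_map c) (\<gamma>1 t0)" using cc(1,2) c(2) continuous_on_eq_continuous_at by blast
    then have "((\<lambda>t. chart_map c (\<gamma> t)) \<longlongrightarrow> chart_map c (\<gamma>1 t0)) (at t0 within {0..1})"
      using lim by (rule isCont_tendsto_compose)
    then have "\<forall>\<^sub>F t in at t0 within {0..1}. dist (chart_map c (\<gamma> t)) (chart_map c (\<gamma>1 t0)) < r"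
      using r(1) by (rule tendstoD)
    from eventually_conj[OF ev this] obtain d where d: "d > 0"
      "\<And>t. t \<in> {0..1} \<Longrightarrow> t \<noteq> t0 \<Longrightarrow> dist t t0 < d \<Longrightarrow> \<gamma> t \<in> chart_dom c \<and> dist (chart_map c (\<gamma> t)) (chart_map c (\<gamma>1 t0)) < r"
      unfolding eventually_at by blast
    have "\<gamma> t \<in> chart_dom c \<and> chart_map c (\<gamma> t) \<in> cball (chart_map c (\<gamma>1 t0)) r" if "t \<in> {0..1}" "dist t t0 < d" for t
      using d(2)[OF that(1) _ that(2)] \<gamma>(2) c(2) r(1) by (cases "t = t0") (auto simp: dist_commute less_imp_le)
    then show ?thesis using d(1) by blast
  qed
  obtain d1 where d1: "d1 > 0" "\<And>t. t \<in> {0..1} \<Longrightarrow> dist t t0 < d1 \<Longrightarrow> \<gamma>1 t \<in> chart_dom c \<and> chart_map c (\<gamma>1 t) \<in> cball (chart_map c (\<gamma>1 t0)) r"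
    using near[OF tr(1)] by blast
  obtain d2 where d2: "d2 > 0" "\<And>t. t \<in> {0..1} \<Longrightarrow> dist t t0 < d2 \<Longrightarrow> \<gamma>2 t \<in> chart_dom c \<and> chart_map c (\<gamma>2 t) \<in> cball (chart_map c (\<gamma>1 t0)) r"
    using near[OF tr(2)] t0(3) by fastforce
  \<comment> \<open>the last entry makes the Lipschitz estimate a strict contraction\<close>
  define h where "h = Min {d1/2, d2/2, 1 - t0, 1 / (L * C + 1)}"
  have LC: "L * C \<ge> 0" using r(2) C by simp
  have hp: "h > 0" using d1(1) d2(1) t0(2) LC by (simp add: h_def)
  have h_le: "h \<le> d1/2" "h \<le> d2/2" "h \<le> 1 - t0" "h \<le> 1 / (L * C + 1)" unfolding h_def by (rule Min_le; simp)+
  have LCh: "L * C * h < 1"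
  proof -
    have "L * C * h \<le> L * C * (1 / (L * C + 1))" using h_le(4) LC by (intro mult_left_mono) auto
    also have "\<dots> < 1" using LC by (simp add: field_simps)
    finally show ?thesis .
  qed
  let ?J = "{t0..t0 + h}"
  have J: "?J \<subseteq> {0..1}" using t0 h_le(3) by auto
  have in1: "\<gamma>1 t \<in> chart_dom c" "chart_map c (\<gamma>1 t) \<in> cball (chart_map c (\<gamma>1 t0)) r"
    and in2: "\<gamma>2 t \<in> chart_dom c" "chart_map c (\<gamma>2 t) \<in> cball (chart_map c (\<gamma>1 t0)) r" if t: "t \<in> ?J" for t
  proof -
    have "dist t t0 < d1" "dist t t0 < d2" using t hp h_le d1(1) d2(1) by (auto simp: dist_real_def)
    then show "\<gamma>1 t \<in> chart_dom c" "chart_map c (\<gamma>1 t) \<in> cball (chart_map c (\<gamma>1 t0)) r"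
      "\<gamma>2 t \<in> chart_dom c" "chart_map c (\<gamma>2 t) \<in> cball (chart_map c (\<gamma>1 t0)) r"
      using d1(2)[of t] d2(2)[of t] t J by auto
  qed
  define w where "w t = (chart_map c \<circ> \<gamma>1) t - (chart_map c \<circ> \<gamma>2) t" for t
  have ac: "abs_cont t0 (t0 + h) w"
  proof -
    have "abs_cont t0 (t0 + h) (chart_map c \<circ> \<gamma>1)" "abs_cont t0 (t0 + h) (chart_map c \<circ> \<gamma>2)"
      using tr c(1) t0 hp h_le(3) in1(1) in2(1) unfolding is_trajectory_def
      by (auto intro!: abs_cont_curve_chart)
    then show ?thesis unfolding w_def[abs_def] by (rule abs_cont_diff)
  qed
  have "continuous_on ?J (\<lambda>t. norm (w t))" by (intro continuous_on_norm abs_cont_imp_continuous[OF ac])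
  then obtain tm where tm: "tm \<in> ?J" "\<And>t. t \<in> ?J \<Longrightarrow> norm (w t) \<le> norm (w tm)"
    using continuous_attains_sup[of ?J "\<lambda>t. norm (w t)"] hp by auto
  define m where "m = norm (w tm)"
  have "AE t in lebesgue_on {0..1}. has_velocity A \<gamma>1 (f (\<gamma>1 t) (u t)) t {0..1} \<and>
      has_velocity A \<gamma>2 (f (\<gamma>2 t) (u t)) t {0..1} \<and> norm (u t) \<le> C"
    using tr bd by (auto simp: is_trajectory_def)
  then have neg: "negligible {t \<in> {0..1}. \<not> (has_velocity A \<gamma>1 (f (\<gamma>1 t) (u t)) t {0..1} \<and>
      has_velocity A \<gamma>2 (f (\<gamma>2 t) (u t)) t {0..1} \<and> norm (u t) \<le> C)}" (is "negligible ?Z")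
    by (subst (asm) AE_lebesgue_on_iff_negligible) auto
  have "norm (w tm - w t0) \<le> L * m * C * (tm - t0)"
  proof (rule abs_cont_mean_value[OF abs_cont_subinterval[OF ac] _ neg])
    show "0 \<le> L * m * C" using r(2) C by (simp add: m_def)
    fix t assume t: "t \<in> {t0..tm} - ?Z"
    then have tJ: "t \<in> ?J" using tm(1) by auto
    then have "t \<in> {0..1}" using J by blast
    then have vel: "has_velocity A \<gamma>1 (f (\<gamma>1 t) (u t)) t {0..1}" "has_velocity A \<gamma>2 (f (\<gamma>2 t) (u t)) t {0..1}"
      and uC: "norm (u t) \<le> C" using t by auto
    have sub: "{t0..tm} \<subseteq> {0..1}" using tm(1) J by auto
    have "((chart_map c \<circ> \<gamma>1) has_vector_derivative f (\<gamma>1 t) (u t) c) (at t within {0..1})"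
      "((chart_map c \<circ> \<gamma>2) has_vector_derivative f (\<gamma>2 t) (u t) c) (at t within {0..1})"
      using vel c(1) in1(1)[OF tJ] in2(1)[OF tJ] unfolding has_velocity_def by blast+
    then have "(w has_vector_derivative (f (\<gamma>1 t) (u t) c - f (\<gamma>2 t) (u t) c)) (at t within {0..1})"
      unfolding w_def[abs_def] by (rule has_vector_derivative_diff)
    then have 1: "(w has_vector_derivative (f (\<gamma>1 t) (u t) c - f (\<gamma>2 t) (u t) c)) (at t within {t0..tm})"
      using sub by (rule has_vector_derivative_within_subset)
    have "norm (f (\<gamma>1 t) (u t) c - f (\<gamma>2 t) (u t) c) \<le> L * norm (w t) * norm (u t)"
      using L[OF in1(1)[OF tJ] in2(1)[OF tJ] in1(2)[OF tJ] in2(2)[OF tJ]] by (simp add: w_def)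
    also have "\<dots> \<le> L * m * C"
      using tm(2)[OF tJ] uC r(2) by (intro mult_mono mult_left_mono) (auto simp: m_def)
    finally show "\<exists>D. (w has_vector_derivative D) (at t within {t0..tm}) \<and> norm D \<le> L * m * C" using 1 by blast
  qed (use tm(1) in auto)
  moreover have "w t0 = 0" using t0(3) by (simp add: w_def)
  ultimately have "m \<le> L * m * C * (tm - t0)" by (simp add: m_def)
  also have "\<dots> \<le> L * m * C * h" using tm(1) r(2) C by (intro mult_left_mono) (auto simp: m_def)
  finally have "m \<le> m * (L * C * h)" by (simp add: mult_ac)
  then have "m * (1 - L * C * h) \<le> 0" by (simp add: algebra_simps)
  then have "m \<le> 0" using LCh by (simp add: mult_le_0_iff)
  have "\<gamma>1 t = \<gamma>2 t" if t: "t \<in> ?J" for t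
  proof -
    have "norm (w t) \<le> 0" using tm(2)[OF t] \<open>m \<le> 0\<close> by (simp add: m_def)
    then have "chart_map c (\<gamma>1 t) = chart_map c (\<gamma>2 t)" by (simp add: w_def)
    then show ?thesis using inj_onD[OF cc(3)] in1(1)[OF t] in2(1)[OF t] by blast
  qed
  then show ?thesis using that[of h] hp h_le(3) by simp
qed

lemma trajectory_unique:
  assumes tr: "is_trajectory A f p u \<gamma>1" "is_trajectory A f p u \<gamma>2"
    and u: "u \<in> Linf" and t: "t \<in> {0..1}"
  shows "\<gamma>1 t = \<gamma>2 t"
proof -
  obtain C0 where C0: "AE t in lebesgue_on {0..1}. norm (u t) \<le> C0" using u by (auto simp: Linf_def)
  define C where "C = max 0 C0"
  have C: "AE t in lebesgue_on {0..1}. norm (u t) \<le> C" "0 \<le> C"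
    using C0 by (auto simp: C_def elim!: eventually_mono)
  have cont: "continuous_on {0..1} \<gamma>1" "continuous_on {0..1} \<gamma>2" and init: "\<gamma>1 0 = p" "\<gamma>2 0 = p"
    using tr by (auto simp: is_trajectory_def abs_cont_curve_def)
  define S where "S = {t \<in> {0..1}. \<forall>s\<in>{0..t}. \<gamma>1 s = \<gamma>2 s}"
  have S0: "0 \<in> S" using init by (simp add: S_def)
  have S_bdd: "bdd_above S" by (rule bdd_aboveI[of _ 1]) (auto simp: S_def)
  define T where "T = Sup S"
  have T: "0 \<le> T" "T \<le> 1"
    unfolding T_def using cSup_upper[OF S0 S_bdd] S0 by (auto intro!: cSup_least simp: S_def)
  have before: "\<gamma>1 s = \<gamma>2 s" if "0 \<le> s" "s < T" for s
  proof -
    obtain t where "t \<in> S" "s < t" using \<open>s < T\<close> S0 S_bdd unfolding T_def by (metis empty_iff less_cSup_iff)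
    then show ?thesis using that by (auto simp: S_def)
  qed
  \<comment> \<open>limits in \<open>M\<close> are unique because \<open>M\<close> is Hausdorff\<close>
  have atT: "\<gamma>1 T = \<gamma>2 T"
  proof (cases "T = 0")
    case False
    then have T0: "T > 0" using T by simp
    have l: "(\<gamma> \<longlongrightarrow> \<gamma> T) (at T within {0..<T})" if "continuous_on {0..1} \<gamma>" for \<gamma> :: "real \<Rightarrow> 'm"
    proof -
      have "(\<gamma> \<longlongrightarrow> \<gamma> T) (at T within {0..1})" using that T by (simp add: continuous_on_def)
      then show ?thesis by (rule tendsto_within_subset) (use T in auto)
    qed
    have ne: "at T within {0..<T} \<noteq> bot"
      using T0 by (simp add: trivial_limit_within)
    have "\<forall>\<^sub>F s in at T within {0..<T}. \<gamma>1 s = \<gamma>2 s"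
      unfolding eventually_at_filter by (rule always_eventually) (use before in auto)
    then have "(\<gamma>2 \<longlongrightarrow> \<gamma>1 T) (at T within {0..<T})"
      using l[OF cont(1)] by (rule Lim_transform_eventually[rotated])
    then show ?thesis using l[OF cont(2)] ne tendsto_unique by blast
  qed (use init in simp)
  have "T = 1"
  proof (rule ccontr)
    assume "T \<noteq> 1"
    then have "T < 1" using T by simp
    from trajectory_local_unique[OF tr C T(1) this atT]
    obtain h where h: "h > 0" "T + h \<le> 1" "\<And>t. t \<in> {T..T + h} \<Longrightarrow> \<gamma>1 t = \<gamma>2 t" by blast
    have "\<gamma>1 s = \<gamma>2 s" if "s \<in> {0..T + h}" for s
      using before[of s] h(3)[of s] that by (cases "s < T") auto
    then have "T + h \<in> S" using h T by (auto simp: S_def)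
    then have "T + h \<le> T" unfolding T_def by (rule cSup_upper[OF _ S_bdd])
    then show False using h(1) by simp
  qed
  then show ?thesis using before[of t] atT t by (cases "t = 1") auto
qed

section \<open>Length and energy\<close>

lemma curve_length_le_energy:
  assumes u: "u \<in> Linf" and q: "End_point A f p u = Some q"
  obtains \<gamma> where "abs_cont_curve A 0 1 \<gamma>" "\<gamma> 0 = p" "\<gamma> 1 = q" "curve_length A f N 0 1 \<gamma> \<le> energy A f N p u"
proof -
  have ex: "\<exists>\<gamma>. is_trajectory A f p u \<gamma>" using q by (auto simp: End_point_def split: if_splits)
  define \<gamma> where "\<gamma> = trajectory A f p u"
  have \<gamma>: "is_trajectory A f p u \<gamma>" unfolding \<gamma>_def trajectory_def using ex by (rule someI_ex)
  have "\<gamma> 1 = q" using q ex by (simp add: End_point_def \<gamma>_def)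
  let ?M = "lebesgue_on {0..1::real}"
  have "AE t in ?M. ennreal (N (\<gamma> t) (u t)) \<le> energy A f N p u"
    unfolding energy_def \<gamma>_def by (rule esssup_AE)
  moreover have "AE t in ?M. has_velocity A \<gamma> (f (\<gamma> t) (u t)) t {0..1}"
    using \<gamma> by (simp add: is_trajectory_def)
  moreover have "AE t in ?M. t \<in> {0..1}" by (rule AE_I2) (simp add: space_restrict_space)
  ultimately have "AE t in ?M. speed f N (\<gamma> t) (velocity A \<gamma> {0..1} t) \<le> energy A f N p u"
  proof eventually_elim
    case (elim t)
    have "f (\<gamma> t) (u t) = velocity A \<gamma> {0..1} t"
      using elim(2,3) at_within_Icc_neq_bot[of 0 1 t] by (intro has_velocity_unique) auto
    then have "speed f N (\<gamma> t) (velocity A \<gamma> {0..1} t) \<le> ennreal (N (\<gamma> t) (u t))"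
      unfolding speed_def by (intro Inf_lower) blast
    then show ?case using elim(1) by (rule order_trans)
  qed
  then have "curve_length A f N 0 1 \<gamma> \<le> (\<integral>\<^sup>+t. energy A f N p u \<partial>?M)"
    unfolding curve_length_def by (rule nn_integral_mono_AE)
  also have "\<dots> = energy A f N p u"
    by (simp add: emeasure_restrict_space space_restrict_space)
  finally show ?thesis using that[of \<gamma>] \<gamma> \<open>\<gamma> 1 = q\<close> by (simp add: is_trajectory_def)
qed

text \<open>
  Controls of norm at most \<open>\<Lambda>\<close> that produce the velocity of \<open>\<gamma>\<close> are selected measurably. On the compact
  image of \<open>\<gamma>\<close> the norms \<open>N p\<close> are uniformly equivalent to the given one, so the selected control is
  bounded; by uniqueness its trajectory is \<open>\<gamma>\<close>.
\<close>

lemma cc_dist_le_of_speed_bound: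
  assumes ac: "abs_cont_curve A 0 1 \<gamma>" and pq: "\<gamma> 0 = p" "\<gamma> 1 = q" and \<Lambda>: "0 \<le> \<Lambda>"
    and bound: "negligible {t \<in> {0..1}. \<not> (\<exists>u. f (\<gamma> t) u = velocity A \<gamma> {0..1} t \<and> N (\<gamma> t) u \<le> \<Lambda>)}"
  shows "cc_dist A f N p q \<le> ennreal \<Lambda>"
proof -
  have cont: "continuous_on {0..1} \<gamma>" using ac by (simp add: abs_cont_curve_def)
  obtain G :: "real set" and Q :: "real \<Rightarrow> 'e \<Rightarrow> real" where G: "G \<in> sets borel" "G \<subseteq> {0<..<1}" "negligible ({0..1} - G)"
    and Q: "\<And>u. (\<lambda>t. Q t u) \<in> borel_measurable (restrict_space borel G)"
    "\<And>t. t \<in> G \<Longrightarrow> continuous_on UNIV (Q t)" "\<And>t u. 0 \<le> Q t u"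
    and vel: "\<And>t. t \<in> G \<Longrightarrow> has_velocity A \<gamma> (velocity A \<gamma> {0..1} t) t {0..1}"
    and Q0: "\<And>t u. t \<in> G \<Longrightarrow> Q t u = 0 \<longleftrightarrow> f (\<gamma> t) u = velocity A \<gamma> {0..1} t"
    using velocity_caratheodory[OF ac zero_less_one] by blast
  have G01: "G \<subseteq> {0..1}" using G(2) by auto
  define G' where "G' = {t \<in> G. \<exists>u. Q t u = 0 \<and> N (\<gamma> t) u \<le> \<Lambda>}"
  have "G' \<in> sets (restrict_space borel G)"
    unfolding G'_def by (rule controls_measurable(1)[OF cont G01 Q])
  then have G': "G' \<in> sets borel" using G(1) by (simp add: sets_restrict_space_iff)
  obtain u0 where u0: "u0 \<in> borel_measurable (restrict_space borel G)"
    "\<And>t. t \<in> G' \<Longrightarrow> Q t (u0 t) = 0 \<and> N (\<gamma> t) (u0 t) \<le> \<Lambda>"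
    using controls_measurable(2)[OF cont G01 Q, of \<Lambda>] unfolding G'_def by blast
  \<comment> \<open>outside \<open>G'\<close>, which has full measure, the value \<open>0\<close> keeps \<open>N (\<gamma> t) (u t) \<le> \<Lambda>\<close> true everywhere\<close>
  define u where "u t = (if t \<in> G' then u0 t else 0)" for t
  have "u0 \<in> borel_measurable (restrict_space (restrict_space borel G) G')"
    using u0(1) by (rule measurable_restrict_space1)
  then have "u0 \<in> borel_measurable (restrict_space borel G')"
    using G' G(1) by (subst (asm) restrict_restrict_space) (auto simp: G'_def Int_absorb1)
  then have u_borel: "u \<in> borel_measurable borel"
    unfolding u_def[abs_def] using G' by (subst measurable_If_restrict_space_iff) auto
  have u_meas: "u \<in> borel_measurable (lebesgue_on {0..1})"
    using u_borel by (intro measurable_restrict_space1 measurable_completion) simp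
  have u_le: "N (\<gamma> t) (u t) \<le> \<Lambda>" for t
    using u0(2)[of t] \<Lambda> N_zero_iff[of "\<gamma> t" 0] by (auto simp: u_def)
  have "compact (\<gamma> ` {0..1})" by (rule compact_continuous_image[OF cont]) simp
  then obtain k where k: "k > 0" "\<And>p u. p \<in> \<gamma> ` {0..1} \<Longrightarrow> k * norm u \<le> N p u"
    using N_lower_bound by metis
  have "norm (u t) \<le> \<Lambda> / k" if "t \<in> {0..1}" for t
    using k(2)[of "\<gamma> t" "u t"] u_le[of t] that k(1) by (simp add: field_simps)
  then have "AE t in lebesgue_on {0..1}. norm (u t) \<le> \<Lambda> / k"
    by (intro AE_I2) (simp add: space_restrict_space)
  then have Linf: "u \<in> Linf" using u_meas by (auto simp: Linf_def)
  have "AE t in lebesgue_on {0..1}. has_velocity A \<gamma> (f (\<gamma> t) (u t)) t {0..1}"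
  proof (subst AE_lebesgue_on_iff_negligible, simp)
    have "has_velocity A \<gamma> (f (\<gamma> t) (u t)) t {0..1}" if "t \<in> G'" for t
      using that u0(2)[OF that] Q0[of t "u0 t"] vel[of t] by (simp add: u_def G'_def)
    then have "{t \<in> {0..1}. \<not> has_velocity A \<gamma> (f (\<gamma> t) (u t)) t {0..1}} \<subseteq>
      ({0..1} - G) \<union> {t \<in> {0..1}. \<not> (\<exists>u. f (\<gamma> t) u = velocity A \<gamma> {0..1} t \<and> N (\<gamma> t) u \<le> \<Lambda>)}"
      using Q0 unfolding G'_def by blast
    then show "negligible {t \<in> {0..1}. \<not> has_velocity A \<gamma> (f (\<gamma> t) (u t)) t {0..1}}"
      by (rule negligible_subset[OF negligible_Un[OF G(3) bound]])
  qed
  then have tr: "is_trajectory A f p u \<gamma>" using ac pq(1) by (simp add: is_trajectory_def)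
  then have "is_trajectory A f p u (trajectory A f p u)" unfolding trajectory_def
    by (rule someI[of "is_trajectory A f p u"])
  then have eq: "trajectory A f p u t = \<gamma> t" if "t \<in> {0..1}" for t
    using trajectory_unique[OF _ tr Linf that] by blast
  have "End_point A f p u = Some q" using tr eq[of 1] pq(2) by (auto simp: End_point_def)
  then have "cc_dist A f N p q \<le> energy A f N p u"
    unfolding cc_dist_def using Linf by (intro Inf_lower) blast
  also have "\<dots> \<le> ennreal \<Lambda>"
    unfolding energy_def
  proof (rule esssup_I)
    obtain d :: "nat \<Rightarrow> 'e" where d: "\<And>v \<epsilon>. \<epsilon> > 0 \<Longrightarrow> \<exists>k. dist v (d k) < \<epsilon>"
      using finite_dim_countable_dense[OF finite_dim_e] by blast
    have "(\<lambda>t. N (\<gamma> t) (u t)) \<in> borel_measurable (lebesgue_on {0..1})"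
    proof (rule caratheodory_composition[of d "\<lambda>t. N (\<gamma> t)", OF d _ _ u_meas])
      show "(\<lambda>t. N (\<gamma> t) e) \<in> borel_measurable (lebesgue_on {0..1})" for e
        by (intro continuous_imp_measurable_on_sets_lebesgue N_continuous_on cont continuous_intros) simp
      show "continuous_on UNIV (N (\<gamma> t))" for t by (intro N_continuous_on continuous_intros)
    qed
    then have "(\<lambda>t. ennreal (N (\<gamma> t) (u t))) \<in> borel_measurable (lebesgue_on {0..1})" by measurable
    then show "(\<lambda>t. ennreal (N (trajectory A f p u t) (u t))) \<in> borel_measurable (lebesgue_on {0..1})"
      by (rule measurable_cong[THEN iffD1, rotated]) (simp add: eq space_restrict_space)
    show "AE t in lebesgue_on {0..1}. ennreal (N (trajectory A f p u t) (u t)) \<le> ennreal \<Lambda>"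
      by (rule AE_I2) (use u_le eq in \<open>auto intro!: ennreal_leI simp: space_restrict_space\<close>)
  qed
  finally show ?thesis .
qed

lemma abs_cont_curve_compose_mono:
  assumes ac: "abs_cont_curve A (\<sigma> 0) (\<sigma> 1) \<gamma>"
    and \<sigma>: "\<And>x y. 0 \<le> x \<Longrightarrow> x < y \<Longrightarrow> y \<le> 1 \<Longrightarrow> \<sigma> x < \<sigma> y \<and> \<sigma> y - \<sigma> x \<le> K * (y - x)"
    and \<sigma>_cont: "continuous_on {0..1} \<sigma>"
  shows "abs_cont_curve A 0 1 (\<gamma> \<circ> \<sigma>)"
proof -
  have le: "\<sigma> x \<le> \<sigma> y" if "0 \<le> x" "x \<le> y" "y \<le> 1" for x y
    using \<sigma>[of x y] that by (cases "x = y") auto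
  have cont: "continuous_on {\<sigma> 0..\<sigma> 1} \<gamma>" using ac by (simp add: abs_cont_curve_def)
  have img: "\<sigma> ` {s..t} = {\<sigma> s..\<sigma> t}" if st: "0 \<le> s" "s \<le> t" "t \<le> 1" for s t
  proof (intro equalityI subsetI)
    fix y assume "y \<in> {\<sigma> s..\<sigma> t}"
    then have "\<exists>x. s \<le> x \<and> x \<le> t \<and> \<sigma> x = y"
      by (intro IVT') (use st continuous_on_subset[OF \<sigma>_cont, of "{s..t}"] in auto)
    then show "y \<in> \<sigma> ` {s..t}" by auto
  qed (use st le in auto)
  show ?thesis
    unfolding abs_cont_curve_def
  proof (intro conjI ballI allI impI)
    show "continuous_on {0..1} (\<gamma> \<circ> \<sigma>)"
      by (rule continuous_on_compose[OF \<sigma>_cont]) (simp add: img cont)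
    fix c s t assume c: "c \<in> A" and st: "0 \<le> s \<and> s \<le> t \<and> t \<le> 1 \<and> (\<gamma> \<circ> \<sigma>) ` {s..t} \<subseteq> chart_dom c"
    have "(\<gamma> \<circ> \<sigma>) ` {s..t} = \<gamma> ` {\<sigma> s..\<sigma> t}" using st img[of s t] by (metis image_comp)
    then have "\<gamma> ` {\<sigma> s..\<sigma> t} \<subseteq> chart_dom c" using st by simp
    then have "abs_cont (\<sigma> s) (\<sigma> t) (chart_map c \<circ> \<gamma>)"
      using st by (intro abs_cont_curve_chart[OF ac c] le) auto
    then have "abs_cont s t ((chart_map c \<circ> \<gamma>) \<circ> \<sigma>)"
      by (rule abs_cont_compose_mono[where K = K]) (use st \<sigma> in auto)
    then show "abs_cont s t (chart_map c \<circ> (\<gamma> \<circ> \<sigma>))" by (simp add: comp_assoc)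
  qed
qed

text \<open>
  The chain rule. As \<open>f\<close> is linear in the control, the factor \<open>D\<close> can be moved into the control.
\<close>

lemma has_velocity_compose:
  assumes v: "has_velocity A \<gamma> (f (\<gamma> (\<sigma> x)) u) (\<sigma> x) {a..b}" and \<sigma>x: "\<sigma> x \<in> {a<..<b}"
    and D: "(\<sigma> has_real_derivative D) (at x)"
  shows "has_velocity A (\<gamma> \<circ> \<sigma>) (f ((\<gamma> \<circ> \<sigma>) x) (D *\<^sub>R u)) x S"
  unfolding has_velocity_def
proof (intro conjI ballI impI)
  show "f ((\<gamma> \<circ> \<sigma>) x) (D *\<^sub>R u) \<in> tangent_space A ((\<gamma> \<circ> \<sigma>) x)" by (rule f_tangent)
  fix c assume c: "c \<in> A" "(\<gamma> \<circ> \<sigma>) x \<in> chart_dom c"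
  then have "((chart_map c \<circ> \<gamma>) has_vector_derivative f (\<gamma> (\<sigma> x)) u c) (at (\<sigma> x) within {a..b})"
    using v unfolding has_velocity_def by auto
  then have "((chart_map c \<circ> \<gamma>) has_vector_derivative f (\<gamma> (\<sigma> x)) u c) (at (\<sigma> x))"
    using at_within_interior[of "\<sigma> x" "{a..b}"] \<sigma>x by auto
  moreover have "(\<sigma> has_vector_derivative D) (at x)"
    using D by (simp add: has_real_derivative_iff_has_vector_derivative)
  ultimately have "(((chart_map c \<circ> \<gamma>) \<circ> \<sigma>) has_vector_derivative D *\<^sub>R f (\<gamma> (\<sigma> x)) u c) (at x)"
    by (rule vector_diff_chain_at[rotated])
  then show "((chart_map c \<circ> (\<gamma> \<circ> \<sigma>)) has_vector_derivative f ((\<gamma> \<circ> \<sigma>) x) (D *\<^sub>R u) c) (at x within S)"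
    by (simp add: comp_assoc f_scaleR has_vector_derivative_at_within)
qed

text \<open>
  For \<open>\<Lambda>\<close> above the length, \<open>\<gamma>\<close> is reparametrized with \<open>w\<close> slightly above its speed. Almost every
  point of \<open>[0,1]\<close> is one where \<open>\<sigma>\<close> has a derivative \<open>D\<close>, \<open>\<gamma>\<close> is differentiable at \<open>\<sigma>(x)\<close> and has finite
  speed there; a control \<open>u\<close> for \<open>\<gamma>\<close> with norm at most \<open>w\<close> then yields the control \<open>D u\<close> for \<open>\<gamma> \<circ> \<sigma>\<close>,
  whose norm is at most \<open>\<Lambda>\<close>.
\<close>

lemma cc_dist_le_curve_length:
  assumes ab: "a < b" and ac: "abs_cont_curve A a b \<gamma>" and pq: "\<gamma> a = p" "\<gamma> b = q"
  shows "cc_dist A f N p q \<le> curve_length A f N a b \<gamma>"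
proof (rule dense_ge)
  fix z assume z: "curve_length A f N a b \<gamma> < z"
  show "cc_dist A f N p q \<le> z"
  proof (cases z)
    case (real \<Lambda>)
    let ?V = "velocity A \<gamma> {a..b}"
    have cont: "continuous_on {a..b} \<gamma>" using ac by (simp add: abs_cont_curve_def)
    obtain G :: "real set" and Q :: "real \<Rightarrow> 'e \<Rightarrow> real" where G: "G \<in> sets borel" "G \<subseteq> {a<..<b}" "negligible ({a..b} - G)"
      and Q: "\<And>u. (\<lambda>t. Q t u) \<in> borel_measurable (restrict_space borel G)"
      "\<And>t. t \<in> G \<Longrightarrow> continuous_on UNIV (Q t)" "\<And>t u. 0 \<le> Q t u"
      and vel: "\<And>t. t \<in> G \<Longrightarrow> has_velocity A \<gamma> (?V t) t {a..b}"
      and Q0: "\<And>t u. t \<in> G \<Longrightarrow> Q t u = 0 \<longleftrightarrow> f (\<gamma> t) u = ?V t"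
      using velocity_caratheodory[OF ac ab] by blast
    have Gab: "G \<subseteq> {a..b}" using G(2) by auto
    define s where "s t = speed f N (\<gamma> t) (?V t) * indicator G t" for t
    have "(\<lambda>t. speed f N (\<gamma> t) (?V t)) \<in> borel_measurable (restrict_space borel G)"
      by (rule speed_measurable[OF cont Gab Q Q0])
    then have s: "s \<in> borel_measurable borel"
      unfolding s_def[abs_def] using G(1) by (subst (asm) borel_measurable_restrict_space_iff_ennreal) auto
    have "AE t in lebesgue. t \<notin> {a..b} - G"
      using G(3) by (intro AE_not_in) (simp add: negligible_iff_null_sets)
    then have "AE t in lebesgue. speed f N (\<gamma> t) (?V t) * indicator {a..b} t = s t * indicator {a..b} t"
      by eventually_elim (auto simp: s_def indicator_def)
    then have "(\<integral>\<^sup>+t. speed f N (\<gamma> t) (?V t) * indicator {a..b} t \<partial>lebesgue) = (\<integral>\<^sup>+t. s t * indicator {a..b} t \<partial>lebesgue)"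
      by (rule nn_integral_cong_AE)
    then have len: "curve_length A f N a b \<gamma> = (\<integral>\<^sup>+t. s t * indicator {a..b} t \<partial>lborel)"
      unfolding curve_length_def by (subst nn_integral_restrict_space) (auto simp: nn_integral_completion)
    obtain L where L: "curve_length A f N a b \<gamma> = ennreal L" "0 \<le> L"
      using z by (cases "curve_length A f N a b \<gamma>") auto
    have "L < \<Lambda>" using z L real by (simp add: ennreal_less_iff)
    define \<epsilon> where "\<epsilon> = (\<Lambda> - L) / (2 * (b - a))"
    have \<epsilon>: "\<epsilon> > 0" "L + \<epsilon> * (b - a) < \<Lambda>"
    proof -
      show "\<epsilon> > 0" using \<open>L < \<Lambda>\<close> ab by (simp add: \<epsilon>_def)
      have "\<epsilon> * (b - a) = (\<Lambda> - L) / 2" using ab by (simp add: \<epsilon>_def field_simps)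
      then show "L + \<epsilon> * (b - a) < \<Lambda>" using \<open>L < \<Lambda>\<close> by (simp add: field_simps)
    qed
    \<comment> \<open>strictly above the speed wherever that is finite, so that controls of norm at most \<open>w t\<close> exist\<close>
    define w where "w t = enn2real (s t) + \<epsilon>" for t
    have w: "w \<in> borel_measurable borel" "\<And>t. 0 \<le> w t"
      using s \<epsilon>(1) by (auto simp: w_def[abs_def])
    have "(\<integral>\<^sup>+t\<in>{a..b}. ennreal (w t) \<partial>lborel) \<le> (\<integral>\<^sup>+t. s t * indicator {a..b} t + ennreal \<epsilon> * indicator {a..b} t \<partial>lborel)"
    proof (rule nn_integral_mono)
      fix t
      have "ennreal (w t) = ennreal (enn2real (s t)) + ennreal \<epsilon>" using \<epsilon>(1) by (simp add: w_def)
      also have "\<dots> \<le> s t + ennreal \<epsilon>" by (intro add_right_mono) (simp add: ennreal_enn2real_if)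
      finally show "ennreal (w t) * indicator {a..b} t \<le> s t * indicator {a..b} t + ennreal \<epsilon> * indicator {a..b} t"
        by (simp add: indicator_def)
    qed
    also have "\<dots> = ennreal L + ennreal \<epsilon> * emeasure lborel {a..b}"
      using s len L(1) by (subst nn_integral_add) (auto simp: nn_integral_cmult_indicator)
    also have "\<dots> = ennreal (L + \<epsilon> * (b - a))"
      using ab \<epsilon>(1) L(2) by (simp add: ennreal_mult)
    also have "\<dots> < ennreal \<Lambda>" using \<epsilon>(2) L(2) \<open>L < \<Lambda>\<close> by (intro ennreal_lessI) auto
    finally have w_int: "(\<integral>\<^sup>+t\<in>{a..b}. ennreal (w t) \<partial>lborel) < ennreal \<Lambda>" .
    obtain \<sigma> :: "real \<Rightarrow> real" and K where \<sigma>01: "\<sigma> 0 = a" "\<sigma> 1 = b" and K: "K > 0"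
      and \<sigma>: "\<And>x y. 0 \<le> x \<Longrightarrow> x < y \<Longrightarrow> y \<le> 1 \<Longrightarrow> \<sigma> x < \<sigma> y \<and> \<sigma> y - \<sigma> x \<le> K * (y - x)"
      and \<sigma>_null: "\<And>Z. negligible Z \<Longrightarrow> negligible {x \<in> {0..1}. \<sigma> x \<in> Z}"
      and \<sigma>_deriv: "\<And>x D. x \<in> {0<..<1} \<Longrightarrow> (\<sigma> has_real_derivative D) (at x) \<Longrightarrow> D * w (\<sigma> x) \<le> \<Lambda>"
      using speed_reparametrization[OF ab w w_int] by blast
    have "abs_cont (\<sigma> 0) (\<sigma> 1) (\<lambda>t. t)"
      unfolding abs_cont_iff
    proof (intro allI impI exI conjI)
      fix \<epsilon> :: real and I assume \<epsilon>: "\<epsilon> > 0" and I: "interval_family (\<sigma> 0) (\<sigma> 1) I" "(\<Sum>(s, t)\<in>I. t - s) < \<epsilon>"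
      have "(\<Sum>(s, t)\<in>I. dist s t) = (\<Sum>(s, t)\<in>I. t - s)"
        using I(1) by (intro sum.cong) (auto simp: interval_family_def dist_real_def)
      then show "(\<Sum>(s, t)\<in>I. dist s t) < \<epsilon>" using I(2) by simp
    qed
    then have \<sigma>_ac: "abs_cont 0 1 \<sigma>"
      using abs_cont_compose_mono[of \<sigma> 0 1 "\<lambda>t. t" K] \<sigma> by (simp add: o_def)
    have ac': "abs_cont_curve A 0 1 (\<gamma> \<circ> \<sigma>)"
      by (rule abs_cont_curve_compose_mono[OF _ \<sigma> abs_cont_imp_continuous[OF \<sigma>_ac]]) (use ac \<sigma>01 in auto)
    have "cc_dist A f N p q \<le> ennreal \<Lambda>"
    proof (rule cc_dist_le_of_speed_bound[OF ac'])
      show "(\<gamma> \<circ> \<sigma>) 0 = p" "(\<gamma> \<circ> \<sigma>) 1 = q" using pq \<sigma>01 by auto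
      show "0 \<le> \<Lambda>" using real by simp
      have "(\<integral>\<^sup>+t. s t * indicator {a..b} t \<partial>lborel) \<noteq> \<infinity>"
        unfolding len[symmetric] L(1) by simp
      then have "AE t in lborel. s t * indicator {a..b} t \<noteq> \<infinity>"
        using s by (intro nn_integral_PInf_AE) auto
      then have "AE t in lebesgue. s t * indicator {a..b} t \<noteq> \<infinity>" by (rule AE_completion)
      then have "negligible {t. \<not> (s t * indicator {a..b} t \<noteq> \<infinity>)}"
        unfolding negligible_iff_null_sets by (subst (asm) completion.AE_iff_null_sets) simp
      then have "negligible (({a..b} - G) \<union> {t. \<not> (s t * indicator {a..b} t \<noteq> \<infinity>)})"
        by (rule negligible_Un[OF G(3)])
      from \<sigma>_null[OF this]
      have neg: "negligible ({x \<in> {0..1}. \<sigma> x \<in> ({a..b} - G) \<union> {t. \<not> (s t * indicator {a..b} t \<noteq> \<infinity>)}}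
          \<union> {x \<in> {0..1}. \<not> (\<exists>D. (\<sigma> has_real_derivative D) (at x))} \<union> {0, 1})" (is "negligible ?Z")
        by (intro negligible_Un abs_cont_ae_differentiable_real[OF \<sigma>_ac]) auto
      show "negligible {x \<in> {0..1}. \<not> (\<exists>u. f ((\<gamma> \<circ> \<sigma>) x) u = velocity A (\<gamma> \<circ> \<sigma>) {0..1} x \<and> N ((\<gamma> \<circ> \<sigma>) x) u \<le> \<Lambda>)}"
      proof (rule negligible_subset[OF neg], rule subsetI, rule ccontr)
        fix x assume x: "x \<in> {x \<in> {0..1}. \<not> (\<exists>u. f ((\<gamma> \<circ> \<sigma>) x) u = velocity A (\<gamma> \<circ> \<sigma>) {0..1} x \<and> N ((\<gamma> \<circ> \<sigma>) x) u \<le> \<Lambda>)}"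
          and nZ: "x \<notin> ?Z"
        have x01: "x \<in> {0<..<1}" using x nZ by auto
        have "\<sigma> x \<in> {a<..<b}" using \<sigma>[of 0 x] \<sigma>[of x 1] x01 \<sigma>01 by auto
        then have xG: "\<sigma> x \<in> G" "s (\<sigma> x) \<noteq> \<infinity>" using nZ x01 by auto
        obtain D where D: "(\<sigma> has_real_derivative D) (at x)" using nZ x01 by auto
        have D0: "D \<ge> 0"
        proof (rule tendsto_lowerbound)
          show "((\<lambda>y. (\<sigma> y - \<sigma> x) / (y - x)) \<longlongrightarrow> D) (at x)" using D by (simp add: has_field_derivative_iff)
          have "\<forall>\<^sub>F y in at x. y \<in> {0<..<1}" using x01 by (intro eventually_at_in_open') auto
          then show "\<forall>\<^sub>F y in at x. 0 \<le> (\<sigma> y - \<sigma> x) / (y - x)"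
          proof eventually_elim
            case (elim y)
            then show ?case using \<sigma>[of x y] \<sigma>[of y x] x01
              by (cases x y rule: linorder_cases) (auto simp: zero_le_divide_iff)
          qed
        qed simp
        have "s (\<sigma> x) < ennreal (w (\<sigma> x))"
        proof -
          have "s (\<sigma> x) = ennreal (enn2real (s (\<sigma> x)))" using xG(2) by (simp add: ennreal_enn2real_if)
          also have "\<dots> < ennreal (w (\<sigma> x))" using \<epsilon>(1) by (simp add: w_def ennreal_less_iff)
          finally show ?thesis .
        qed
        then have "speed f N (\<gamma> (\<sigma> x)) (?V (\<sigma> x)) < ennreal (w (\<sigma> x))" using xG(1) by (simp add: s_def)
        then obtain u where u: "f (\<gamma> (\<sigma> x)) u = ?V (\<sigma> x)" "ennreal (N (\<gamma> (\<sigma> x)) u) < ennreal (w (\<sigma> x))"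
          unfolding speed_less_iff by blast
        have Nu: "N (\<gamma> (\<sigma> x)) u \<le> w (\<sigma> x)" using u(2) N_nonneg by (simp add: ennreal_less_iff)
        have "has_velocity A (\<gamma> \<circ> \<sigma>) (f ((\<gamma> \<circ> \<sigma>) x) (D *\<^sub>R u)) x {0..1}"
          using vel[OF xG(1)] u(1) \<open>\<sigma> x \<in> {a<..<b}\<close> D by (intro has_velocity_compose) auto
        then have "f ((\<gamma> \<circ> \<sigma>) x) (D *\<^sub>R u) = velocity A (\<gamma> \<circ> \<sigma>) {0..1} x"
          using at_within_Icc_neq_bot[of 0 1 x] x01 by (intro has_velocity_unique) auto
        moreover have "N ((\<gamma> \<circ> \<sigma>) x) (D *\<^sub>R u) \<le> \<Lambda>"
        proof -
          have "N ((\<gamma> \<circ> \<sigma>) x) (D *\<^sub>R u) = D * N (\<gamma> (\<sigma> x)) u" using D0 by (simp add: N_scaleR)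
          also have "\<dots> \<le> D * w (\<sigma> x)" using Nu D0 by (rule mult_left_mono)
          also have "\<dots> \<le> \<Lambda>" by (rule \<sigma>_deriv[OF x01 D])
          finally show ?thesis .
        qed
        ultimately show False using x by blast
      qed
    qed
    then show ?thesis using real by simp
  qed simp
qed

end

theorem corollary3p19:
  fixes A :: "('m::{t2_space, second_countable_topology}, 'b::banach) chart set"
    and f :: "'m \<Rightarrow> 'e::banach \<Rightarrow> ('m, 'b) tvec"
    and N :: "'m \<Rightarrow> 'e \<Rightarrow> real"
    and p q :: 'm
  assumes "\<exists>B :: 'b set. finite B \<and> span B = UNIV"
    and "smooth_atlas A"
    and "\<exists>B :: 'e set. finite B \<and> span B = UNIV"
    and "lipschitz_vf_structure A f"
    and "continuously_varying_norm N"
  shows "cc_dist A f N p q =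
    Inf {curve_length A f N a b \<gamma> | a b \<gamma>.
      a < b \<and> abs_cont_curve A a b \<gamma> \<and> \<gamma> a = p \<and> \<gamma> b = q}"
proof (rule antisym)
  interpret polarized_manifold A f N by unfold_locales fact+
  show "cc_dist A f N p q \<le> Inf {curve_length A f N a b \<gamma> | a b \<gamma>.
      a < b \<and> abs_cont_curve A a b \<gamma> \<and> \<gamma> a = p \<and> \<gamma> b = q}"
    by (rule Inf_greatest) (use cc_dist_le_curve_length in blast)
  show "Inf {curve_length A f N a b \<gamma> | a b \<gamma>.
      a < b \<and> abs_cont_curve A a b \<gamma> \<and> \<gamma> a = p \<and> \<gamma> b = q} \<le> cc_dist A f N p q"
    unfolding cc_dist_def
  proof (rule Inf_greatest, clarify)
    fix u :: "real \<Rightarrow> 'e" assume "u \<in> Linf" "End_point A f p u = Some q"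
    then obtain \<gamma> where \<gamma>: "abs_cont_curve A 0 1 \<gamma>" "\<gamma> 0 = p" "\<gamma> 1 = q"
      "curve_length A f N 0 1 \<gamma> \<le> energy A f N p u"
      by (rule curve_length_le_energy)
    have "Inf {curve_length A f N a b \<gamma> | a b \<gamma>.
      a < b \<and> abs_cont_curve A a b \<gamma> \<and> \<gamma> a = p \<and> \<gamma> b = q} \<le> curve_length A f N 0 1 \<gamma>"
      by (rule Inf_lower) (use \<gamma>(1-3) zero_less_one in blast)
    then show "Inf {curve_length A f N a b \<gamma> | a b \<gamma>.
      a < b \<and> abs_cont_curve A a b \<gamma> \<and> \<gamma> a = p \<and> \<gamma> b = q} \<le> energy A f N p u"
      using \<gamma>(4) by (rule order_trans)
  qed
qed

end
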